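(* Let $m,\alpha,\beta$ be positive real numbers and let $\mathrm{Q}\in\{\mathbb{R}^2_{++},\mathbb{R}^2_{--}\}$. Then $\Lambda_{\alpha,\beta}\cap\bar{\mathrm{Q}}$ is a $\bar{\mathrm{Q}}$-local Fourier uniqueness set for $\mathrm{ACH}(\Gamma_m)$ if and only if $\alpha\beta m^2\le 4\pi^2$.
   Context: For a finite complex-valued Borel measure $\mu$ on $\mathbb{R}^2$, the Fourier transform is $\widehat\mu(\xi)=\int_{\mathbb{R}^2}e^{\pi i\langle x,\xi\rangle}\,d\mu(x)$ for $\xi\in\mathbb{R}^2$, where $\langle x,\xi\rangle=x_1\xi_1+x_2\xi_2$. For $m>0$, $\Gamma_m=\{x\in\mathbb{R}^2: x_1x_2=-m^2/(4\pi^2)\}$. Definition of $\mathrm{ACH}(\Gamma_m)$: for a finite complex Borel measure $\mu$ supported on $\Gamma_m$, its compression to the $x_1$-axis is the measure $\boldsymbol\pi_1\mu(A)=\mu(A\times\mathbb{R})$ on $\mathbb{R}$; $\mu$ is absolutely continuous with respect to arc length on $\Gamma_m$ iff $\boldsymbol\pi_1\mu$ is absolutely continuous with respect to Lebesgue measure. $\mathrm{AC}_0(\Gamma_m)$ is the space of those $\mu$ that are absolutely continuous with respect to arc length and satisfy $\mu(\mathbb{R}^2)=0$. The Hilbert transform on $\mathbb{R}$ is $\mathbf{H}[f](x)=\mathrm{pv}\,\frac1\pi\int_{\mathbb{R}}\frac{f(t)}{x-t}\,dt$ (as a distribution), and the Hilbert transform $\mathbf{H}_{\Gamma_m}$ on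 $\Gamma_m$ is the one corresponding to $\mathbf{H}$ under $\boldsymbol\pi_1$, i.e. $\boldsymbol\pi_1\mathbf{H}_{\Gamma_m}[\mu]=\mathbf{H}[\boldsymbol\pi_1\mu]$. $\mathrm{ACH}(\Gamma_m)$ is the space of $\mu\in\mathrm{AC}_0(\Gamma_m)$ with $\mathbf{H}_{\Gamma_m}[\mu]\in\mathrm{AC}_0(\Gamma_m)$. Equivalently, $\mu\in\mathrm{ACH}(\Gamma_m)$ iff $d\boldsymbol\pi_1\mu(t)=f(t)\,dt$ with $f\in L^1(\mathbb{R})$, $\int_{\mathbb{R}} f=0$, $\mathbf{H}[f]\in L^1(\mathbb{R})$ and $\int_{\mathbb{R}}\mathbf{H}[f]=0$. For $\alpha,\beta>0$, the lattice-cross is $\Lambda_{\alpha,\beta}=(\alpha\mathbb{Z}\times\{0\})\cup(\{0\}\times\beta\mathbb{Z})\subset\mathbb{R}^2$. $\mathbb{R}^2_{++}=\{\xi\in\mathbb{R}^2:\xi_1>0,\ \xi_2>0\}$ and $\mathbb{R}^2_{--}=\{\xi\in\mathbb{R}^2:\xi_1<0,\ \xi_2<0\}$ (the space-like quadrants); $\bar{\mathrm{Q}}$ is the closure of $\mathrm{Q}$. For $\Lambda\subset\mathrm{K}\subset\mathbb{R}^2$, $\Lambda$ is a $\mathrm{K}$-local Fourier uniqueness set for a linear space $X$ of finite complex Borel measures on $\mathbb{R}^2$ if every $\mu\in X$ with $\widehat\mu|_\Lambda=0$ satisfies $\widehat\mu|_{\mathrm{K}}=0$. *)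

theory Defs
  imports "HOL-Analysis.Analysis"
begin

text \<open>A complex Borel measure is a countably additive complex set function on the Borel sets;
  finiteness is then automatic.  Values on non-Borel sets are irrelevant throughout.\<close>

definition complex_borel_measure :: "('a::topological_space set \<Rightarrow> complex) \<Rightarrow> bool" where
  "complex_borel_measure \<mu> \<longleftrightarrow>
     \<mu> {} = 0 \<and>
     (\<forall>A :: nat \<Rightarrow> 'a set. range A \<subseteq> sets borel \<longrightarrow> disjoint_family A \<longrightarrow>
        (\<lambda>n. \<mu> (A n)) sums \<mu> (\<Union>n. A n))"

text \<open>The positive part of the Jordan decomposition of a finite signed Borel measure,
  \<open>\<nu>\<^sup>+(A) = sup {\<nu>(B). B \<subseteq> A Borel}\<close>; the negative part is \<open>(-\<nu>)\<^sup>+\<close>.  (Truncation of negative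
  numbers by \<open>ennreal\<close> does no harm, since \<open>B = {}\<close> is admitted.)\<close>

definition positive_variation :: "('a::topological_space set \<Rightarrow> real) \<Rightarrow> 'a measure" where
  "positive_variation \<nu> =
     measure_of UNIV (sets borel) (\<lambda>A. SUP B\<in>{B \<in> sets borel. B \<subseteq> A}. ennreal (\<nu> B))"

definition cm_integral ::
    "('a::topological_space set \<Rightarrow> complex) \<Rightarrow> ('a \<Rightarrow> complex) \<Rightarrow> complex" where
  "cm_integral \<mu> f =
     (integral\<^sup>L (positive_variation (\<lambda>A. Re (\<mu> A))) f
        - integral\<^sup>L (positive_variation (\<lambda>A. - Re (\<mu> A))) f)
     + \<i> * (integral\<^sup>L (positive_variation (\<lambda>A. Im (\<mu> A))) f
        - integral\<^sup>L (positive_variation (\<lambda>A. - Im (\<mu> A))) f)"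

definition fourier :: "((real \<times> real) set \<Rightarrow> complex) \<Rightarrow> real \<times> real \<Rightarrow> complex" where
  "fourier \<mu> \<xi> = cm_integral \<mu> (\<lambda>x. exp (\<i> * complex_of_real (pi * (x \<bullet> \<xi>))))"

definition test_function :: "(real \<Rightarrow> complex) \<Rightarrow> bool" where
  "test_function \<phi> \<longleftrightarrow>
     (\<exists>D :: nat \<Rightarrow> real \<Rightarrow> complex. D 0 = \<phi> \<and>
        (\<forall>k x. (D k has_vector_derivative D (Suc k) x) (at x))) \<and>
     compact (closure {x. \<phi> x \<noteq> 0})"

definition hilbert_truncated :: "(real set \<Rightarrow> complex) \<Rightarrow> real \<Rightarrow> real \<Rightarrow> complex" where
  "hilbert_truncated \<nu> \<epsilon> x =
     complex_of_real (1 / pi) *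
       cm_integral \<nu> (\<lambda>t. if \<bar>x - t\<bar> > \<epsilon> then complex_of_real (1 / (x - t)) else 0)"

text \<open>The distribution \<open>H[\<nu>] = pv (1/\<pi>) \<integral> d\<nu>(t) / (x - t)\<close> is the limit, in the sense of
  distributions, of the truncated integrals as \<open>\<epsilon> \<down> 0\<close>.  The following says that this
  distribution is (given by) the measure \<open>\<rho>\<close>.  For \<open>d\<nu> = f dt\<close> it is the Hilbert transform
  of the function \<open>f\<close>.\<close>

definition has_hilbert_transform :: "(real set \<Rightarrow> complex) \<Rightarrow> (real set \<Rightarrow> complex) \<Rightarrow> bool" where
  "has_hilbert_transform \<nu> \<rho> \<longleftrightarrow>
     (\<forall>\<phi>. test_function \<phi> \<longrightarrow>
        ((\<lambda>\<epsilon>. integral\<^sup>L lborel (\<lambda>x. hilbert_truncated \<nu> \<epsilon> x * \<phi> x))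
           \<longlongrightarrow> cm_integral \<rho> \<phi>) (at_right 0))"

definition hyperbola :: "real \<Rightarrow> (real \<times> real) set" where
  "hyperbola m = {x. fst x * snd x = - (m\<^sup>2 / (4 * pi\<^sup>2))}"

text \<open>Arc length on \<open>hyperbola m\<close>, via the parametrization \<open>t \<mapsto> (t, - c / t)\<close>, \<open>t \<noteq> 0\<close>, where
  \<open>c = m\<^sup>2 / (4 \<pi>\<^sup>2)\<close>, whose speed is \<open>sqrt (1 + (c / t\<^sup>2)\<^sup>2)\<close>.  The single parameter value
  \<open>t = 0\<close> is Lebesgue null and does not contribute.\<close>

definition arc_length :: "real \<Rightarrow> (real \<times> real) measure" where
  "arc_length m =
     (let c = m\<^sup>2 / (4 * pi\<^sup>2) in
       distr (density lborel (\<lambda>t. ennreal (sqrt (1 + (c / t\<^sup>2)\<^sup>2)))) borel (\<lambda>t. (t, - (c / t))))"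

definition compression :: "((real \<times> real) set \<Rightarrow> complex) \<Rightarrow> real set \<Rightarrow> complex" where
  "compression \<mu> A = \<mu> (A \<times> UNIV)"

text \<open>As \<open>hyperbola m\<close> is closed, \<open>\<mu>\<close> is supported on it iff \<open>\<mu>\<close> vanishes on all Borel sets
  disjoint from it.\<close>

definition AC0 :: "real \<Rightarrow> ((real \<times> real) set \<Rightarrow> complex) set" where
  "AC0 m = {\<mu>. complex_borel_measure \<mu> \<and>
     (\<forall>A\<in>sets borel. A \<inter> hyperbola m = {} \<longrightarrow> \<mu> A = 0) \<and>
     (\<forall>A\<in>null_sets (arc_length m). \<mu> A = 0) \<and>
     \<mu> UNIV = 0}"

text \<open>The measure \<open>\<rho>\<close> below is the Hilbert transform of \<open>\<mu>\<close> on the hyperbola: the one whose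
  compression is the Hilbert transform of the compression of \<open>\<mu>\<close>.\<close>

definition ACH :: "real \<Rightarrow> ((real \<times> real) set \<Rightarrow> complex) set" where
  "ACH m = {\<mu> \<in> AC0 m. \<exists>\<rho>\<in>AC0 m. has_hilbert_transform (compression \<mu>) (compression \<rho>)}"

definition local_fourier_uniqueness_set ::
    "(real \<times> real) set \<Rightarrow> (real \<times> real) set \<Rightarrow> ((real \<times> real) set \<Rightarrow> complex) set \<Rightarrow> bool" where
  "local_fourier_uniqueness_set \<Lambda> K X \<longleftrightarrow>
     \<Lambda> \<subseteq> K \<and> (\<forall>\<mu>\<in>X. (\<forall>\<xi>\<in>\<Lambda>. fourier \<mu> \<xi> = 0) \<longrightarrow> (\<forall>\<xi>\<in>K. fourier \<mu> \<xi> = 0))"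

definition lattice_cross :: "real \<Rightarrow> real \<Rightarrow> (real \<times> real) set" where
  "lattice_cross \<alpha> \<beta> =
     range (\<lambda>j::int. (\<alpha> * of_int j, 0)) \<union> range (\<lambda>k::int. (0, \<beta> * of_int k))"

definition quadrant_pp :: "(real \<times> real) set" where
  "quadrant_pp = {\<xi>. fst \<xi> > 0 \<and> snd \<xi> > 0}"

definition quadrant_mm :: "(real \<times> real) set" where
  "quadrant_mm = {\<xi>. fst \<xi> < 0 \<and> snd \<xi> < 0}"

end

theory Submission
  imports Defs
begin

text \<open>Write \<open>c = m\<^sup>2 / (4 \<pi>\<^sup>2)\<close>.  A measure in \<open>ACH m\<close> has a density \<open>f\<close> in the variable \<open>t = x\<^sub>1\<close>, and its Fourier
  transform is the integral of \<open>f\<close> against \<open>exp (\<i> \<pi> (\<xi>\<^sub>1 t - c \<xi>\<^sub>2 / t))\<close>, which for \<open>\<xi>\<close> in the closed first quadrant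
  is the boundary function of a bounded holomorphic function on the upper half-plane.  If \<open>g\<close> is the Hilbert
  transform of \<open>f\<close>, then \<open>f + \<i> g\<close> lies in the Hardy space \<open>H\<^sup>1\<close> of the upper half-plane and annihilates all
  these exponentials, while \<open>f - \<i> g\<close> lies in \<open>H\<^sup>1\<close> of the lower half-plane and annihilates their conjugates.
  So if the transform vanishes on half of the lattice-cross, \<open>f - \<i> g\<close> annihilates the exponentials of the
  whole lattice-cross.

  If \<open>\<gamma> = \<alpha> \<beta> c \<le> 1\<close>, this forces an integrable function to vanish: the relations on the two axes say that
  its parts inside and outside of \<open>[-1, 1]\<close> (after scaling) determine each other through the map
  \<open>t \<mapsto> - \<gamma> / t mod 2\<close>, and the mass that the iterates of its transfer operator transport from Lebesgue measure
  into a compact part of \<open>(-1, 1)\<close> is arbitrarily small, because of mass loss for \<open>\<gamma> < 1\<close> and because the invariant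
  density \<open>1 / (1 - t\<^sup>2)\<close> is not integrable for \<open>\<gamma> = 1\<close>.

  If \<open>\<gamma> > 1\<close>, there are two points of the upper half-plane at which all exponentials of the lattice-cross
  agree, and the difference of the Cauchy kernels at these points is a counterexample.\<close>

subsection \<open>Signed and complex measures\<close>

text \<open>Once \<open>f - \<i> * g\<close> vanishes, \<open>f\<close> is half of
  \<open>f + \<i> * g\<close>, so its transform is zero on the whole closed quadrant and not only on
  the cross. Hardy spaces are encoded by orthogonality to Cauchy kernels: partial fractions give
  stability under multiplication by kernels, and the exponentials are bounded limits of products of
  kernels. For uniqueness, the integral of \<open>F\<close> against a bounded function supported in
  the interval is majorized by that of a fixed integrable \<open>W\<close> against the n-th iterate
  of the bounded function. The iterate stays bounded by 1, so cutting \<open>W\<close> at a height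
  leaves only the integral of the iterate to be made small. Smallness at one point spreads over
  compact sets, because all iterates of the constant 1 obey a Harnack inequality whose constant is
  independent of n. For \<open>\<gamma> > 1\<close> both poles of the counterexample lie in the
  upper half-plane; it is therefore an eigenfunction of the Hilbert transform with eigenvalue
  \<open>\<i>\<close>, and its transform on the first quadrant is a difference of two point values.
  The other quadrant follows by conjugation.\<close>

lemma sets_positive_variation [simp, measurable_cong]: "sets (positive_variation \<nu>) = sets borel"
  unfolding positive_variation_def
  using sets.sigma_sets_eq[of borel] by (subst sets_measure_of) auto

lemma space_positive_variation [simp]: "space (positive_variation \<nu>) = UNIV"
  unfolding positive_variation_def by (subst space_measure_of) auto

context
  fixes \<nu> :: "'a::topological_space set \<Rightarrow> real"
  assumes \<nu>_empty: "\<nu> {} = 0"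
    and \<nu>_sums: "\<And>A :: nat \<Rightarrow> 'a set. range A \<subseteq> sets borel \<Longrightarrow> disjoint_family A \<Longrightarrow>
        (\<lambda>n. \<nu> (A n)) sums \<nu> (\<Union>n. A n)"
begin

lemma signed_measure_Un:
  assumes "A \<in> sets borel" "B \<in> sets borel" "A \<inter> B = {}"
  shows "\<nu> (A \<union> B) = \<nu> A + \<nu> B"
proof -
  have "(\<lambda>n. \<nu> (binaryset A B n)) sums \<nu> (\<Union>n. binaryset A B n)"
    using assms by (intro \<nu>_sums) (auto simp: range_binaryset_eq disjoint_family_on_def binaryset_def)
  moreover have "(\<lambda>n. \<nu> (binaryset A B n)) sums (\<nu> A + \<nu> B)"
    by (rule binaryset_sums) (rule \<nu>_empty)
  ultimately show ?thesis by (simp add: UN_binaryset_eq sums_unique2)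
qed

text \<open>If a set \<open>A\<close> had subsets of arbitrarily large measure, it would contain one such subset
  \<open>B\<close> with \<open>\<bar>\<mu> B\<bar>\<close> large; one of \<open>B\<close>, \<open>A - B\<close> again has subsets of arbitrarily large measure, and the
  other one is split off.  The pieces that are split off have measure at least 1 in modulus.\<close>

lemma signed_measure_bounded: "\<exists>K. \<forall>B\<in>sets borel. \<bar>\<nu> B\<bar> \<le> K"
proof (rule ccontr)
  assume unbounded: "\<not> ?thesis"
  define bad where "bad E \<longleftrightarrow> E \<in> sets borel \<and> (\<forall>K. \<exists>B\<in>sets borel. B \<subseteq> E \<and> \<bar>\<nu> B\<bar> > K)" for E :: "'a set"
  have step: "\<exists>E'. bad E' \<and> E' \<subseteq> E \<and> \<bar>\<nu> (E - E')\<bar> \<ge> 1" if E: "bad E" for E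
  proof -
    from E obtain B where B: "B \<in> sets borel" "B \<subseteq> E" "\<bar>\<nu> B\<bar> > \<bar>\<nu> E\<bar> + 1"
      unfolding bad_def by blast
    have E': "E \<in> sets borel" using E by (simp add: bad_def)
    have sp: "\<nu> E = \<nu> B + \<nu> (E - B)"
      using signed_measure_Un[of B "E - B"] B E' by (simp add: Un_absorb1)
    have "bad B \<or> bad (E - B)"
    proof (rule ccontr)
      assume "\<not> (bad B \<or> bad (E - B))"
      then obtain K1 K2 where K: "\<And>C. C \<in> sets borel \<Longrightarrow> C \<subseteq> B \<Longrightarrow> \<bar>\<nu> C\<bar> \<le> K1"
        "\<And>C. C \<in> sets borel \<Longrightarrow> C \<subseteq> E - B \<Longrightarrow> \<bar>\<nu> C\<bar> \<le> K2"
        using B E' unfolding bad_def by (metis not_le sets.Diff)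
      obtain C where C: "C \<in> sets borel" "C \<subseteq> E" "\<bar>\<nu> C\<bar> > K1 + K2"
        using E unfolding bad_def by blast
      have "\<nu> C = \<nu> (C \<inter> B) + \<nu> (C - B)"
        using signed_measure_Un[of "C \<inter> B" "C - B"] B C by (simp add: Int_Diff_Un Int_Diff_disjoint)
      moreover have "\<bar>\<nu> (C \<inter> B)\<bar> \<le> K1" using B C by (intro K) auto
      moreover have "\<bar>\<nu> (C - B)\<bar> \<le> K2" using B C by (intro K) auto
      ultimately show False using C by linarith
    qed
    then show ?thesis
    proof
      assume "bad B"
      moreover have "\<bar>\<nu> (E - B)\<bar> \<ge> 1" using sp B by linarith
      ultimately show ?thesis using B by blast
    next
      assume "bad (E - B)"
      moreover have "E - (E - B) = B" using B by blast
      moreover have "\<bar>\<nu> B\<bar> \<ge> 1" using B by linarith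
      ultimately show ?thesis by (metis Diff_subset)
    qed
  qed
  have bad_UNIV: "bad UNIV"
    unfolding bad_def using unbounded by (auto simp: not_le)
  have "\<exists>E. \<forall>n. bad (E n) \<and> E (Suc n) \<subseteq> E n \<and> \<bar>\<nu> (E n - E (Suc n))\<bar> \<ge> 1"
    using dependent_nat_choice[of "\<lambda>_. bad" "\<lambda>_ E E'. E' \<subseteq> E \<and> \<bar>\<nu> (E - E')\<bar> \<ge> 1"] step bad_UNIV
    by blast
  then obtain E where E: "\<And>n. bad (E n)" "\<And>n. E (Suc n) \<subseteq> E n"
      "\<And>n. \<bar>\<nu> (E n - E (Suc n))\<bar> \<ge> 1"
    by blast
  have dec: "decseq E" using E(2) by (intro decseq_SucI)
  have "disjoint_family (\<lambda>n. E n - E (Suc n))"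
    unfolding disjoint_family_on_def
  proof (intro ballI impI)
    fix m n :: nat assume "m \<noteq> n"
    then show "(E m - E (Suc m)) \<inter> (E n - E (Suc n)) = {}"
      using decseqD[OF dec, of "Suc m" n] decseqD[OF dec, of "Suc n" m] by (cases "m < n") auto
  qed
  moreover have "range (\<lambda>n. E n - E (Suc n)) \<subseteq> sets borel"
    using E(1) by (auto simp: bad_def)
  ultimately have "summable (\<lambda>n. \<nu> (E n - E (Suc n)))"
    using \<nu>_sums sums_summable by blast
  then have "(\<lambda>n. \<nu> (E n - E (Suc n))) \<longlonglongrightarrow> 0" by (rule summable_LIMSEQ_zero)
  then have "\<forall>\<^sub>F n in sequentially. dist (\<nu> (E n - E (Suc n))) 0 < 1"
    by (rule tendstoD) simp
  then obtain n where "\<bar>\<nu> (E n - E (Suc n))\<bar> < 1"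
    by (auto simp: eventually_sequentially)
  then show False using E(3)[of n] by linarith
qed

text \<open>Subadditivity: a competitor \<open>B\<close> inside the union is cut along the
  \<open>A i\<close>, and \<open>\<nu>\<close> is countably additive. Superadditivity: competitors
  in disjoint sets can be united, finitely many at a time. Only because the supremum is a measure
  does \<open>measure_of\<close> keep it; otherwise the result would be the zero measure.\<close>

lemma emeasure_positive_variation:
  assumes "X \<in> sets borel"
  shows "emeasure (positive_variation \<nu>) X = (SUP B\<in>{B \<in> sets borel. B \<subseteq> X}. ennreal (\<nu> B))"
proof -
  let ?P = "\<lambda>A. SUP B\<in>{B \<in> sets borel. B \<subseteq> A}. ennreal (\<nu> B)"
  have Pos: "positive (sets borel) ?P"
    by (auto simp: positive_def \<nu>_empty bot_ennreal[symmetric])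
  have "countably_additive (sets borel) ?P"
    unfolding countably_additive_def
  proof (intro allI impI)
    fix A :: "nat \<Rightarrow> 'a set"
    assume A: "range A \<subseteq> sets borel" "disjoint_family A" "(\<Union>i. A i) \<in> sets borel"
    show "(\<Sum>i. ?P (A i)) = ?P (\<Union>i. A i)"
    proof (rule antisym)
      show "?P (\<Union>i. A i) \<le> (\<Sum>i. ?P (A i))"
      proof (rule SUP_least)
        fix B assume B: "B \<in> {B \<in> sets borel. B \<subseteq> (\<Union>i. A i)}"
        have "(\<lambda>n. \<nu> (B \<inter> A n)) sums \<nu> (\<Union>n. B \<inter> A n)"
          using A B by (intro \<nu>_sums) (auto simp: disjoint_family_on_def)
        then have s: "(\<lambda>n. \<nu> (B \<inter> A n)) sums \<nu> B"
          using B by (simp add: Int_UN_distrib[symmetric] Int_absorb2)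
        show "ennreal (\<nu> B) \<le> (\<Sum>i. ?P (A i))"
        proof (rule LIMSEQ_le_const2)
          show "(\<lambda>n. ennreal (\<Sum>i<n. \<nu> (B \<inter> A i))) \<longlonglongrightarrow> ennreal (\<nu> B)"
            using s by (intro tendsto_ennrealI) (simp add: sums_def)
          have "ennreal (\<Sum>i<n. \<nu> (B \<inter> A i)) \<le> (\<Sum>i. ?P (A i))" for n
          proof -
            have "ennreal (\<Sum>i<n. \<nu> (B \<inter> A i)) \<le> (\<Sum>i<n. ennreal (\<nu> (B \<inter> A i)))"
            proof (induction n)
              case (Suc n)
              have "ennreal (x + y) \<le> ennreal x + ennreal y" for x y
                by (cases "x \<ge> 0"; cases "y \<ge> 0") (auto simp: ennreal_neg ennreal_leI simp flip: ennreal_plus)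
              then show ?case using Suc by (simp, meson add_right_mono order_trans)
            qed simp
            also have "\<dots> \<le> (\<Sum>i<n. ?P (A i))"
              using A B by (intro sum_mono SUP_upper) auto
            also have "\<dots> \<le> (\<Sum>i. ?P (A i))" by (intro sum_le_suminf) auto
            finally show ?thesis .
          qed
          then show "\<exists>N. \<forall>n\<ge>N. ennreal (\<Sum>i<n. \<nu> (B \<inter> A i)) \<le> (\<Sum>i. ?P (A i))" by blast
        qed
      qed
      have fin: "(\<Sum>i<n. ?P (A i)) \<le> ?P (\<Union>i<n. A i)" for n
      proof (induction n)
        case 0
        then show ?case by simp
      next
        case (Suc n)
        have dis: "(\<Union>i<n. A i) \<inter> A n = {}"
        proof -
          have "A i \<inter> A n = {}" if "i < n" for i
            using disjoint_family_onD[OF A(2), of i n] that by simp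
          then show ?thesis by blast
        qed
        have sub: "?P X + ?P Y \<le> ?P (X \<union> Y)" if XY: "X \<inter> Y = {}" for X Y
        proof -
          have pair: "ennreal (\<nu> B) + ennreal (\<nu> C) \<le> ?P (X \<union> Y)"
            if B: "B \<in> sets borel" "B \<subseteq> X" and C: "C \<in> sets borel" "C \<subseteq> Y" for B C
          proof -
            have up: "ennreal (\<nu> D) \<le> ?P (X \<union> Y)" if "D \<in> sets borel" "D \<subseteq> X \<union> Y" for D
              using that by (intro SUP_upper) auto
            \<comment> \<open>Negative values are truncated to 0 by \<open>ennreal\<close>, so a
              competitor of negative measure is dropped rather than united with the other
              one.\<close>
            consider "\<nu> B \<le> 0" | "\<nu> C \<le> 0" | "\<nu> B \<ge> 0" "\<nu> C \<ge> 0" by linarith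
            then show ?thesis
            proof cases
              case 1
              then show ?thesis using up[of C] C by (auto simp: ennreal_neg)
            next
              case 2
              then show ?thesis using up[of B] B by (auto simp: ennreal_neg)
            next
              case 3
              have "\<nu> (B \<union> C) = \<nu> B + \<nu> C" using B C XY by (intro signed_measure_Un) auto
              then show ?thesis using 3 up[of "B \<union> C"] B C by (auto simp flip: ennreal_plus)
            qed
          qed
          have left: "ennreal (\<nu> B) + ?P Y \<le> ?P (X \<union> Y)" if "B \<in> sets borel" "B \<subseteq> X" for B
          proof -
            have "ennreal (\<nu> B) + ?P Y = (SUP C\<in>{C \<in> sets borel. C \<subseteq> Y}. ennreal (\<nu> B) + ennreal (\<nu> C))"
              by (rule ennreal_SUP_add_right) blast
            also have "\<dots> \<le> ?P (X \<union> Y)"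
              using pair that by (intro SUP_least) simp
            finally show ?thesis .
          qed
          have "?P X + ?P Y = (SUP B\<in>{B \<in> sets borel. B \<subseteq> X}. ennreal (\<nu> B) + ?P Y)"
            by (rule ennreal_SUP_add_left[symmetric]) blast
          also have "\<dots> \<le> ?P (X \<union> Y)"
            using left by (intro SUP_least) simp
          finally show ?thesis .
        qed
        have "(\<Sum>i<Suc n. ?P (A i)) \<le> ?P (\<Union>i<n. A i) + ?P (A n)"
          using Suc by (simp add: add_right_mono)
        also have "\<dots> \<le> ?P ((\<Union>i<n. A i) \<union> A n)" by (rule sub[OF dis])
        also have "(\<Union>i<n. A i) \<union> A n = (\<Union>i<Suc n. A i)" by (auto simp: lessThan_Suc)
        finally show ?case .
      qed
      have "(\<Sum>i<n. ?P (A i)) \<le> ?P (\<Union>i. A i)" for n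
        by (rule order_trans[OF fin]) (intro SUP_subset_mono, auto)
      then show "(\<Sum>i. ?P (A i)) \<le> ?P (\<Union>i. A i)"
        by (intro suminf_le_const) auto
    qed
  qed
  moreover have "sigma_algebra (UNIV :: 'a set) (sets borel)"
    using sets.sigma_algebra_axioms[of "borel :: 'a measure"] by simp
  ultimately show ?thesis
    using assms unfolding positive_variation_def
    by (intro emeasure_measure_of_sigma Pos)
qed

lemma finite_measure_positive_variation: "finite_measure (positive_variation \<nu>)"
proof
  obtain K where K: "\<And>B. B \<in> sets borel \<Longrightarrow> \<bar>\<nu> B\<bar> \<le> K" using signed_measure_bounded by blast
  have "emeasure (positive_variation \<nu>) UNIV \<le> ennreal K"
    by (subst emeasure_positive_variation) (auto intro!: SUP_least ennreal_leI order_trans[OF abs_ge_self] K)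
  then show "emeasure (positive_variation \<nu>) (space (positive_variation \<nu>)) \<noteq> \<infinity>"
    by (simp add: top_unique) (metis ennreal_less_top leD top.not_eq_extremum)
qed

lemma le_measure_positive_variation:
  assumes "A \<in> sets borel" "B \<in> sets borel" "B \<subseteq> A"
  shows "\<nu> B \<le> measure (positive_variation \<nu>) A"
proof -
  interpret finite_measure "positive_variation \<nu>" by (rule finite_measure_positive_variation)
  have "ennreal (\<nu> B) \<le> emeasure (positive_variation \<nu>) A"
    using assms by (subst emeasure_positive_variation) (auto intro: SUP_upper)
  then show ?thesis by (simp add: emeasure_eq_measure)
qed

lemma measure_positive_variation_le:
  assumes "A \<in> sets borel" "\<And>B. B \<in> sets borel \<Longrightarrow> B \<subseteq> A \<Longrightarrow> \<nu> B \<le> x"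
  shows "measure (positive_variation \<nu>) A \<le> x"
proof -
  interpret finite_measure "positive_variation \<nu>" by (rule finite_measure_positive_variation)
  have "0 \<le> x" using assms(2)[of "{}"] \<nu>_empty by simp
  have "emeasure (positive_variation \<nu>) A \<le> ennreal x"
    using assms by (subst emeasure_positive_variation) (auto intro!: SUP_least ennreal_leI)
  then show ?thesis using \<open>0 \<le> x\<close> by (simp add: emeasure_eq_measure)
qed

end

text \<open>Complements inside \<open>A\<close> exchange the two suprema: since
  \<open>\<nu> B = \<nu> A - \<nu> (A - B)\<close>, a bound for \<open>- \<nu>\<close> on subsets of
  \<open>A\<close> bounds \<open>\<nu>\<close> on the complementary subsets, and conversely. The two
  resulting inequalities are opposite to each other.\<close>

lemma Jordan_decomposition:
  fixes \<nu> :: "'a::topological_space set \<Rightarrow> real"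
  assumes empty: "\<nu> {} = 0"
    and sums: "\<And>A :: nat \<Rightarrow> 'a set. range A \<subseteq> sets borel \<Longrightarrow> disjoint_family A \<Longrightarrow>
        (\<lambda>n. \<nu> (A n)) sums \<nu> (\<Union>n. A n)"
    and A: "A \<in> sets borel"
  shows "\<nu> A = measure (positive_variation \<nu>) A - measure (positive_variation (\<lambda>B. - \<nu> B)) A"
proof -
  have empty': "- \<nu> {} = 0" using empty by simp
  have sums': "\<And>A :: nat \<Rightarrow> 'a set. range A \<subseteq> sets borel \<Longrightarrow> disjoint_family A \<Longrightarrow>
        (\<lambda>n. - \<nu> (A n)) sums - \<nu> (\<Union>n. A n)"
    by (intro sums_minus sums)
  have split: "\<nu> B + \<nu> (A - B) = \<nu> A" if "B \<in> sets borel" "B \<subseteq> A" for B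
    using signed_measure_Un[of \<nu> B "A - B", OF empty sums] that A by (simp add: Un_absorb1)
  have "measure (positive_variation \<nu>) A \<le> \<nu> A + measure (positive_variation (\<lambda>B. - \<nu> B)) A"
  proof (rule measure_positive_variation_le[OF empty sums A])
    fix B :: "'a set" assume B: "B \<in> sets borel" "B \<subseteq> A"
    have "- \<nu> (A - B) \<le> measure (positive_variation (\<lambda>B. - \<nu> B)) A"
      using A B by (intro le_measure_positive_variation[OF empty' sums']) auto
    then show "\<nu> B \<le> \<nu> A + measure (positive_variation (\<lambda>B. - \<nu> B)) A"
      using split[OF B] by linarith
  qed
  moreover have "measure (positive_variation (\<lambda>B. - \<nu> B)) A \<le> measure (positive_variation \<nu>) A - \<nu> A"
  proof (rule measure_positive_variation_le[OF empty' sums' A])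
    fix B :: "'a set" assume B: "B \<in> sets borel" "B \<subseteq> A"
    have "\<nu> (A - B) \<le> measure (positive_variation \<nu>) A"
      using A B by (intro le_measure_positive_variation[OF empty sums]) auto
    then show "- \<nu> B \<le> measure (positive_variation \<nu>) A - \<nu> A"
      using split[OF B] by linarith
  qed
  ultimately show ?thesis by linarith
qed

section \<open>Densities with respect to Lebesgue measure\<close>

lemma finite_measure_Radon_Nikodym_lborel:
  fixes M :: "real measure"
  assumes "finite_measure M" and sets: "sets M = sets borel" and ac: "absolutely_continuous lborel M"
  shows "\<exists>u. integrable lborel u \<and> (\<forall>A\<in>sets borel. measure M A = (\<integral>t. indicator A t * u t \<partial>lborel))"
proof -
  interpret finite_measure M by fact
  obtain h where h[measurable]: "h \<in> borel_measurable lborel" and M: "density lborel h = M"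
    using sigma_finite_measure.Radon_Nikodym[OF lborel.sigma_finite_measure_axioms ac] sets by auto
  have fin: "(\<integral>\<^sup>+t. h t \<partial>lborel) < \<infinity>"
    using emeasure_finite[of UNIV] by (subst (asm) M[symmetric]) (simp add: emeasure_density less_top)
  have ae: "AE t in lborel. h t \<noteq> \<infinity>" using fin by (intro nn_integral_PInf_AE) auto
  define u where "u t = enn2real (h t)" for t
  have [measurable]: "u \<in> borel_measurable borel" using h by (simp add: u_def[abs_def])
  have u_nonneg: "0 \<le> u t" for t by (simp add: u_def)
  have u: "AE t in lborel. ennreal (u t) = h t"
    using ae by eventually_elim (simp add: u_def less_top)
  have int: "integrable lborel u"
  proof (rule integrableI_bounded)
    have "(\<integral>\<^sup>+t. ennreal (norm (u t)) \<partial>lborel) = (\<integral>\<^sup>+t. h t \<partial>lborel)"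
      using u by (intro nn_integral_cong_AE) (auto simp: u_def)
    then show "(\<integral>\<^sup>+t. ennreal (norm (u t)) \<partial>lborel) < \<infinity>" using fin by simp
  qed simp
  have "measure M A = (\<integral>t. indicator A t * u t \<partial>lborel)" if A: "A \<in> sets borel" for A
  proof -
    have "emeasure M A = (\<integral>\<^sup>+t. h t * indicator A t \<partial>lborel)"
      using A by (subst M[symmetric]) (simp add: emeasure_density)
    also have "\<dots> = (\<integral>\<^sup>+t. ennreal (indicator A t * u t) \<partial>lborel)"
      using u by (intro nn_integral_cong_AE) (auto split: split_indicator)
    also have "\<dots> = ennreal (\<integral>t. indicator A t * u t \<partial>lborel)"
      using A int u_nonneg by (intro nn_integral_eq_integral integrable_mult_indicator[where 'b=real, simplified])
        auto
    finally show ?thesis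
      using u_nonneg by (simp add: measure_def integral_nonneg_AE)
  qed
  then show ?thesis using int by blast
qed

lemma signed_measure_density:
  fixes \<nu> :: "real set \<Rightarrow> real"
  assumes empty: "\<nu> {} = 0"
    and sums: "\<And>A :: nat \<Rightarrow> real set. range A \<subseteq> sets borel \<Longrightarrow> disjoint_family A \<Longrightarrow>
        (\<lambda>n. \<nu> (A n)) sums \<nu> (\<Union>n. A n)"
    and null: "\<And>A. A \<in> null_sets lborel \<Longrightarrow> \<nu> A = 0"
  shows "\<exists>u. integrable lborel u \<and> (\<forall>A\<in>sets borel. \<nu> A = (\<integral>t. indicator A t * u t \<partial>lborel))"
proof -
  have dens: "\<exists>u. integrable lborel u \<and> (\<forall>A\<in>sets borel. measure (positive_variation \<kappa>) A = (\<integral>t. indicator A t * u t \<partial>lborel))"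
    if e: "\<kappa> {} = 0" and s: "\<And>A :: nat \<Rightarrow> real set. range A \<subseteq> sets borel \<Longrightarrow> disjoint_family A \<Longrightarrow>
        (\<lambda>n. \<kappa> (A n)) sums \<kappa> (\<Union>n. A n)" and n: "\<And>A. A \<in> null_sets lborel \<Longrightarrow> \<kappa> A = 0"
    for \<kappa> :: "real set \<Rightarrow> real"
  proof (rule finite_measure_Radon_Nikodym_lborel)
    show "finite_measure (positive_variation \<kappa>)" by (rule finite_measure_positive_variation[OF e s])
    show "absolutely_continuous lborel (positive_variation \<kappa>)"
      unfolding absolutely_continuous_def
    proof
      fix A :: "real set" assume A: "A \<in> null_sets lborel"
      then have "A \<in> sets borel" by auto
      \<comment> \<open>The variation of a null set is a supremum over its Borel subsets, all of
        which are null again.\<close>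
      moreover have "\<kappa> B = 0" if "B \<in> sets borel" "B \<subseteq> A" for B
        using that A by (intro n null_sets_subset[OF A]) auto
      ultimately have "emeasure (positive_variation \<kappa>) A = 0"
        by (subst emeasure_positive_variation[OF e s]) (auto intro!: antisym SUP_least)
      then show "A \<in> null_sets (positive_variation \<kappa>)" using A by (simp add: null_sets_def)
    qed
  qed simp
  obtain u1 where u1: "integrable lborel u1"
    "\<And>A. A \<in> sets borel \<Longrightarrow> measure (positive_variation \<nu>) A = (\<integral>t. indicator A t * u1 t \<partial>lborel)"
    using dens[OF empty sums null] by blast
  obtain u2 where u2: "integrable lborel u2"
    "\<And>A. A \<in> sets borel \<Longrightarrow> measure (positive_variation (\<lambda>B. - \<nu> B)) A = (\<integral>t. indicator A t * u2 t \<partial>lborel)"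
  proof -
    have "\<exists>u. integrable lborel u \<and> (\<forall>A\<in>sets borel. measure (positive_variation (\<lambda>B. - \<nu> B)) A = (\<integral>t. indicator A t * u t \<partial>lborel))"
      by (rule dens) (simp_all add: empty null sums_minus[OF sums])
    then show ?thesis using that by blast
  qed
  have "\<nu> A = (\<integral>t. indicator A t * (u1 t - u2 t) \<partial>lborel)" if A: "A \<in> sets borel" for A
  proof -
    have "integrable lborel (\<lambda>t. indicator A t * u1 t)" "integrable lborel (\<lambda>t. indicator A t * u2 t)"
      using A u1(1) u2(1) by (auto intro!: integrable_mult_indicator[where 'b=real, simplified])
    then show ?thesis
      using A by (subst Jordan_decomposition[OF empty sums A]) (auto simp: u1(2) u2(2) right_diff_distrib)
  qed
  then show ?thesis using u1(1) u2(1) by (intro exI[of _ "\<lambda>t. u1 t - u2 t"]) auto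
qed

lemma complex_measure_density:
  fixes \<nu> :: "real set \<Rightarrow> complex"
  assumes \<nu>: "complex_borel_measure \<nu>" and null: "\<And>A. A \<in> null_sets lborel \<Longrightarrow> \<nu> A = 0"
  shows "\<exists>f. integrable lborel f \<and> (\<forall>A\<in>sets borel. \<nu> A = (\<integral>t. indicator A t *\<^sub>R f t \<partial>lborel))"
proof -
  have empty: "\<nu> {} = 0" and sums: "\<And>A :: nat \<Rightarrow> real set. range A \<subseteq> sets borel \<Longrightarrow> disjoint_family A \<Longrightarrow>
        (\<lambda>n. \<nu> (A n)) sums \<nu> (\<Union>n. A n)"
    using \<nu> by (auto simp: complex_borel_measure_def)
  obtain u where u: "integrable lborel u"
    "\<And>A. A \<in> sets borel \<Longrightarrow> Re (\<nu> A) = (\<integral>t. indicator A t * u t \<partial>lborel)"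
    using signed_measure_density[of "\<lambda>A. Re (\<nu> A)"] sums null empty by (auto simp: sums_complex_iff)
  obtain v where v: "integrable lborel v"
    "\<And>A. A \<in> sets borel \<Longrightarrow> Im (\<nu> A) = (\<integral>t. indicator A t * v t \<partial>lborel)"
    using signed_measure_density[of "\<lambda>A. Im (\<nu> A)"] sums null empty by (auto simp: sums_complex_iff)
  have "\<nu> A = (\<integral>t. indicator A t *\<^sub>R Complex (u t) (v t) \<partial>lborel)" if A: "A \<in> sets borel" for A
  proof -
    have int: "integrable lborel (\<lambda>t. indicator A t * u t)" "integrable lborel (\<lambda>t. indicator A t * v t)"
      using A u(1) v(1) by (auto intro!: integrable_mult_indicator[where 'b=real, simplified])
    have "(\<integral>t. indicator A t *\<^sub>R Complex (u t) (v t) \<partial>lborel)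
      = (\<integral>t. complex_of_real (indicator A t * u t) + \<i> * complex_of_real (indicator A t * v t) \<partial>lborel)"
      by (intro Bochner_Integration.integral_cong) (auto simp: complex_eq_iff)
    also have "\<dots> = complex_of_real (Re (\<nu> A)) + \<i> * complex_of_real (Im (\<nu> A))"
      using int by (subst Bochner_Integration.integral_add) (auto simp: u(2)[OF A] v(2)[OF A] simp del: of_real_mult)
    also have "\<dots> = \<nu> A" by (rule complex_eq[symmetric])
    finally show ?thesis by simp
  qed
  moreover have "integrable lborel (\<lambda>t. Complex (u t) (v t))"
    using u(1) v(1) unfolding Complex_eq by simp
  ultimately show ?thesis by blast
qed

section \<open>Complex measures with a density along a parametrized curve\<close>

definition curve_measure :: "(real \<Rightarrow> 'a) \<Rightarrow> (real \<Rightarrow> complex) \<Rightarrow> 'a set \<Rightarrow> complex" where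
  "curve_measure p f B = (\<integral>t. indicator B (p t) *\<^sub>R f t \<partial>lborel)"

lemma positive_variation_cong:
  "(\<And>B. B \<in> sets borel \<Longrightarrow> \<nu> B = \<nu>' B) \<Longrightarrow> positive_variation \<nu> = positive_variation \<nu>'"
  unfolding positive_variation_def by (intro arg_cong[where f="measure_of UNIV (sets borel)"] ext SUP_cong) auto

lemma cm_integral_cong:
  "(\<And>B. B \<in> sets borel \<Longrightarrow> \<mu> B = \<mu>' B) \<Longrightarrow> cm_integral \<mu> h = cm_integral \<mu>' h"
  unfolding cm_integral_def
  by (intro arg_cong2[where f="(+)"] arg_cong2[where f="(-)"] arg_cong2[where f="(*)"] refl
      arg_cong[where f="\<lambda>M. integral\<^sup>L M h"] positive_variation_cong) auto

lemma ennreal_integral_le_nn_integral: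
  fixes g :: "'a \<Rightarrow> real"
  assumes "integrable M g"
  shows "ennreal (\<integral>x. g x \<partial>M) \<le> (\<integral>\<^sup>+x. ennreal (g x) \<partial>M)"
proof -
  have "ennreal (\<integral>x. g x \<partial>M) \<le> ennreal (\<integral>x. max 0 (g x) \<partial>M)"
    using assms by (intro ennreal_leI integral_mono) auto
  also have "\<dots> = (\<integral>\<^sup>+x. ennreal (max 0 (g x)) \<partial>M)"
    using assms by (intro nn_integral_eq_integral[symmetric]) auto
  also have "\<dots> = (\<integral>\<^sup>+x. ennreal (g x) \<partial>M)"
    by (intro nn_integral_cong) (simp add: max_def ennreal_neg)
  finally show ?thesis .
qed

lemma integrable_indicator_comp:
  fixes u :: "real \<Rightarrow> 'b::{banach, second_countable_topology}"
  assumes "integrable lborel u" and [measurable]: "p \<in> borel \<rightarrow>\<^sub>M borel" "B \<in> sets borel"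
  shows "integrable lborel (\<lambda>t. indicator B (p t) *\<^sub>R u t)"
proof -
  have "integrable lborel (\<lambda>t. indicator (p -` B) t *\<^sub>R u t)"
    using measurable_sets[OF assms(2,3)] by (intro integrable_mult_indicator assms) simp
  then show ?thesis by (simp add: indicator_vimage)
qed

text \<open>The supremum is attained on the part of the curve where \<open>u > 0\<close>. The left
  inverse \<open>q\<close> recovers the parameter, so this part is cut out by a Borel set of the
  target; if \<open>p\<close> identified parameters, values of \<open>u\<close> of opposite sign
  could cancel on a fibre.\<close>

lemma positive_variation_curve:
  fixes p :: "real \<Rightarrow> 'a::topological_space" and q :: "'a \<Rightarrow> real"
  assumes u: "integrable lborel u" and p[measurable]: "p \<in> borel \<rightarrow>\<^sub>M borel"
    and q[measurable]: "q \<in> borel \<rightarrow>\<^sub>M borel" and qp: "\<And>t. q (p t) = t"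
  shows "positive_variation (\<lambda>B. \<integral>t. indicator B (p t) * u t \<partial>lborel)
    = distr (density lborel (\<lambda>t. ennreal (u t))) borel p"
    (is "positive_variation ?\<nu> = ?N")
proof -
  have [measurable]: "u \<in> borel_measurable borel" using u by auto
  have int: "integrable lborel (\<lambda>t. indicator B (p t) * u t)" if "B \<in> sets borel" for B
    using integrable_indicator_comp[OF u p that] by simp
  have eq: "(SUP B\<in>{B \<in> sets borel. B \<subseteq> A}. ennreal (?\<nu> B)) = emeasure ?N A"
    if A[measurable]: "A \<in> sets borel" for A
  proof -
    have N: "emeasure ?N A = (\<integral>\<^sup>+t. ennreal (u t) * indicator A (p t) \<partial>lborel)"
      using measurable_sets[OF p A]
      by (simp add: emeasure_distr emeasure_density indicator_vimage)
    show ?thesis unfolding N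
    proof (rule antisym)
      show "(SUP B\<in>{B \<in> sets borel. B \<subseteq> A}. ennreal (?\<nu> B)) \<le> (\<integral>\<^sup>+t. ennreal (u t) * indicator A (p t) \<partial>lborel)"
      proof (rule SUP_least)
        fix B assume B: "B \<in> {B \<in> sets borel. B \<subseteq> A}"
        then have "ennreal (?\<nu> B) \<le> (\<integral>\<^sup>+t. ennreal (indicator B (p t) * u t) \<partial>lborel)"
          by (intro ennreal_integral_le_nn_integral int) auto
        also have "\<dots> \<le> (\<integral>\<^sup>+t. ennreal (u t) * indicator A (p t) \<partial>lborel)"
          using B by (intro nn_integral_mono) (auto split: split_indicator)
        finally show "ennreal (?\<nu> B) \<le> (\<integral>\<^sup>+t. ennreal (u t) * indicator A (p t) \<partial>lborel)" .
      qed
      define B where "B = A \<inter> {x \<in> space borel. u (q x) > 0}"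
      have B: "B \<in> sets borel" unfolding B_def by measurable
      have "(\<integral>\<^sup>+t. ennreal (u t) * indicator A (p t) \<partial>lborel) = (\<integral>\<^sup>+t. ennreal (indicator B (p t) * u t) \<partial>lborel)"
        by (intro nn_integral_cong) (auto simp: B_def qp ennreal_neg split: split_indicator)
      also have "\<dots> = ennreal (?\<nu> B)"
        using B by (intro nn_integral_eq_integral int AE_I2) (auto simp: B_def qp split: split_indicator)
      also have "\<dots> \<le> (SUP B\<in>{B \<in> sets borel. B \<subseteq> A}. ennreal (?\<nu> B))"
        using B by (intro SUP_upper) (auto simp: B_def)
      finally show "(\<integral>\<^sup>+t. ennreal (u t) * indicator A (p t) \<partial>lborel) \<le> (SUP B\<in>{B \<in> sets borel. B \<subseteq> A}. ennreal (?\<nu> B))" .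
    qed
  qed
  have "positive_variation ?\<nu> = measure_of (space ?N) (sets ?N) (emeasure ?N)"
    unfolding positive_variation_def using sets.sigma_sets_eq[of "borel :: 'a measure"]
    by (simp, intro measure_of_eq) (auto simp: eq)
  then show ?thesis by (simp only: measure_of_of_measure)
qed

lemma integral_distr_density_truncated:
  fixes h :: "'a::topological_space \<Rightarrow> complex"
  assumes [measurable]: "u \<in> borel_measurable borel" "p \<in> borel \<rightarrow>\<^sub>M borel" "h \<in> borel_measurable borel"
  shows "integral\<^sup>L (distr (density lborel (\<lambda>t. ennreal (u t))) borel p) h
     = (\<integral>t. complex_of_real (max 0 (u t)) * h (p t) \<partial>lborel)"
proof -
  have "density lborel (\<lambda>t. ennreal (u t)) = density lborel (\<lambda>t. ennreal (max 0 (u t)))"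
    by (intro density_cong) (auto simp: max_def ennreal_neg)
  then show ?thesis
    by (simp add: integral_distr integral_density scaleR_conv_of_real)
qed

text \<open>The four variations have as densities the positive parts of \<open>Re f\<close>,
  \<open>- Re f\<close>, \<open>Im f\<close> and \<open>- Im f\<close>, and
  \<open>max 0 x - max 0 (- x) = x\<close> reassembles \<open>f\<close>. Boundedness of
  \<open>h\<close> makes the four integrals converge separately.\<close>

lemma cm_integral_curve:
  fixes p :: "real \<Rightarrow> 'a::topological_space" and q :: "'a \<Rightarrow> real"
  assumes f: "integrable lborel f" and p[measurable]: "p \<in> borel \<rightarrow>\<^sub>M borel"
    and q: "q \<in> borel \<rightarrow>\<^sub>M borel" and qp: "\<And>t. q (p t) = t"
    and h[measurable]: "h \<in> borel_measurable borel" and bd: "\<And>x. norm (h x) \<le> K"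
  shows "cm_integral (curve_measure p f) h = (\<integral>t. f t * h (p t) \<partial>lborel)"
proof -
  have [measurable]: "f \<in> borel_measurable borel" using f by auto
  have real: "integral\<^sup>L (positive_variation (\<lambda>B. \<integral>t. indicator B (p t) * u t \<partial>lborel)) h
      = (\<integral>t. complex_of_real (max 0 (u t)) * h (p t) \<partial>lborel)" if "integrable lborel u" for u
    using that by (subst positive_variation_curve[OF that p q qp])
      (auto intro!: integral_distr_density_truncated)
  have ind: "integrable lborel (\<lambda>t. indicator B (p t) *\<^sub>R f t)" if "B \<in> sets borel" for B
    by (rule integrable_indicator_comp[OF f p that])
  have parts: "Re (curve_measure p f B) = (\<integral>t. indicator B (p t) * Re (f t) \<partial>lborel)"
      "- Re (curve_measure p f B) = (\<integral>t. indicator B (p t) * - Re (f t) \<partial>lborel)"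
      "Im (curve_measure p f B) = (\<integral>t. indicator B (p t) * Im (f t) \<partial>lborel)"
      "- Im (curve_measure p f B) = (\<integral>t. indicator B (p t) * - Im (f t) \<partial>lborel)"
    if "B \<in> sets borel" for B
    using integral_Re[OF ind[OF that]] integral_Im[OF ind[OF that]] by (simp_all add: curve_measure_def)
  have pv: "positive_variation (\<lambda>A. Re (curve_measure p f A)) = positive_variation (\<lambda>B. \<integral>t. indicator B (p t) * Re (f t) \<partial>lborel)"
     "positive_variation (\<lambda>A. - Re (curve_measure p f A)) = positive_variation (\<lambda>B. \<integral>t. indicator B (p t) * - Re (f t) \<partial>lborel)"
     "positive_variation (\<lambda>A. Im (curve_measure p f A)) = positive_variation (\<lambda>B. \<integral>t. indicator B (p t) * Im (f t) \<partial>lborel)"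
     "positive_variation (\<lambda>A. - Im (curve_measure p f A)) = positive_variation (\<lambda>B. \<integral>t. indicator B (p t) * - Im (f t) \<partial>lborel)"
    by (intro positive_variation_cong parts; assumption)+
  have int: "integrable lborel (\<lambda>t. complex_of_real (max 0 (u t)) * h (p t))" if "integrable lborel u" for u
  proof (rule Bochner_Integration.integrable_bound)
    show "integrable lborel (\<lambda>t. K * u t)" using that by simp
    show "(\<lambda>t. complex_of_real (max 0 (u t)) * h (p t)) \<in> borel_measurable lborel" using that by measurable
    show "AE t in lborel. norm (complex_of_real (max 0 (u t)) * h (p t)) \<le> norm (K * u t)"
    proof (rule AE_I2)
      fix t
      have K: "norm (h (p t)) \<le> \<bar>K\<bar>" using bd[of "p t"] by linarith
      have "\<bar>max 0 (u t)\<bar> * norm (h (p t)) \<le> \<bar>u t\<bar> * \<bar>K\<bar>"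
        by (intro mult_mono K) auto
      then show "norm (complex_of_real (max 0 (u t)) * h (p t)) \<le> norm (K * u t)"
        by (simp add: norm_mult abs_mult mult.commute)
    qed
  qed
  have fi: "integrable lborel (\<lambda>t. Re (f t))" "integrable lborel (\<lambda>t. - Re (f t))"
     "integrable lborel (\<lambda>t. Im (f t))" "integrable lborel (\<lambda>t. - Im (f t))"
    using f by auto
  have fs: "f t * h (p t) = (complex_of_real (max 0 (Re (f t))) * h (p t) - complex_of_real (max 0 (- Re (f t))) * h (p t))
     + \<i> * (complex_of_real (max 0 (Im (f t))) * h (p t) - complex_of_real (max 0 (- Im (f t))) * h (p t))" for t
  proof -
    have "complex_of_real (max 0 x) - complex_of_real (max 0 (- x)) = complex_of_real x" for x
      by (simp add: max_def flip: of_real_diff)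
    then have "complex_of_real (max 0 (Re (f t))) - complex_of_real (max 0 (- Re (f t)))
      + \<i> * (complex_of_real (max 0 (Im (f t))) - complex_of_real (max 0 (- Im (f t)))) = f t"
      by (simp add: complex_eq[symmetric])
    from arg_cong[OF this, of "\<lambda>z. z * h (p t)"] show ?thesis by (simp add: algebra_simps)
  qed
  show ?thesis
    unfolding cm_integral_def pv fs
    using fi[THEN real] fi[THEN int] by simp
qed

lemma complex_borel_measure_curve:
  assumes f: "integrable lborel f" and p[measurable]: "p \<in> borel \<rightarrow>\<^sub>M borel"
  shows "complex_borel_measure (curve_measure p f)"
  unfolding complex_borel_measure_def
proof (intro conjI allI impI)
  show "curve_measure p f {} = 0" by (simp add: curve_measure_def)
  fix A :: "nat \<Rightarrow> 'a set" assume A: "range A \<subseteq> sets borel" "disjoint_family A"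
  have int: "integrable lborel (\<lambda>t. indicator (A n) (p t) *\<^sub>R f t)" for n
    using A by (intro integrable_indicator_comp[OF f p]) auto
  have s: "(\<lambda>n. indicator (A n) x) sums (indicator (\<Union>n. A n) x :: real)" for x
    using A(2) by (intro indicator_sums) (auto simp: disjoint_family_on_def)
  have eq: "norm (indicator (A n) (p t) *\<^sub>R f t) = norm (f t) * indicator (A n) (p t)" for n t
    by (auto split: split_indicator)
  have "(\<lambda>n. \<integral>t. indicator (A n) (p t) *\<^sub>R f t \<partial>lborel) sums (\<integral>t. (\<Sum>n. indicator (A n) (p t) *\<^sub>R f t) \<partial>lborel)"
  proof (rule sums_integral[OF int])
    show "AE t in lborel. summable (\<lambda>n. norm (indicator (A n) (p t) *\<^sub>R f t))"
      unfolding eq using s by (intro AE_I2 summable_mult) (auto simp: sums_iff)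
    show "summable (\<lambda>n. \<integral>t. norm (indicator (A n) (p t) *\<^sub>R f t) \<partial>lborel)"
    proof (rule summableI_nonneg_bounded)
      fix n
      have "(\<Sum>i<n. \<integral>t. norm (indicator (A i) (p t) *\<^sub>R f t) \<partial>lborel)
          = (\<integral>t. (\<Sum>i<n. norm (indicator (A i) (p t) *\<^sub>R f t)) \<partial>lborel)"
        by (intro Bochner_Integration.integral_sum[symmetric] integrable_norm int)
      also have "\<dots> \<le> (\<integral>t. norm (f t) \<partial>lborel)"
      proof (rule integral_mono)
        show "integrable lborel (\<lambda>t. \<Sum>i<n. norm (indicator (A i) (p t) *\<^sub>R f t))"
          using int by (intro Bochner_Integration.integrable_sum integrable_norm)
        show "(\<Sum>i<n. norm (indicator (A i) (p t) *\<^sub>R f t)) \<le> norm (f t)" for t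
        proof -
          have "(\<Sum>i<n. indicator (A i) (p t) :: real) \<le> indicator (\<Union>n. A n) (p t)"
            using sum_le_suminf[OF sums_summable[OF s[of "p t"]], of "{..<n}"] sums_unique[OF s[of "p t"]] by simp
          also have "\<dots> \<le> 1" by (auto split: split_indicator)
          finally show ?thesis
            unfolding eq sum_distrib_left[symmetric] by (simp add: mult_left_le)
        qed
      qed (use f in auto)
      finally show "(\<Sum>i<n. \<integral>t. norm (indicator (A i) (p t) *\<^sub>R f t) \<partial>lborel) \<le> (\<integral>t. norm (f t) \<partial>lborel)" .
    qed auto
  qed
  moreover have "(\<Sum>n. indicator (A n) (p t) *\<^sub>R f t) = indicator (\<Union>n. A n) (p t) *\<^sub>R f t" for t
    using sums_scaleR_left[OF s, of "p t" "f t"] by (simp add: sums_iff)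
  ultimately show "(\<lambda>n. curve_measure p f (A n)) sums curve_measure p f (\<Union>n. A n)"
    by (simp add: curve_measure_def)
qed

section \<open>Measures on the hyperbola and their densities\<close>

definition hyperbola_point :: "real \<Rightarrow> real \<Rightarrow> real \<times> real" where
  "hyperbola_point m t = (t, - (m\<^sup>2 / (4 * pi\<^sup>2) / t))"

lemma hyperbola_point_measurable [measurable]: "hyperbola_point m \<in> borel \<rightarrow>\<^sub>M borel"
proof -
  have "hyperbola_point m \<in> borel \<rightarrow>\<^sub>M borel \<Otimes>\<^sub>M borel"
    unfolding hyperbola_point_def by measurable
  then show ?thesis by (simp add: borel_prod)
qed

text \<open>The speed of the parametrization is strictly positive, so arc length and Lebesgue
  measure of the parameter have the same null sets.\<close>

lemma null_sets_arc_length_iff: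
  assumes [measurable]: "A \<in> sets borel"
  shows "A \<in> null_sets (arc_length m) \<longleftrightarrow> (AE t in lborel. hyperbola_point m t \<notin> A)"
proof -
  define w where "w t = ennreal (sqrt (1 + (m\<^sup>2 / (4 * pi\<^sup>2) / t\<^sup>2)\<^sup>2))" for t :: real
  have w[measurable]: "w \<in> borel_measurable borel" unfolding w_def by measurable
  have pos: "w t > 0" for t
    by (simp add: w_def add_pos_nonneg)
  have "arc_length m = distr (density lborel w) borel (hyperbola_point m)"
    unfolding arc_length_def Let_def w_def[abs_def] hyperbola_point_def[abs_def] ..
  then have "A \<in> null_sets (arc_length m) \<longleftrightarrow> hyperbola_point m -` A \<in> null_sets (density lborel w)"
    using measurable_sets[OF hyperbola_point_measurable assms] by (simp add: null_sets_def emeasure_distr)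
  also have "\<dots> \<longleftrightarrow> (AE t in lborel. t \<in> hyperbola_point m -` A \<longrightarrow> w t = 0)"
    using measurable_sets[OF hyperbola_point_measurable assms] by (subst null_sets_density_iff) auto
  also have "\<dots> \<longleftrightarrow> (AE t in lborel. hyperbola_point m t \<notin> A)"
    using pos by (intro AE_cong) (auto simp: less_le)
  finally show ?thesis .
qed

lemma hyperbola_eq: "m \<noteq> 0 \<Longrightarrow> hyperbola m = {x. fst x \<noteq> 0 \<and> x = hyperbola_point m (fst x)}"
proof -
  assume "m \<noteq> 0"
  define c where "c = m\<^sup>2 / (4 * pi\<^sup>2)"
  have c: "c \<noteq> 0" using \<open>m \<noteq> 0\<close> by (simp add: c_def)
  have "fst x * snd x = - c \<longleftrightarrow> fst x \<noteq> 0 \<and> snd x = - (c / fst x)" for x :: "real \<times> real"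
    using c by (cases "fst x = 0") (auto simp: field_simps)
  then show ?thesis
    unfolding hyperbola_def hyperbola_point_def c_def[symmetric] by (auto simp: prod_eq_iff)
qed

text \<open>A vertical strip over a Lebesgue null set is null for arc length, so the compression has
  a density by Radon-Nikodym. The compression determines \<open>\<mu>\<close> because the hyperbola
  is a graph over the first coordinate: a Borel set and the strip over its parameter set meet the
  hyperbola in the same points.\<close>

lemma AC0_density:
  assumes m: "m > 0" and \<mu>: "\<mu> \<in> AC0 m"
  obtains f where "integrable lborel f" "(\<integral>t. f t \<partial>lborel) = 0"
    "\<And>B. B \<in> sets borel \<Longrightarrow> \<mu> B = curve_measure (hyperbola_point m) f B"
    "\<And>B. B \<in> sets borel \<Longrightarrow> compression \<mu> B = curve_measure (\<lambda>t. t) f B"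
proof -
  have cb: "complex_borel_measure \<mu>" and supp: "\<And>A. A \<in> sets borel \<Longrightarrow> A \<inter> hyperbola m = {} \<Longrightarrow> \<mu> A = 0"
    and null: "\<And>A. A \<in> null_sets (arc_length m) \<Longrightarrow> \<mu> A = 0" and U: "\<mu> UNIV = 0"
    using \<mu> by (auto simp: AC0_def)
  have prod: "A \<times> UNIV \<in> sets (borel :: (real \<times> real) measure)" if "A \<in> sets borel" for A :: "real set"
    using that by (simp add: borel_prod[symmetric])
  have comp: "complex_borel_measure (compression \<mu>)"
    unfolding complex_borel_measure_def compression_def
  proof (intro conjI allI impI)
    show "\<mu> ({} \<times> UNIV) = 0" using cb by (simp add: complex_borel_measure_def)
    fix A :: "nat \<Rightarrow> real set" assume A: "range A \<subseteq> sets borel" "disjoint_family A"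
    have "(\<lambda>n. \<mu> (A n \<times> UNIV)) sums \<mu> (\<Union>n. A n \<times> UNIV)"
      using cb A prod unfolding complex_borel_measure_def
      by (elim conjE allE[of _ "\<lambda>n. A n \<times> UNIV"] mp) (auto simp: disjoint_family_on_def)
    moreover have "(\<Union>n. A n \<times> UNIV) = (\<Union>n. A n) \<times> (UNIV :: real set)" by blast
    ultimately show "(\<lambda>n. \<mu> (A n \<times> UNIV)) sums \<mu> ((\<Union>n. A n) \<times> UNIV)" by (simp only:)
  qed
  moreover have "compression \<mu> A = 0" if A: "A \<in> null_sets lborel" for A
    unfolding compression_def
  proof (rule null)
    have "AE t in lborel. t \<notin> A" using A by (rule AE_not_in)
    then show "A \<times> UNIV \<in> null_sets (arc_length m)"
      using A prod[of A] by (subst null_sets_arc_length_iff) (auto simp: hyperbola_point_def null_sets_def)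
  qed
  ultimately have "\<exists>f. integrable lborel f \<and> (\<forall>A\<in>sets borel. compression \<mu> A = (\<integral>t. indicator A t *\<^sub>R f t \<partial>lborel))"
    by (rule complex_measure_density)
  then obtain f where f: "integrable lborel f"
    "\<And>A. A \<in> sets borel \<Longrightarrow> compression \<mu> A = (\<integral>t. indicator A t *\<^sub>R f t \<partial>lborel)"
    by blast
  show ?thesis
  proof (rule that[OF f(1)])
    show "(\<integral>t. f t \<partial>lborel) = 0" using f(2)[of UNIV] U by (simp add: compression_def)
    show "compression \<mu> B = curve_measure (\<lambda>t. t) f B" if "B \<in> sets borel" for B
      using f(2)[OF that] by (simp add: curve_measure_def)
    show "\<mu> B = curve_measure (hyperbola_point m) f B" if B: "B \<in> sets borel" for B
    proof -
      have add: "\<mu> (X \<union> Y) = \<mu> X + \<mu> Y" if XY: "X \<in> sets borel" "Y \<in> sets borel" "X \<inter> Y = {}" for X Y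
      proof -
        have "(\<lambda>n. \<mu> (binaryset X Y n)) sums \<mu> (\<Union>n. binaryset X Y n)"
        proof -
          have "range (binaryset X Y) \<subseteq> sets borel" "disjoint_family (binaryset X Y)"
            using XY by (auto simp: range_binaryset_eq disjoint_family_on_def binaryset_def)
          then show ?thesis using cb unfolding complex_borel_measure_def by blast
        qed
        moreover have "(\<lambda>n. \<mu> (binaryset X Y n)) sums (\<mu> X + \<mu> Y)"
          using cb by (intro binaryset_sums) (auto simp: complex_borel_measure_def)
        ultimately show ?thesis by (simp add: UN_binaryset_eq sums_unique2)
      qed
      define A where "A = hyperbola_point m -` B"
      have A: "A \<in> sets borel"
        using measurable_sets[OF hyperbola_point_measurable B] by (simp add: A_def)
      have eq: "B \<inter> hyperbola m = (A \<times> UNIV) \<inter> hyperbola m"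
        using m by (auto simp: hyperbola_eq A_def)
      have hyp: "hyperbola m \<in> sets borel"
        unfolding hyperbola_def
        by (intro borel_closed closed_Collect_eq continuous_intros)
      have restr: "\<mu> X = \<mu> (X \<inter> hyperbola m)" if X: "X \<in> sets borel" for X
      proof -
        have "\<mu> ((X \<inter> hyperbola m) \<union> (X - hyperbola m)) = \<mu> (X \<inter> hyperbola m) + \<mu> (X - hyperbola m)"
          using X hyp by (intro add) auto
        moreover have "(X \<inter> hyperbola m) \<union> (X - hyperbola m) = X" by blast
        moreover have "\<mu> (X - hyperbola m) = 0" using X hyp by (intro supp) auto
        ultimately show ?thesis by simp
      qed
      have "\<mu> B = \<mu> (A \<times> UNIV)"
        using restr[OF B] restr[OF prod[OF A]] eq by simp
      also have "\<dots> = compression \<mu> A" by (simp add: compression_def)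
      also have "\<dots> = curve_measure (hyperbola_point m) f B"
        using f(2)[OF A] by (simp add: curve_measure_def A_def indicator_vimage)
      finally show ?thesis .
    qed
  qed
qed

lemma curve_measure_in_AC0:
  assumes m: "m > 0" and f: "integrable lborel f" "(\<integral>t. f t \<partial>lborel) = 0"
  shows "curve_measure (hyperbola_point m) f \<in> AC0 m"
  unfolding AC0_def
proof (intro CollectI conjI ballI impI)
  show "complex_borel_measure (curve_measure (hyperbola_point m) f)"
    by (rule complex_borel_measure_curve[OF f(1)]) simp
  show "curve_measure (hyperbola_point m) f UNIV = 0"
    by (simp add: curve_measure_def f)
  show "curve_measure (hyperbola_point m) f A = 0" if "A \<in> sets borel" "A \<inter> hyperbola m = {}" for A
  proof -
    \<comment> \<open>At \<open>t = 0\<close> division by zero makes \<open>hyperbola_point\<close>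
      the origin, which is off the hyperbola; this parameter value is discarded as a null
      set.\<close>
    have out: "hyperbola_point m t \<notin> A" if "t \<noteq> 0" for t
      using \<open>A \<inter> hyperbola m = {}\<close> that m by (auto simp: hyperbola_eq hyperbola_point_def)
    have "AE t in lborel. indicator A (hyperbola_point m t) *\<^sub>R f t = 0"
      using AE_lborel_singleton[of "0::real"] by eventually_elim (simp add: out)
    then show ?thesis unfolding curve_measure_def by (rule integral_eq_zero_AE)
  qed
  show "curve_measure (hyperbola_point m) f A = 0" if A: "A \<in> null_sets (arc_length m)" for A
  proof -
    have "sets (arc_length m) = sets borel" by (simp add: arc_length_def Let_def)
    then have "A \<in> sets borel" using A by auto
    with A have "AE t in lborel. hyperbola_point m t \<notin> A" by (simp add: null_sets_arc_length_iff)
    then have "AE t in lborel. indicator A (hyperbola_point m t) *\<^sub>R f t = 0"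
      by eventually_elim simp
    then show ?thesis unfolding curve_measure_def by (rule integral_eq_zero_AE)
  qed
qed

lemma compression_curve_measure:
  "compression (curve_measure (hyperbola_point m) f) = curve_measure (\<lambda>t. t) f"
  by (simp add: fun_eq_iff compression_def curve_measure_def hyperbola_point_def indicator_times)

subsection \<open>Hardy space of the upper half-plane\<close>

text \<open>Normalized to have the value 1 at \<open>t = 0\<close>: the modulus is then at most 1
  for every \<open>a\<close>, and \<open>a = 0\<close> gives the constant 1.\<close>

definition resolvent :: "real \<Rightarrow> real \<Rightarrow> complex" where
  "resolvent a t = 1 / (1 - \<i> * complex_of_real (a * t))"

lemma resolvent_denom_nonzero: "1 - \<i> * complex_of_real x \<noteq> 0"
  by (simp add: complex_eq_iff)

lemma resolvent_measurable [measurable]: "resolvent a \<in> borel_measurable borel"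
  unfolding resolvent_def by measurable

lemma resolvent_continuous_arg: "continuous_on UNIV (\<lambda>a. resolvent a t)"
  unfolding resolvent_def
  by (intro continuous_intros) (simp add: complex_eq_iff)

lemma norm_resolvent_le: "norm (resolvent a t) \<le> 1"
proof -
  have "1 \<le> norm (1 - \<i> * complex_of_real (a * t))"
    using abs_Re_le_cmod[of "1 - \<i> * complex_of_real (a * t)"] by simp
  then show ?thesis by (simp add: resolvent_def norm_divide)
qed

lemma norm_one_minus_resolvent_le: "norm (1 - resolvent a t) \<le> 1"
proof -
  have *: "1 - resolvent a t = - (\<i> * complex_of_real (a * t)) / (1 - \<i> * complex_of_real (a * t))"
    using resolvent_denom_nonzero[of "a * t"] by (simp add: resolvent_def field_simps)
  have "norm (\<i> * complex_of_real (a * t)) \<le> norm (1 - \<i> * complex_of_real (a * t))"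
    using abs_Im_le_cmod[of "1 - \<i> * complex_of_real (a * t)"] by (simp add: norm_mult)
  moreover have "norm (1 - \<i> * complex_of_real (a * t)) > 0"
    using resolvent_denom_nonzero[of "a * t"] by simp
  ultimately show ?thesis unfolding * by (simp add: norm_divide)
qed

text \<open>Partial fractions. Pairings with a product of two kernels reduce to pairings with single
  kernels, which makes \<open>hardy\<close> stable under multiplication by a kernel.\<close>

lemma resolvent_identity:
  assumes "a \<noteq> b"
  shows "resolvent a t * resolvent b t
    = (complex_of_real a * resolvent a t - complex_of_real b * resolvent b t) / complex_of_real (a - b)"
  using resolvent_denom_nonzero[of "a * t"] resolvent_denom_nonzero[of "b * t"] assms
  unfolding resolvent_def by (simp add: divide_simps) (simp add: algebra_simps)

lemma integrable_mult_bounded: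
  fixes F g :: "'a \<Rightarrow> complex"
  assumes F: "integrable M F" and g: "g \<in> borel_measurable M" and b: "\<And>x. norm (g x) \<le> B"
  shows "integrable M (\<lambda>x. F x * g x)"
proof (rule Bochner_Integration.integrable_bound)
  show "integrable M (\<lambda>x. B * norm (F x))" using F by simp
  show "(\<lambda>x. F x * g x) \<in> borel_measurable M"
    using F g by measurable
  show "AE x in M. norm (F x * g x) \<le> norm (B * norm (F x))"
  proof (rule AE_I2)
    fix x
    have "norm (F x) * norm (g x) \<le> norm (F x) * B" by (intro mult_left_mono b) simp
    also have "\<dots> \<le> \<bar>B * norm (F x)\<bar>" by (simp add: mult.commute)
    finally show "norm (F x * g x) \<le> norm (B * norm (F x))" by (simp add: norm_mult)
  qed
qed

lemma tendsto_integral_mult_bounded: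
  fixes F :: "'a \<Rightarrow> complex" and g :: "nat \<Rightarrow> 'a \<Rightarrow> complex"
  assumes F: "integrable M F" and g[measurable]: "\<And>n. g n \<in> borel_measurable M"
    and g'[measurable]: "g' \<in> borel_measurable M"
    and b: "\<And>n x. norm (g n x) \<le> B" and lim: "AE x in M. (\<lambda>n. g n x) \<longlonglongrightarrow> g' x"
  shows "(\<lambda>n. \<integral>x. F x * g n x \<partial>M) \<longlonglongrightarrow> (\<integral>x. F x * g' x \<partial>M)"
proof (rule integral_dominated_convergence[where w="\<lambda>x. B * norm (F x)"])
  have [measurable]: "F \<in> borel_measurable M" using F by simp
  show "(\<lambda>x. F x * g' x) \<in> borel_measurable M" "\<And>i. (\<lambda>x. F x * g i x) \<in> borel_measurable M"
    by measurable
  show "integrable M (\<lambda>x. B * norm (F x))" using F by simp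
  show "AE x in M. (\<lambda>i. F x * g i x) \<longlonglongrightarrow> F x * g' x"
    using lim by eventually_elim (intro tendsto_intros)
  show "AE x in M. norm (F x * g i x) \<le> B * norm (F x)" for i
  proof (rule AE_I2)
    fix x
    have "norm (F x) * norm (g i x) \<le> norm (F x) * B" by (intro mult_left_mono b) simp
    then show "norm (F x * g i x) \<le> B * norm (F x)" by (simp add: norm_mult mult.commute)
  qed
qed

text \<open>These are the boundary functions of the Hardy space \<open>H\<^sup>1\<close> of the upper half-plane:
  \<open>resolvent a\<close> is a Cauchy kernel with pole at \<open>- \<i> / a\<close> in the lower half-plane.\<close>

definition hardy :: "(real \<Rightarrow> complex) \<Rightarrow> bool" where
  "hardy F \<longleftrightarrow> integrable lborel F \<and> (\<integral>t. F t \<partial>lborel) = 0 \<and>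
     (\<forall>a>0. (\<integral>t. F t * resolvent a t \<partial>lborel) = 0)"

lemma integrable_mult_resolvent:
  "integrable lborel F \<Longrightarrow> integrable lborel (\<lambda>t. F t * resolvent a t)"
  by (rule integrable_mult_bounded[where B=1]) (auto simp: norm_resolvent_le)

lemma tendsto_integral_resolvent:
  assumes "integrable lborel F" "s \<longlonglongrightarrow> a"
  shows "(\<lambda>n. \<integral>t. F t * resolvent (s n) t \<partial>lborel) \<longlonglongrightarrow> (\<integral>t. F t * resolvent a t \<partial>lborel)"
proof (rule tendsto_integral_mult_bounded[where B=1])
  have "(\<lambda>n. resolvent (s n) t) \<longlonglongrightarrow> resolvent a t" for t
    using resolvent_continuous_arg[of t] assms(2)
    by (intro isCont_tendsto_compose[of a "\<lambda>a. resolvent a t"])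
      (auto simp: continuous_on_eq_continuous_at)
  then show "AE t in lborel. (\<lambda>n. resolvent (s n) t) \<longlonglongrightarrow> resolvent a t" by simp
qed (auto simp: assms norm_resolvent_le)

text \<open>Partial fractions degenerate when two poles coincide. The one excluded parameter
  \<open>b\<close> is recovered here, since the pairing with \<open>resolvent a\<close> is
  continuous in \<open>a\<close>.\<close>

lemma hardyI_resolvent_limit:
  assumes F: "integrable lborel F" "(\<integral>t. F t \<partial>lborel) = 0"
    and a: "\<And>a. a > 0 \<Longrightarrow> a \<noteq> b \<Longrightarrow> (\<integral>t. F t * resolvent a t \<partial>lborel) = 0"
  shows "hardy F"
  unfolding hardy_def
proof (intro conjI allI impI F)
  fix c :: real assume "c > 0"
  show "(\<integral>t. F t * resolvent c t \<partial>lborel) = 0"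
  proof (cases "c = b")
    case True
    let ?s = "\<lambda>n. c + inverse (real (Suc n))"
    have "?s \<longlonglongrightarrow> c + 0" by (intro tendsto_intros LIMSEQ_inverse_real_of_nat)
    then have "(\<lambda>n. \<integral>t. F t * resolvent (?s n) t \<partial>lborel) \<longlonglongrightarrow> (\<integral>t. F t * resolvent c t \<partial>lborel)"
      by (intro tendsto_integral_resolvent F) simp
    moreover have "(\<integral>t. F t * resolvent (?s n) t \<partial>lborel) = 0" for n
    proof (rule a)
      show "?s n > 0" using \<open>c > 0\<close> by (intro add_pos_pos) auto
      show "?s n \<noteq> b" using True by simp
    qed
    ultimately show ?thesis by (simp add: LIMSEQ_const_iff)
  qed (use a \<open>c > 0\<close> in auto)
qed

lemma hardy_mult_resolvent:
  assumes F: "hardy F" and b: "b > 0"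
  shows "hardy (\<lambda>t. F t * resolvent b t)"
proof (rule hardyI_resolvent_limit)
  have int: "integrable lborel F" using F by (simp add: hardy_def)
  show "integrable lborel (\<lambda>t. F t * resolvent b t)" by (rule integrable_mult_resolvent[OF int])
  show "(\<integral>t. F t * resolvent b t \<partial>lborel) = 0" using F b by (simp add: hardy_def)
  fix a :: real assume a: "a > 0" "a \<noteq> b"
  have "F t * resolvent b t * resolvent a t
    = (complex_of_real a / complex_of_real (a - b)) * (F t * resolvent a t)
     - (complex_of_real b / complex_of_real (a - b)) * (F t * resolvent b t)" for t
  proof -
    have "F t * resolvent b t * resolvent a t = F t * (resolvent a t * resolvent b t)" by (simp add: mult_ac)
    also have "\<dots> = F t * (complex_of_real a * resolvent a t - complex_of_real b * resolvent b t) / complex_of_real (a - b)"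
      by (simp only: resolvent_identity[OF a(2)] times_divide_eq_right)
    finally show ?thesis by (simp add: right_diff_distrib diff_divide_distrib mult_ac del: of_real_diff)
  qed
  then have "(\<integral>t. F t * resolvent b t * resolvent a t \<partial>lborel)
     = (complex_of_real a / complex_of_real (a - b)) * (\<integral>t. F t * resolvent a t \<partial>lborel)
     - (complex_of_real b / complex_of_real (a - b)) * (\<integral>t. F t * resolvent b t \<partial>lborel)"
    using integrable_mult_resolvent[OF int] by simp
  then show "(\<integral>t. F t * resolvent b t * resolvent a t \<partial>lborel) = 0"
    using F a b by (simp add: hardy_def)
qed

lemma hardy_diff: "hardy F \<Longrightarrow> hardy G \<Longrightarrow> hardy (\<lambda>t. F t - G t)"
  by (simp add: hardy_def left_diff_distrib integrable_mult_resolvent)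

lemma hardy_add: "hardy F \<Longrightarrow> hardy G \<Longrightarrow> hardy (\<lambda>t. F t + G t)"
  by (simp add: hardy_def distrib_right integrable_mult_resolvent)

lemma hardy_cmult: "hardy F \<Longrightarrow> hardy (\<lambda>t. c * F t)"
  by (simp add: hardy_def mult.assoc integrable_mult_resolvent)

lemma hardy_mult_one_minus_resolvent:
  assumes F: "hardy F" and b: "b > 0"
  shows "hardy (\<lambda>t. F t * (1 - resolvent b t))"
  using hardy_diff[OF F hardy_mult_resolvent[OF F b]] by (simp add: algebra_simps)

text \<open>The bounded rational functions
  \<open>(1 - \<i> a t / N)\<^bsup>-N\<^esup> (1 + \<i> b / (N t))\<^bsup>-N\<^esup>\<close>, with all poles in the lower half-plane, which
  converge to \<open>exp (\<i> a t - \<i> b / t)\<close>.\<close>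

definition hyp_approx :: "real \<Rightarrow> real \<Rightarrow> nat \<Rightarrow> real \<Rightarrow> complex" where
  "hyp_approx a b n t = resolvent (a / real (Suc n)) t ^ Suc n *
     (if b = 0 then 1 else 1 - resolvent (real (Suc n) / b) t) ^ Suc n"

definition hyp_exp :: "real \<Rightarrow> real \<Rightarrow> real \<Rightarrow> complex" where
  "hyp_exp a b t = exp (\<i> * complex_of_real (a * t - b / t))"

lemma norm_hyp_approx_le: "norm (hyp_approx a b n t) \<le> 1"
proof -
  have "norm (resolvent (a / real (Suc n)) t ^ Suc n) \<le> 1"
    unfolding norm_power by (intro power_le_one norm_ge_zero norm_resolvent_le)
  moreover have "norm ((if b = 0 then 1 else 1 - resolvent (real (Suc n) / b) t) ^ Suc n) \<le> 1"
    unfolding norm_power by (intro power_le_one norm_ge_zero) (auto simp: norm_one_minus_resolvent_le)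
  ultimately show ?thesis
    unfolding hyp_approx_def norm_mult by (intro mult_le_one norm_ge_zero)
qed

lemma hyp_approx_measurable [measurable]: "hyp_approx a b n \<in> borel_measurable borel"
  unfolding hyp_approx_def by measurable

lemma hyp_exp_measurable [measurable]: "hyp_exp a b \<in> borel_measurable borel"
  unfolding hyp_exp_def by measurable

lemma norm_hyp_exp [simp]: "norm (hyp_exp a b t) = 1"
  by (simp add: hyp_exp_def)

lemma upper_denom_norm: "Im w \<ge> 0 \<Longrightarrow> norm (1 - \<i> * w) \<ge> 1"
  using abs_Re_le_cmod[of "1 - \<i> * w"] by simp

text \<open>For \<open>Im x \<ge> 0\<close> both bases have modulus at most 1, so the N-th powers
  differ by at most N times the difference of the bases. That difference is \<open>h (x / N)\<close>
  with \<open>h y / y\<close> tending to 0. The argument is complex because the limit is taken both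
  on the real line and at points of the upper half-plane.\<close>

lemma tendsto_inverse_power_exp:
  assumes "Im x \<ge> 0"
  shows "(\<lambda>n. (1 / (1 - \<i> * (x / of_nat (Suc n)))) ^ Suc n) \<longlonglongrightarrow> exp (\<i> * x)"
proof -
  define h where "h y = 1 / (1 - \<i> * y) - exp (\<i> * y)" for y
  have "(h has_field_derivative 0) (at 0)"
    unfolding h_def by (auto intro!: derivative_eq_intros)
  then have h: "((\<lambda>y. h y / y) \<longlongrightarrow> 0) (at 0)"
    by (simp add: DERIV_def h_def)
  have lim: "(\<lambda>n. of_nat (Suc n) * h (x / of_nat (Suc n))) \<longlonglongrightarrow> 0"
  proof (cases "x = 0")
    case False
    have "(\<lambda>n. x / of_nat (Suc n)) \<longlonglongrightarrow> 0"
      by (rule LIMSEQ_Suc[OF lim_const_over_n])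
    then have "filterlim (\<lambda>n. x / of_nat (Suc n)) (at 0) sequentially"
      using False unfolding filterlim_at by (auto simp del: of_nat_Suc)
    from filterlim_compose[OF h this]
    have "(\<lambda>n. x * (h (x / of_nat (Suc n)) / (x / of_nat (Suc n)))) \<longlonglongrightarrow> x * 0"
      by (intro tendsto_intros)
    then show ?thesis using False by (simp add: mult.commute)
  qed (simp add: h_def)
  have eq: "exp (\<i> * x) = exp (\<i> * (x / of_nat (Suc n))) ^ Suc n" for n
    by (subst exp_of_nat_mult[symmetric]) (simp add: field_simps del: of_nat_Suc)
  have "norm ((1 / (1 - \<i> * (x / of_nat (Suc n)))) ^ Suc n - exp (\<i> * x))
     \<le> norm (of_nat (Suc n) * h (x / of_nat (Suc n)))" for n
  proof -
    have im: "Im (x / of_nat (Suc n)) \<ge> 0"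
      using assms by (simp add: Im_divide_of_nat del: of_nat_Suc)
    have "norm (1 / (1 - \<i> * (x / of_nat (Suc n)))) \<le> 1"
      using upper_denom_norm[OF im] by (simp add: norm_divide divide_le_eq del: of_nat_Suc)
    moreover have "norm (exp (\<i> * (x / of_nat (Suc n)))) \<le> 1"
      using im by (simp del: of_nat_Suc)
    ultimately have "norm ((1 / (1 - \<i> * (x / of_nat (Suc n)))) ^ Suc n - exp (\<i> * (x / of_nat (Suc n))) ^ Suc n)
      \<le> real (Suc n) * norm (1 / (1 - \<i> * (x / of_nat (Suc n))) - exp (\<i> * (x / of_nat (Suc n))))"
      by (intro norm_power_diff)
    then show ?thesis unfolding eq[of n, symmetric] h_def norm_mult norm_of_nat .
  qed
  then have "(\<lambda>n. (1 / (1 - \<i> * (x / of_nat (Suc n)))) ^ Suc n - exp (\<i> * x)) \<longlonglongrightarrow> 0"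
    by (intro Lim_null_comparison[OF _ tendsto_norm_zero[OF lim]]) auto
  then show ?thesis by (simp add: LIM_zero_iff)
qed

lemma tendsto_resolvent_power:
  "(\<lambda>n. resolvent (a / real (Suc n)) t ^ Suc n) \<longlonglongrightarrow> exp (\<i> * complex_of_real (a * t))"
  using tendsto_inverse_power_exp[of "complex_of_real (a * t)"] by (simp add: resolvent_def del: of_nat_Suc)

lemma tendsto_hyp_approx:
  assumes "t \<noteq> 0"
  shows "(\<lambda>n. hyp_approx a b n t) \<longlonglongrightarrow> hyp_exp a b t"
proof -
  \<comment> \<open>In the variable \<open>1 / t\<close> the factor \<open>1 - resolvent\<close> is
    again a resolvent, with a negative parameter, so \<open>tendsto_resolvent_power\<close> covers
    both factors.\<close>
  have eq: "(if b = 0 then 1 else 1 - resolvent (real (Suc n) / b) t) = resolvent (- b / real (Suc n)) (1 / t)" for n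
  proof (cases "b = 0")
    case False
    have "1 - \<i> * complex_of_real (real (Suc n) / b * t) \<noteq> 0" by (rule resolvent_denom_nonzero)
    moreover have "1 - \<i> * complex_of_real (- b / real (Suc n) * (1 / t)) \<noteq> 0" by (rule resolvent_denom_nonzero)
    ultimately show ?thesis using False assms
      unfolding resolvent_def
      by (simp add: divide_simps del: of_nat_Suc) (auto simp: algebra_simps simp del: of_nat_Suc)
  qed (simp add: resolvent_def)
  have "(\<lambda>n. hyp_approx a b n t) \<longlonglongrightarrow> exp (\<i> * complex_of_real (a * t)) * exp (\<i> * complex_of_real (- b * (1 / t)))"
    unfolding hyp_approx_def eq by (intro tendsto_mult tendsto_resolvent_power)
  also have "exp (\<i> * complex_of_real (a * t)) * exp (\<i> * complex_of_real (- b * (1 / t))) = hyp_exp a b t"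
    unfolding hyp_exp_def by (simp add: exp_add[symmetric] algebra_simps)
  finally show ?thesis .
qed

lemma hardy_mult_resolvent_power: "hardy F \<Longrightarrow> b > 0 \<Longrightarrow> hardy (\<lambda>t. F t * resolvent b t ^ n)"
  by (induction n) (auto simp: power_Suc2 mult.assoc[symmetric] intro: hardy_mult_resolvent simp del: power_Suc)

lemma hardy_mult_one_minus_resolvent_power:
  "hardy F \<Longrightarrow> b > 0 \<Longrightarrow> hardy (\<lambda>t. F t * (1 - resolvent b t) ^ n)"
  by (induction n) (auto simp: power_Suc2 mult.assoc[symmetric] intro: hardy_mult_one_minus_resolvent simp del: power_Suc)

lemma hardy_mult_hyp_approx:
  assumes F: "hardy F" and ab: "a \<ge> 0" "b \<ge> 0"
  shows "hardy (\<lambda>t. F t * hyp_approx a b n t)"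
proof -
  have 1: "hardy (\<lambda>t. F t * resolvent (a / real (Suc n)) t ^ Suc n)"
  proof (cases "a = 0")
    case True
    have "resolvent 0 = (\<lambda>t. 1)" by (simp add: resolvent_def fun_eq_iff)
    then show ?thesis using F True by simp
  next
    case False
    then have "a / real (Suc n) > 0" using ab by simp
    then show ?thesis using hardy_mult_resolvent_power[OF F] by blast
  qed
  show ?thesis
  proof (cases "b = 0")
    case True
    then show ?thesis using 1 by (simp add: hyp_approx_def)
  next
    case False
    then have "real (Suc n) / b > 0" using ab by simp
    from hardy_mult_one_minus_resolvent_power[OF 1 this, of "Suc n"] False
    show ?thesis by (simp add: hyp_approx_def mult.assoc)
  qed
qed

lemma tendsto_integral_hyp_approx:
  assumes F: "integrable lborel F"
  shows "(\<lambda>n. \<integral>t. F t * hyp_approx a b n t \<partial>lborel) \<longlonglongrightarrow> (\<integral>t. F t * hyp_exp a b t \<partial>lborel)"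
proof (rule tendsto_integral_mult_bounded[where B=1])
  have "AE t in lborel. t \<noteq> (0::real)" by (rule AE_lborel_singleton)
  then show "AE t in lborel. (\<lambda>n. hyp_approx a b n t) \<longlonglongrightarrow> hyp_exp a b t"
    by eventually_elim (rule tendsto_hyp_approx)
qed (auto simp: F norm_hyp_approx_le)

lemma integral_hardy_hyp_exp:
  assumes F: "hardy F" and ab: "a \<ge> 0" "b \<ge> 0"
  shows "(\<integral>t. F t * hyp_exp a b t \<partial>lborel) = 0"
proof -
  have "(\<lambda>n. \<integral>t. F t * hyp_approx a b n t \<partial>lborel) \<longlonglongrightarrow> (\<integral>t. F t * hyp_exp a b t \<partial>lborel)"
    using F by (intro tendsto_integral_hyp_approx) (simp add: hardy_def)
  moreover have "(\<integral>t. F t * hyp_approx a b n t \<partial>lborel) = 0" for n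
    using hardy_mult_hyp_approx[OF F ab, of n] by (simp add: hardy_def)
  ultimately show ?thesis by (simp add: LIMSEQ_const_iff)
qed

subsection \<open>Periodization\<close>

text \<open>The characters are those of period 2: all Fourier coefficients of the 2-periodization of
  \<open>F\<close> vanish. The form in which this is used is
  \<open>char_annih_periodic\<close>.\<close>

definition char_annih :: "(real \<Rightarrow> complex) \<Rightarrow> bool" where
  "char_annih F \<longleftrightarrow> integrable lborel F \<and>
     (\<forall>j::int. (\<integral>t. F t * cis (pi * of_int j * t) \<partial>lborel) = 0)"

lemma cis_measurable [measurable]: "(\<lambda>t. cis (c * t)) \<in> borel_measurable borel"
  unfolding cis_conv_exp by measurable

lemma char_annih_integral: "char_annih F \<Longrightarrow> (\<integral>t. F t \<partial>lborel) = 0"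
  unfolding char_annih_def by (elim conjE allE[of _ 0]) simp

lemma char_annih_mult_cis:
  assumes F: "char_annih F"
  shows "char_annih (\<lambda>t. F t * cis (pi * of_int k * t))"
  unfolding char_annih_def
proof (intro conjI allI)
  have int: "integrable lborel F" using F by (simp add: char_annih_def)
  show "integrable lborel (\<lambda>t. F t * cis (pi * of_int k * t))"
    by (rule integrable_mult_bounded[OF int, where B=1]) auto
  fix j :: int
  have "F t * cis (pi * of_int k * t) * cis (pi * of_int j * t) = F t * cis (pi * of_int (k + j) * t)" for t
    unfolding mult.assoc[of "F t"] cis_mult by (simp add: algebra_simps)
  then show "(\<integral>t. F t * cis (pi * of_int k * t) * cis (pi * of_int j * t) \<partial>lborel) = 0"
    using F unfolding char_annih_def by presburger
qed

lemma char_annih_add: "char_annih F \<Longrightarrow> char_annih G \<Longrightarrow> char_annih (\<lambda>t. F t + G t)"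
  by (simp add: char_annih_def distrib_right integrable_mult_bounded[where B=1])

lemma char_annih_cmult: "char_annih F \<Longrightarrow> char_annih (\<lambda>t. F t * c)"
proof -
  assume F: "char_annih F"
  have "F t * c * cis (pi * of_int j * t) = F t * cis (pi * of_int j * t) * c" for j t
    by (simp add: mult_ac)
  then show "char_annih (\<lambda>t. F t * c)" using F by (simp only: char_annih_def) simp
qed

text \<open>On the unit circle a real-linear function is a combination of \<open>z\<close> and its
  inverse, and multiplying by either only shifts the index of the characters. The induction over
  polynomials runs for all \<open>F\<close> at once, so that a product is treated one factor at a
  time.\<close>

lemma char_annih_mult_polynomial:
  fixes u :: "complex \<Rightarrow> real"
  assumes "real_polynomial_function u" "char_annih F"
  shows "char_annih (\<lambda>t. F t * complex_of_real (u (cis (pi * t))))"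
  using assms
proof (induction arbitrary: F)
  case (linear f)
  then interpret bounded_linear f by simp
  have f: "f z = Re z * f 1 + Im z * f \<i>" for z
  proof -
    have "f z = f (Re z *\<^sub>R 1 + Im z *\<^sub>R \<i>)" by (rule arg_cong[where f=f]) (simp add: complex_eq_iff)
    then show ?thesis by (simp add: add scaleR)
  qed
  have eq: "complex_of_real (f (cis (pi * t)))
     = cis (pi * of_int 1 * t) * ((f 1 - \<i> * f \<i>) / 2) + cis (pi * of_int (-1) * t) * ((f 1 + \<i> * f \<i>) / 2)" for t
    by (subst f[of "cis (pi * t)"]) (simp add: complex_eq_iff field_simps)
  have "char_annih (\<lambda>t. F t * cis (pi * of_int 1 * t) * ((f 1 - \<i> * f \<i>) / 2)
     + F t * cis (pi * of_int (-1) * t) * ((f 1 + \<i> * f \<i>) / 2))"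
    by (intro char_annih_add char_annih_cmult char_annih_mult_cis linear.prems)
  then show ?case unfolding eq by (simp add: distrib_left mult.assoc)
next
  case (const c)
  then show ?case by (rule char_annih_cmult)
next
  case (add f g)
  then show ?case using char_annih_add[OF add.IH(1) add.IH(2)] by (simp add: distrib_left)
next
  case (mult f g)
  then show ?case using mult.IH(2)[OF mult.IH(1)[OF mult.prems]] by (simp add: mult.assoc)
qed

text \<open>Stone-Weierstrass on the unit circle: a uniform error \<open>e / (I + 1)\<close> costs
  at most \<open>e\<close> after integration against \<open>F\<close>, where \<open>I\<close> is the
  norm of \<open>F\<close>; the summand 1 covers \<open>I = 0\<close>.\<close>

lemma char_annih_continuous:
  fixes v :: "complex \<Rightarrow> real"
  assumes F: "char_annih F" and v: "continuous_on UNIV v"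
  shows "(\<integral>t. F t * complex_of_real (v (cis (pi * t))) \<partial>lborel) = 0"
proof -
  have int: "integrable lborel F" using F by (simp add: char_annih_def)
  have [measurable]: "v \<in> borel_measurable borel" using v by (rule borel_measurable_continuous_onI)
  have bd: "\<exists>B. \<forall>t. \<bar>h (cis (pi * t))\<bar> \<le> B" if "continuous_on (sphere 0 1) h" for h :: "complex \<Rightarrow> real"
  proof -
    have "bounded (h ` sphere 0 1)"
      by (intro compact_imp_bounded compact_continuous_image that compact_sphere)
    then obtain B where "\<forall>y\<in>h ` sphere 0 1. norm y \<le> B" unfolding bounded_iff by blast
    then show ?thesis by (intro exI[of _ B]) auto
  qed
  have vs: "continuous_on (sphere 0 1) v" using v continuous_on_subset by blast
  obtain B where B: "\<And>t. \<bar>v (cis (pi * t))\<bar> \<le> B" using bd[OF vs] by blast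
  have iv: "integrable lborel (\<lambda>t. F t * complex_of_real (v (cis (pi * t))))"
    by (rule integrable_mult_bounded[OF int, where B=B]) (auto simp: B)
  have "norm (\<integral>t. F t * complex_of_real (v (cis (pi * t))) \<partial>lborel) \<le> e" if "e > 0" for e :: real
  proof -
    define I where "I = (\<integral>t. norm (F t) \<partial>lborel)"
    have I: "I \<ge> 0" by (simp add: I_def)
    have "e / (I + 1) > 0" using \<open>e > 0\<close> I by simp
    from Stone_Weierstrass_polynomial_function[OF compact_sphere vs this]
    obtain g where g: "polynomial_function g" "\<And>z. z \<in> sphere 0 1 \<Longrightarrow> norm (v z - g z) < e / (I + 1)"
      by blast
    have gp: "real_polynomial_function g" using g(1) by (simp add: real_polynomial_function_eq)
    have ann: "char_annih (\<lambda>t. F t * complex_of_real (g (cis (pi * t))))"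
      by (rule char_annih_mult_polynomial[OF gp F])
    have "norm (\<integral>t. F t * complex_of_real (v (cis (pi * t))) \<partial>lborel)
       = norm (\<integral>t. F t * complex_of_real (v (cis (pi * t))) - F t * complex_of_real (g (cis (pi * t))) \<partial>lborel)"
      using iv ann char_annih_integral[OF ann] by (subst Bochner_Integration.integral_diff) (auto simp: char_annih_def)
    also have "\<dots> \<le> (\<integral>t. norm (F t * complex_of_real (v (cis (pi * t))) - F t * complex_of_real (g (cis (pi * t)))) \<partial>lborel)"
      by (rule integral_norm_bound)
    also have "\<dots> \<le> (\<integral>t. e / (I + 1) * norm (F t) \<partial>lborel)"
    proof (rule integral_mono)
      show "integrable lborel (\<lambda>t. norm (F t * complex_of_real (v (cis (pi * t))) - F t * complex_of_real (g (cis (pi * t)))))"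
        using iv ann by (auto simp: char_annih_def)
      show "integrable lborel (\<lambda>t. e / (I + 1) * norm (F t))" using int by simp
      fix t
      have "norm (F t * complex_of_real (v (cis (pi * t))) - F t * complex_of_real (g (cis (pi * t))))
        = norm (F t) * norm (v (cis (pi * t)) - g (cis (pi * t)))"
        by (simp add: norm_mult right_diff_distrib[symmetric] flip: of_real_diff)
      also have "\<dots> \<le> norm (F t) * (e / (I + 1))"
        using g(2)[of "cis (pi * t)"] by (intro mult_left_mono) auto
      finally show "norm (F t * complex_of_real (v (cis (pi * t))) - F t * complex_of_real (g (cis (pi * t)))) \<le> e / (I + 1) * norm (F t)"
        by (simp add: mult.commute)
    qed
    also have "\<dots> = e / (I + 1) * I" by (simp add: I_def)
    also have "\<dots> \<le> e" using I \<open>e > 0\<close> by (simp add: field_simps)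
    finally show ?thesis .
  qed
  then have "norm (\<integral>t. F t * complex_of_real (v (cis (pi * t))) \<partial>lborel) \<le> 0"
    by (rule field_le_epsilon[of _ 0, simplified])
  then show ?thesis by simp
qed

lemma curve_measure_eq_zero_bounded:
  fixes h :: "'a::topological_space \<Rightarrow> complex"
  assumes F: "integrable lborel F" and p[measurable]: "p \<in> borel \<rightarrow>\<^sub>M borel"
    and null: "\<And>A. A \<in> sets borel \<Longrightarrow> curve_measure p F A = 0"
    and h[measurable]: "h \<in> borel_measurable borel" and bd: "\<And>x. norm (h x) \<le> K"
  shows "(\<integral>t. F t * h (p t) \<partial>lborel) = 0"
proof -
  obtain s where s: "\<And>i. simple_function borel (s i)" "\<And>x. (\<lambda>i. s i x) \<longlonglongrightarrow> h x"
     "\<And>i x. dist (s i x) 0 \<le> 2 * dist (h x) 0"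
    using borel_measurable_implies_sequence_metric[OF h, of 0] by auto
  have sm[measurable]: "s i \<in> borel_measurable borel" for i
    using s(1) by (rule borel_measurable_simple_function)
  have "(\<integral>t. F t * s i (p t) \<partial>lborel) = 0" for i
  proof -
    have fin: "finite (range (s i))" using s(1)[of i] by (simp add: simple_function_def)
    have eq: "F t * s i (p t) = (\<Sum>y\<in>range (s i). y * (indicator (s i -` {y}) (p t) *\<^sub>R F t))" for t
    proof -
      have "(\<Sum>y\<in>range (s i). y * (indicator (s i -` {y}) (p t) *\<^sub>R F t))
        = (\<Sum>y\<in>range (s i). if y = s i (p t) then y * F t else 0)"
        by (intro sum.cong) (auto simp: indicator_def)
      also have "\<dots> = s i (p t) * F t" using fin by simp
      finally show ?thesis by (simp add: mult.commute)
    qed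
    have set: "s i -` {y} \<in> sets borel" for y
      using measurable_sets[OF sm, of "{y}" i] by simp
    have "(\<integral>t. F t * s i (p t) \<partial>lborel) = (\<Sum>y\<in>range (s i). y * curve_measure p F (s i -` {y}))"
      unfolding eq curve_measure_def
      using integrable_indicator_comp[OF F p set] by (subst Bochner_Integration.integral_sum) (auto simp del: mult_scaleR_right)
    then show ?thesis by (simp add: null[OF set])
  qed
  moreover have "(\<lambda>i. \<integral>t. F t * s i (p t) \<partial>lborel) \<longlonglongrightarrow> (\<integral>t. F t * h (p t) \<partial>lborel)"
  proof (rule tendsto_integral_mult_bounded[OF F, where B="2 * K"])
    show "norm (s i (p t)) \<le> 2 * K" for i t
      using s(3)[of i "p t"] bd[of "p t"] by simp
  qed (use s(2) in auto)
  ultimately show ?thesis by (simp add: LIMSEQ_const_iff)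
qed

text \<open>The image of \<open>F dt\<close> on the circle is the zero measure. For a closed set,
  the indicator is a bounded limit of continuous functions of the distance; closed sets form an
  intersection-stable generator of the Borel sets, and the remaining sets follow by Dynkin's
  argument.\<close>

lemma char_annih_circle:
  assumes F: "char_annih F" and A: "A \<in> sets borel"
  shows "curve_measure (\<lambda>t. cis (pi * t)) F A = 0"
proof -
  have int: "integrable lborel F" using F by (simp add: char_annih_def)
  define p where "p t = cis (pi * t)" for t
  have p[measurable]: "p \<in> borel \<rightarrow>\<^sub>M borel" unfolding p_def by measurable
  have cb: "complex_borel_measure (curve_measure p F)"
    by (rule complex_borel_measure_curve[OF int p])
  have cl: "curve_measure p F C = 0" if C: "closed C" for C
  proof (cases "C = {}")
    case True
    then show ?thesis by (simp add: curve_measure_def)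
  next
    case False
    define v where "v n z = max 0 (1 - real n * infdist z C)" for n z
    have cv: "continuous_on UNIV (v n)" for n unfolding v_def by (intro continuous_intros)
    have [measurable]: "v n \<in> borel_measurable borel" for n using cv by (rule borel_measurable_continuous_onI)
    have lim: "(\<lambda>n. v n z) \<longlonglongrightarrow> indicator C z" for z
    proof (cases "z \<in> C")
      case True
      then show ?thesis by (simp add: v_def)
    next
      case outside: False
      then have pos: "infdist z C > 0" using in_closed_iff_infdist_zero[OF C False, of z] infdist_nonneg[of z C] by linarith
      have "\<forall>\<^sub>F n in sequentially. v n z = 0"
        using eventually_ge_at_top[of "nat \<lceil>1 / infdist z C\<rceil>"]
      proof eventually_elim
        case (elim n)
        then have "1 / infdist z C \<le> real n" by linarith
        then show ?case using pos by (simp add: v_def field_simps)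
      qed
      then show ?thesis using outside by (simp add: tendsto_eventually)
    qed
    have "(\<lambda>n. \<integral>t. F t * complex_of_real (v n (p t)) \<partial>lborel) \<longlonglongrightarrow> (\<integral>t. F t * complex_of_real (indicator C (p t)) \<partial>lborel)"
    proof (rule tendsto_integral_mult_bounded[OF int, where B=1])
      show "norm (complex_of_real (v n (p t))) \<le> 1" for n t
        using infdist_nonneg[of "p t" C] by (simp add: v_def max_def)
      show "(\<lambda>t. complex_of_real (indicator C (p t))) \<in> borel_measurable lborel"
        using measurable_sets[OF p borel_closed[OF C]] by (simp add: indicator_vimage[symmetric])
    qed (use lim in \<open>auto intro!: tendsto_of_real\<close>)
    moreover have "(\<integral>t. F t * complex_of_real (v n (p t)) \<partial>lborel) = 0" for n
      unfolding p_def by (rule char_annih_continuous[OF F cv])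
    ultimately have "(\<integral>t. F t * complex_of_real (indicator C (p t)) \<partial>lborel) = 0" by (simp add: LIMSEQ_const_iff)
    then show ?thesis by (simp add: curve_measure_def scaleR_conv_of_real mult.commute)
  qed
  have gen: "sigma_sets UNIV (Collect closed) = sets (borel :: complex measure)"
    by (simp add: borel_eq_closed)
  have "Int_stable (Collect closed :: complex set set)" by (auto simp: Int_stable_def)
  moreover have "Collect closed \<subseteq> Pow (UNIV :: complex set)" by simp
  moreover have "A \<in> sigma_sets UNIV (Collect closed)" using A gen by simp
  ultimately have "curve_measure p F A = 0"
  proof (induction A rule: sigma_sets_induct_disjoint)
    case (compl A)
    have ind: "integrable lborel (\<lambda>t. indicator A (p t) *\<^sub>R F t)"
      using compl(1) gen by (intro integrable_indicator_comp[OF int p]) simp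
    have "indicator (UNIV - A) (p t) *\<^sub>R F t = F t - indicator A (p t) *\<^sub>R F t" for t
      by (auto split: split_indicator)
    then have "curve_measure p F (UNIV - A) = (\<integral>t. F t \<partial>lborel) - curve_measure p F A"
      unfolding curve_measure_def using ind int by simp
    then show ?case using compl char_annih_integral[OF F] by simp
  next
    case (union A)
    then have "(\<lambda>n. curve_measure p F (A n)) sums curve_measure p F (\<Union>n. A n)"
    proof -
      have "range A \<subseteq> sets borel" using union(2) gen by simp
      then show ?thesis using cb union(1) unfolding complex_borel_measure_def by blast
    qed
    then show ?case using union by (simp add: sums_iff)
  qed (use cl cl[OF closed_empty] in auto)
  then show ?thesis by (simp add: p_def[abs_def])
qed

section \<open>Reduction modulo 2 to the interval [-1, 1)\<close>

definition period_red :: "real \<Rightarrow> real" where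
  "period_red t = t - 2 * of_int \<lfloor>(t + 1) / 2\<rfloor>"

lemma period_red_measurable [measurable]: "period_red \<in> borel_measurable borel"
  unfolding period_red_def by measurable

lemma period_red_bounds: "-1 \<le> period_red t" "period_red t < 1"
proof -
  have "of_int \<lfloor>(t + 1) / 2\<rfloor> \<le> (t + 1) / 2" "(t + 1) / 2 < of_int \<lfloor>(t + 1) / 2\<rfloor> + 1"
    by linarith+
  then show "-1 \<le> period_red t" "period_red t < 1" by (simp_all add: period_red_def field_simps)
qed

lemma period_red_id: "-1 \<le> t \<Longrightarrow> t < 1 \<Longrightarrow> period_red t = t"
  unfolding period_red_def by (subst floor_unique[of 0]) auto

text \<open>The half-angle formula for \<open>tan (pi * r / 2)\<close> reads the representative off
  the point of the circle by a Borel expression. At the representative -1 the denominator vanishes;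
  this concerns only countably many \<open>t\<close>.\<close>

lemma period_red_circle:
  assumes "period_red t \<noteq> -1"
  shows "2 / pi * arctan (Im (cis (pi * t)) / (1 + Re (cis (pi * t)))) = period_red t"
proof -
  define r where "r = period_red t"
  have r: "-1 < r" "r < 1" using period_red_bounds[of t] assms by (auto simp: r_def)
  have t: "pi * t = pi * r + 2 * pi * of_int \<lfloor>(t + 1) / 2\<rfloor>"
    by (simp add: r_def period_red_def algebra_simps)
  have cis: "cis (pi * t) = cis (pi * r)"
    unfolding t cis_mult[symmetric] by (simp add: cis_multiple_2pi)
  have 1: "Re (cis (pi * r)) = 2 * (cos (pi * r / 2))\<^sup>2 - 1" using cos_double_cos[of "pi * r / 2"] by simp
  have 2: "Im (cis (pi * r)) = 2 * sin (pi * r / 2) * cos (pi * r / 2)" using sin_double[of "pi * r / 2"] by simp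
  have b: "- (pi / 2) < pi * r / 2" "pi * r / 2 < pi / 2"
    using mult_strict_left_mono[OF r(1) pi_gt_zero] mult_strict_left_mono[OF r(2) pi_gt_zero] by simp_all
  have "cos (pi * r / 2) > 0" using b by (intro cos_gt_zero_pi) auto
  then have "Im (cis (pi * r)) / (1 + Re (cis (pi * r))) = tan (pi * r / 2)"
    unfolding 1 2 tan_def by (simp add: power2_eq_square)
  then have "arctan (Im (cis (pi * r)) / (1 + Re (cis (pi * r)))) = pi * r / 2"
    using b by (simp add: arctan_tan)
  then show ?thesis unfolding cis r_def[symmetric] by (simp only:) simp
qed

lemma AE_period_red: "AE t in lborel. period_red t \<noteq> -1"
proof (rule AE_I')
  have "{t. period_red t = -1} \<subseteq> range (\<lambda>k::int. 2 * of_int k - 1)"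
  proof
    fix t assume "t \<in> {t. period_red t = -1}"
    then have "t = 2 * of_int \<lfloor>(t + 1) / 2\<rfloor> - 1" by (simp add: period_red_def)
    then show "t \<in> range (\<lambda>k::int. 2 * of_int k - 1)" by blast
  qed
  then have "countable {t. period_red t = -1}" by (rule countable_subset) simp
  then show "{t. period_red t = -1} \<in> null_sets lborel" by (rule countable_imp_null_set_lborel)
qed auto

text \<open>Bounded Borel functions of period 2 are bounded Borel functions on the circle, where the
  image of \<open>F dt\<close> is zero. This admits test functions supported in a part of the
  period, which the characters do not.\<close>

lemma char_annih_periodic:
  fixes b :: "real \<Rightarrow> complex"
  assumes F: "char_annih F" and b[measurable]: "b \<in> borel_measurable borel" and bd: "\<And>t. norm (b t) \<le> K"
  shows "(\<integral>t. F t * b (period_red t) \<partial>lborel) = 0"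
proof -
  have int: "integrable lborel F" using F by (simp add: char_annih_def)
  then have [measurable]: "F \<in> borel_measurable borel" by auto
  define h where "h z = b (2 / pi * arctan (Im z / (1 + Re z)))" for z
  have h: "h \<in> borel_measurable borel" unfolding h_def by measurable
  have hm: "(\<lambda>t. h (cis (pi * t))) \<in> borel_measurable borel"
    by (rule measurable_compose[OF _ h]) measurable
  have "(\<integral>t. F t * b (period_red t) \<partial>lborel) = (\<integral>t. F t * h (cis (pi * t)) \<partial>lborel)"
  proof (rule integral_cong_AE)
    show "AE t in lborel. F t * b (period_red t) = F t * h (cis (pi * t))"
      using AE_period_red unfolding h_def by eventually_elim (subst period_red_circle, auto)
  qed (use hm in auto)
  also have "\<dots> = 0"
    by (rule curve_measure_eq_zero_bounded[OF int, where K=K])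
      (auto simp: h bd h_def char_annih_circle[OF F])
  finally show ?thesis .
qed

subsection \<open>The Gauss-type map and its transfer operator\<close>

text \<open>Change of variables on the punctured line, where the inversion is a bijection with
  derivative \<open>c / x\<^sup>2\<close>. Since Lebesgue measure is determined by its values on
  intervals, indicators of intervals are enough.\<close>

lemma lborel_inversion:
  fixes c :: real
  assumes c: "c > 0"
  shows "distr (density lborel (\<lambda>x. ennreal (c / x\<^sup>2))) borel (\<lambda>x. - (c / x)) = lborel"
proof (rule lborel_eqI[symmetric])
  let ?M = "distr (density lborel (\<lambda>x. ennreal (c / x\<^sup>2))) borel (\<lambda>x. - (c / x))"
  show "sets ?M = sets borel" by simp
  fix l u :: real assume "\<And>b. b \<in> Basis \<Longrightarrow> l \<bullet> b \<le> u \<bullet> b"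
  then have lu: "l \<le> u" by simp
  let ?f = "indicator {l<..<u} :: real \<Rightarrow> real"
  let ?g = "\<lambda>x::real. - (c / x)"
  have inj: "inj_on ?g (UNIV - {0})" using c by (auto simp: inj_on_def)
  have img: "?g ` (UNIV - {0}) = UNIV - {0}"
  proof (intro equalityI subsetI)
    fix y assume "y \<in> UNIV - {0::real}"
    then have "y = ?g (- (c / y))" "- (c / y) \<in> UNIV - {0}" using c by auto
    then show "y \<in> ?g ` (UNIV - {0})" by blast
  qed (use c in auto)
  have der: "(?g has_field_derivative c / x\<^sup>2) (at x within UNIV - {0})" if "x \<in> UNIV - {0}" for x
    using that by (auto intro!: derivative_eq_intros simp: power2_eq_square)
  have "set_integrable lebesgue UNIV ?f"
    using lu by (simp add: set_integrable_def integrable_completion)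
  then have "?f absolutely_integrable_on UNIV - {0}"
    by (rule set_integrable_subset) auto
  moreover have "integral (UNIV - {0}) ?f = u - l"
  proof -
    have "((\<lambda>x. 1) has_integral measure lborel {l<..<u}) {l<..<u}"
      using lu by (intro has_integral_measure_lborel) auto
    then have "((\<lambda>x. if x \<in> {l<..<u} then 1 else 0) has_integral (u - l)) UNIV"
      using lu by (subst has_integral_restrict_UNIV) simp
    moreover have "(\<lambda>x. if x \<in> {l<..<u} then 1 else 0) = ?f" by (auto simp: indicator_def)
    ultimately have "(?f has_integral (u - l)) UNIV" by simp
    then have "(?f has_integral (u - l)) (UNIV - {0})"
      by (rule has_integral_spike_set_eq[THEN iffD1, rotated -1]) (auto intro: negligible_subset[of "{0}"])
    then show ?thesis by (rule integral_unique)
  qed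
  ultimately have "(\<lambda>x. \<bar>c / x\<^sup>2\<bar> * ?f (?g x)) absolutely_integrable_on UNIV - {0} \<and>
      integral (UNIV - {0}) (\<lambda>x. \<bar>c / x\<^sup>2\<bar> * ?f (?g x)) = u - l"
    using has_absolute_integral_change_of_variables_1'[OF _ der inj, of ?f "u - l"] img by simp
  then have "((\<lambda>x. \<bar>c / x\<^sup>2\<bar> * ?f (?g x)) has_integral (u - l)) (UNIV - {0})"
    using absolutely_integrable_on_def has_integral_integral by metis
  then have "((\<lambda>x. \<bar>c / x\<^sup>2\<bar> * ?f (?g x)) has_integral (u - l)) UNIV"
    by (rule has_integral_spike_set_eq[THEN iffD1, rotated -1]) (auto intro: negligible_subset[of "{0}"])
  then have "(\<integral>\<^sup>+x. ennreal (indicator UNIV x * (\<bar>c / x\<^sup>2\<bar> * ?f (?g x))) \<partial>lborel) = ennreal (u - l)"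
    by (intro nn_integral_has_integral_lborel) auto
  moreover have "ennreal (indicator UNIV x * (\<bar>c / x\<^sup>2\<bar> * ?f (?g x))) = ennreal (c / x\<^sup>2) * indicator {l<..<u} (?g x)" for x
    using c by (auto simp: indicator_def)
  ultimately have "(\<integral>\<^sup>+x. ennreal (c / x\<^sup>2) * indicator {l<..<u} (?g x) \<partial>lborel) = ennreal (u - l)"
    by simp
  then show "emeasure ?M (box l u) = (\<Prod>b\<in>Basis. (u - l) \<bullet> b)"
    using measurable_sets[of ?g borel borel "{l<..<u}"]
    by (simp add: emeasure_distr emeasure_density indicator_vimage box_real)
qed

lemma nn_integral_inversion:
  fixes c :: real
  assumes c: "c > 0" and [measurable]: "f \<in> borel_measurable borel"
  shows "(\<integral>\<^sup>+x. ennreal (c / x\<^sup>2) * f (- (c / x)) \<partial>lborel) = (\<integral>\<^sup>+x. f x \<partial>lborel)"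
  by (subst (2) lborel_inversion[OF c, symmetric]) (simp add: nn_integral_distr nn_integral_density)

lemma integral_inversion:
  fixes c :: real and f :: "real \<Rightarrow> complex"
  assumes c: "c > 0" and [measurable]: "f \<in> borel_measurable borel"
  shows "(\<integral>x. (c / x\<^sup>2) *\<^sub>R f (- (c / x)) \<partial>lborel) = (\<integral>x. f x \<partial>lborel)"
  using c by (subst (2) lborel_inversion[OF c, symmetric]) (simp add: integral_distr integral_density)

lemma integrable_inversion:
  fixes c :: real and f :: "real \<Rightarrow> complex"
  assumes c: "c > 0" and f: "integrable lborel f"
  shows "integrable lborel (\<lambda>x. (c / x\<^sup>2) *\<^sub>R f (- (c / x)))"
proof -
  have [measurable]: "f \<in> borel_measurable borel" using f by auto
  have "integrable (distr (density lborel (\<lambda>x. ennreal (c / x\<^sup>2))) borel (\<lambda>x. - (c / x))) f"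
    using f by (simp add: lborel_inversion[OF c])
  then show ?thesis using c by (simp add: integrable_distr_eq integrable_density)
qed

text \<open>The dual side of the Gauss-type map \<open>s \<mapsto> -c/s mod 2\<close> on \<open>[-1, 1)\<close>, killed where
  \<open>-c/s\<close> does not leave \<open>[-1, 1)\<close>.\<close>

definition gauss_koopman :: "real \<Rightarrow> (real \<Rightarrow> 'a) \<Rightarrow> real \<Rightarrow> 'a::zero" where
  "gauss_koopman c b s = (if - (c / s) \<in> {-1..<1} then 0 else b (period_red (- (c / s))))"

definition gauss_transfer_summand :: "real \<Rightarrow> (real \<Rightarrow> ennreal) \<Rightarrow> real \<Rightarrow> ennreal" where
  "gauss_transfer_summand c h x = ennreal (c / x\<^sup>2) * h (- (c / x))"

text \<open>The density of the image of \<open>h ds\<close> under the map with killing. The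
  preimages of \<open>t\<close> are \<open>- (c / (t + 2 * k))\<close> with integers
  \<open>k \<noteq> 0\<close>, each weighted by its Jacobian; \<open>k = 0\<close> is missing
  because there the point is killed.\<close>

definition gauss_transfer :: "real \<Rightarrow> (real \<Rightarrow> ennreal) \<Rightarrow> real \<Rightarrow> ennreal" where
  "gauss_transfer c h t = (\<Sum>n. gauss_transfer_summand c h (t + 2 * real (Suc n))
      + gauss_transfer_summand c h (t - 2 * real (Suc n)))"

lemma gauss_koopman_measurable [measurable]:
  fixes b :: "real \<Rightarrow> 'a::{zero, topological_space}"
  assumes [measurable]: "b \<in> borel_measurable borel"
  shows "gauss_koopman c b \<in> borel_measurable borel"
  unfolding gauss_koopman_def by measurable

lemma gauss_transfer_summand_measurable [measurable]:
  assumes [measurable]: "h \<in> borel_measurable borel"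
  shows "gauss_transfer_summand c h \<in> borel_measurable borel"
  unfolding gauss_transfer_summand_def by measurable

lemma gauss_transfer_measurable [measurable]:
  assumes [measurable]: "h \<in> borel_measurable borel"
  shows "gauss_transfer c h \<in> borel_measurable borel"
  unfolding gauss_transfer_def by measurable

text \<open>This is where \<open>c \<le> 1\<close> enters: points outside the interval are inverted
  into it, hence killed. Iterates therefore remain supported in \<open>{-1..<1}\<close>, as the
  duality with the transfer operator requires.\<close>

lemma gauss_koopman_outside:
  assumes "0 < c" "c \<le> 1" "s \<notin> {-1..<1}"
  shows "gauss_koopman c b s = 0"
proof -
  have "- (c / s) \<in> {-1..<1}"
  proof (cases "s \<ge> 1")
    case True
    then have "c / s \<le> 1" "c / s > 0" using assms by (auto simp: field_simps)
    then show ?thesis by simp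
  next
    case False
    then have s: "s < -1" using assms by auto
    then have "- (c / s) < 1" "- (c / s) > 0" using assms by (auto simp: field_simps)
    then show ?thesis by simp
  qed
  then show ?thesis by (simp add: gauss_koopman_def)
qed

text \<open>As \<open>b\<close> lives on a single period, at most the translate by
  \<open>2 * k\<close> with \<open>k = \<lfloor>(x + 1) / 2\<rfloor>\<close> contributes. The sum
  runs over nonzero \<open>k\<close> only, so nothing survives for \<open>x\<close> in the interval
  itself.\<close>

lemma periodization_identity:
  fixes b :: "real \<Rightarrow> ennreal"
  assumes b: "\<And>t. t \<notin> {-1..<1} \<Longrightarrow> b t = 0"
  shows "(\<Sum>n. b (x - 2 * real (Suc n)) + b (x + 2 * real (Suc n)))
    = (if x \<in> {-1..<1} then 0 else b (period_red x))"
proof -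
  define k where "k = \<lfloor>(x + 1) / 2\<rfloor>"
  have kb: "of_int k \<le> (x + 1) / 2" "(x + 1) / 2 < of_int k + 1" unfolding k_def by linarith+
  have out: "b (x - 2 * of_int j) = 0" if "j \<noteq> k" for j :: int
  proof (rule b, rule notI)
    assume "x - 2 * of_int j \<in> {-1..<1}"
    then have "of_int j \<le> (x + 1) / 2" "(x + 1) / 2 < of_int j + 1" by (auto simp: field_simps)
    then have "j = k" unfolding k_def by linarith
    then show False using that by simp
  qed
  have p: "b (x - 2 * real (Suc n)) = (if k = int (Suc n) then b (period_red x) else 0)" for n
    using out[of "int (Suc n)"] by (auto simp: period_red_def k_def)
  have q: "b (x + 2 * real (Suc n)) = (if k = - int (Suc n) then b (period_red x) else 0)" for n
  proof -
    have "x + 2 * real (Suc n) = x - 2 * of_int (- int (Suc n))" by simp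
    then show ?thesis using out[of "- int (Suc n)"] by (metis k_def period_red_def)
  qed
  have inI: "x \<in> {-1..<1} \<longleftrightarrow> k = 0"
    unfolding k_def by (auto simp: floor_eq_iff)
  consider "k = 0" | n where "k = int (Suc n)" | n where "k = - int (Suc n)"
  proof (cases "k = 0")
    case False
    then have "k = int (Suc (nat k - 1)) \<or> k = - int (Suc (nat (- k) - 1))" by linarith
    then show ?thesis using that(2,3) by blast
  qed (rule that(1))
  then show ?thesis
  proof cases
    case 1
    then show ?thesis unfolding p q inI by simp
  next
    case (2 n)
    have "(\<Sum>i. (if k = int (Suc i) then b (period_red x) else 0) + (if k = - int (Suc i) then b (period_red x) else 0))
      = (\<Sum>i\<in>{n}. (if k = int (Suc i) then b (period_red x) else 0) + (if k = - int (Suc i) then b (period_red x) else 0))"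
      using 2 by (intro suminf_finite) auto
    then show ?thesis unfolding p q inI using 2 by simp
  next
    case (3 n)
    have "(\<Sum>i. (if k = int (Suc i) then b (period_red x) else 0) + (if k = - int (Suc i) then b (period_red x) else 0))
      = (\<Sum>i\<in>{n}. (if k = int (Suc i) then b (period_red x) else 0) + (if k = - int (Suc i) then b (period_red x) else 0))"
      using 3 by (intro suminf_finite) auto
    then show ?thesis unfolding p q inI using 3 by simp
  qed
qed

lemma nn_integral_translate:
  fixes f :: "real \<Rightarrow> ennreal"
  assumes "f \<in> borel_measurable borel"
  shows "(\<integral>\<^sup>+x. f (x + a) \<partial>lborel) = (\<integral>\<^sup>+x. f x \<partial>lborel)"
  using nn_integral_real_affine[OF assms, of 1 a] by (simp add: add.commute)

text \<open>The inversion moves the Jacobian onto \<open>h\<close>,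
  \<open>periodization_identity\<close> unfolds the periodic function into translates of
  \<open>b\<close>, and translating each term back puts the sum on the side of \<open>h\<close>. All
  terms are nonnegative, so sums and integrals may be exchanged.\<close>

lemma gauss_transfer_dual:
  assumes c: "0 < c" "c \<le> 1" and h[measurable]: "h \<in> borel_measurable borel"
    and bm[measurable]: "b \<in> borel_measurable borel" and b: "\<And>t. t \<notin> {-1..<1} \<Longrightarrow> b t = (0::ennreal)"
  shows "(\<integral>\<^sup>+s. h s * gauss_koopman c b s \<partial>lborel) = (\<integral>\<^sup>+t. gauss_transfer c h t * b t \<partial>lborel)"
proof -
  let ?v = "gauss_transfer_summand c h"
  have inv: "- (c / - (c / x)) = x" for x using c by simp
  have "(\<integral>\<^sup>+s. h s * gauss_koopman c b s \<partial>lborel)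
     = (\<integral>\<^sup>+x. ennreal (c / x\<^sup>2) * (h (- (c / x)) * gauss_koopman c b (- (c / x))) \<partial>lborel)"
    using c(1) by (intro nn_integral_inversion[symmetric]) measurable
  also have "\<dots> = (\<integral>\<^sup>+x. (\<Sum>n. ?v x * b (x - 2 * real (Suc n)) + ?v x * b (x + 2 * real (Suc n))) \<partial>lborel)"
  proof (rule nn_integral_cong)
    fix x :: real
    have "gauss_koopman c b (- (c / x)) = (\<Sum>n. b (x - 2 * real (Suc n)) + b (x + 2 * real (Suc n)))"
      unfolding gauss_koopman_def inv by (rule periodization_identity[symmetric]) (rule b)
    then show "ennreal (c / x\<^sup>2) * (h (- (c / x)) * gauss_koopman c b (- (c / x)))
      = (\<Sum>n. ?v x * b (x - 2 * real (Suc n)) + ?v x * b (x + 2 * real (Suc n)))"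
      by (simp add: gauss_transfer_summand_def mult.assoc distrib_left[symmetric] del: of_nat_Suc)
  qed
  also have "\<dots> = (\<Sum>n. (\<integral>\<^sup>+x. ?v x * b (x - 2 * real (Suc n)) \<partial>lborel) + (\<integral>\<^sup>+x. ?v x * b (x + 2 * real (Suc n)) \<partial>lborel))"
    by (subst nn_integral_suminf) (auto simp: nn_integral_add)
  also have "\<dots> = (\<Sum>n. (\<integral>\<^sup>+x. ?v (x + 2 * real (Suc n)) * b x \<partial>lborel) + (\<integral>\<^sup>+x. ?v (x - 2 * real (Suc n)) * b x \<partial>lborel))"
  proof -
    have 1: "(\<integral>\<^sup>+x. ?v x * b (x - a) \<partial>lborel) = (\<integral>\<^sup>+x. ?v (x + a) * b x \<partial>lborel)" for a
      using nn_integral_translate[of "\<lambda>x. ?v x * b (x - a)" a] by simp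
    have 2: "(\<integral>\<^sup>+x. ?v x * b (x + a) \<partial>lborel) = (\<integral>\<^sup>+x. ?v (x - a) * b x \<partial>lborel)" for a
      using 1[of "- a"] by simp
    show ?thesis unfolding 1 2 ..
  qed
  also have "\<dots> = (\<integral>\<^sup>+x. (\<Sum>n. ?v (x + 2 * real (Suc n)) * b x + ?v (x - 2 * real (Suc n)) * b x) \<partial>lborel)"
    by (subst nn_integral_suminf) (auto simp: nn_integral_add)
  also have "\<dots> = (\<integral>\<^sup>+t. gauss_transfer c h t * b t \<partial>lborel)"
    by (intro nn_integral_cong) (simp add: gauss_transfer_def distrib_right[symmetric] del: of_nat_Suc)
  finally show ?thesis .
qed

lemma gauss_koopman_funpow_props:
  assumes "0 < c" "c \<le> 1" and bm: "b \<in> borel_measurable borel" and b: "\<And>t. t \<notin> {-1..<1} \<Longrightarrow> b t = (0::'a::{zero, topological_space})"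
  shows "(gauss_koopman c ^^ n) b \<in> borel_measurable borel"
    "t \<notin> {-1..<1} \<Longrightarrow> (gauss_koopman c ^^ n) b t = 0"
proof -
  show "(gauss_koopman c ^^ n) b \<in> borel_measurable borel"
    by (induction n) (auto intro: bm gauss_koopman_measurable)
  show "t \<notin> {-1..<1} \<Longrightarrow> (gauss_koopman c ^^ n) b t = 0"
    by (cases n) (use b gauss_koopman_outside[OF assms(1,2)] in auto)
qed

lemma gauss_transfer_funpow_measurable [measurable]:
  "h \<in> borel_measurable borel \<Longrightarrow> (gauss_transfer c ^^ n) h \<in> borel_measurable borel"
  by (induction n) auto

lemma gauss_transfer_funpow_dual:
  assumes c: "0 < c" "c \<le> 1" and h[measurable]: "h \<in> borel_measurable borel"
    and bm[measurable]: "b \<in> borel_measurable borel" and b: "\<And>t. t \<notin> {-1..<1} \<Longrightarrow> b t = (0::ennreal)"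
  shows "(\<integral>\<^sup>+s. h s * (gauss_koopman c ^^ n) b s \<partial>lborel) = (\<integral>\<^sup>+t. (gauss_transfer c ^^ n) h t * b t \<partial>lborel)"
  using h
proof (induction n arbitrary: h)
  case (Suc n)
  note [measurable] = Suc.prems
  have "(\<integral>\<^sup>+s. h s * (gauss_koopman c ^^ Suc n) b s \<partial>lborel)
    = (\<integral>\<^sup>+s. h s * gauss_koopman c ((gauss_koopman c ^^ n) b) s \<partial>lborel)" by simp
  also have "\<dots> = (\<integral>\<^sup>+t. gauss_transfer c h t * (gauss_koopman c ^^ n) b t \<partial>lborel)"
    using gauss_koopman_funpow_props[OF c bm b] by (intro gauss_transfer_dual c) auto
  also have "\<dots> = (\<integral>\<^sup>+t. (gauss_transfer c ^^ n) (gauss_transfer c h) t * b t \<partial>lborel)"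
    by (rule Suc.IH) simp
  finally show ?case by (simp add: funpow_swap1)
qed simp

section \<open>A Harnack inequality preserved by the transfer operator\<close>

definition harnack_const :: "real \<Rightarrow> real \<Rightarrow> real" where
  "harnack_const s t = 1 / (max ((1 + s) / (1 + t)) ((1 - s) / (1 - t)))\<^sup>2"

text \<open>The class of Harnack functions contains all \<open>(t + p)\<^sup>-\<^sup>2\<close> with \<open>\<bar>p\<bar> \<ge> 1\<close>, and all iterates of the
  transfer operator on the constant function 1 are combinations of these.\<close>

definition harnack :: "(real \<Rightarrow> ennreal) \<Rightarrow> bool" where
  "harnack h \<longleftrightarrow> (\<forall>s t. -1 < s \<and> s < 1 \<and> -1 < t \<and> t < 1 \<longrightarrow> ennreal (harnack_const s t) * h t \<le> h s)"

lemma harnackD: "harnack h \<Longrightarrow> -1 < s \<Longrightarrow> s < 1 \<Longrightarrow> -1 < t \<Longrightarrow> t < 1 \<Longrightarrow> ennreal (harnack_const s t) * h t \<le> h s"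
  by (simp add: harnack_def)

lemma harnack_max_pos:
  fixes s t :: real
  assumes "-1 < s" "s < 1" "-1 < t" "t < 1"
  shows "0 < max ((1 + s) / (1 + t)) ((1 - s) / (1 - t))"
  using assms by (simp add: less_max_iff_disj)

lemma harnack_const_pos:
  assumes "-1 < s" "s < 1" "-1 < t" "t < 1"
  shows "0 < harnack_const s t"
  using harnack_max_pos[OF assms] by (simp add: harnack_const_def)

text \<open>The ratio of \<open>s + p\<close> to \<open>t + p\<close> is monotone in
  \<open>p\<close> and tends to 1. For \<open>s \<ge> t\<close> its largest value on
  \<open>p \<ge> 1\<close> is therefore the one at \<open>p = 1\<close>; for \<open>s < t\<close> it
  stays below 1, while the maximum on the right is at least 1.\<close>

lemma harnack_ratio_pos:
  fixes s t p :: real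
  assumes "-1 < s" "s < 1" "-1 < t" "t < 1" and p: "p \<ge> 1"
  shows "s + p \<le> max ((1 + s) / (1 + t)) ((1 - s) / (1 - t)) * (t + p)"
proof (cases "s \<ge> t")
  case True
  have "(s + p) * (1 + t) \<le> (1 + s) * (t + p)"
  proof -
    have "(1 + s) * (t + p) - (s + p) * (1 + t) = (s - t) * (p - 1)" by (simp add: algebra_simps)
    also have "\<dots> \<ge> 0" using True p by simp
    finally show ?thesis by simp
  qed
  then have "s + p \<le> (1 + s) / (1 + t) * (t + p)" using assms by (simp add: field_simps)
  also have "\<dots> \<le> max ((1 + s) / (1 + t)) ((1 - s) / (1 - t)) * (t + p)"
    using assms by (intro mult_right_mono) auto
  finally show ?thesis .
next
  case False
  have "1 * (t + p) \<le> max ((1 + s) / (1 + t)) ((1 - s) / (1 - t)) * (t + p)"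
    using False assms by (intro mult_right_mono) (auto simp: le_max_iff_disj field_simps)
  moreover have "s + p \<le> 1 * (t + p)" using False by simp
  ultimately show ?thesis by (rule order_trans[rotated])
qed

lemma harnack_ratio:
  fixes s t p :: real
  assumes st: "-1 < s" "s < 1" "-1 < t" "t < 1" and p: "\<bar>p\<bar> \<ge> 1"
  shows "\<bar>s + p\<bar> \<le> max ((1 + s) / (1 + t)) ((1 - s) / (1 - t)) * \<bar>t + p\<bar>"
proof (cases "p \<ge> 1")
  case True
  then show ?thesis using harnack_ratio_pos[OF st True] st by simp
next
  case False
  then have "- p \<ge> 1" using p by linarith
  from harnack_ratio_pos[OF _ _ _ _ this, of "- s" "- t"] st
  have "- s + - p \<le> max ((1 + s) / (1 + t)) ((1 - s) / (1 - t)) * (- t + - p)"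
    by (simp add: max.commute)
  moreover have "\<bar>s + p\<bar> = - s + - p" "\<bar>t + p\<bar> = - t + - p" using \<open>- p \<ge> 1\<close> st by linarith+
  ultimately show ?thesis by simp
qed

text \<open>The constant does not deteriorate under iteration: the loss from comparing
  \<open>h\<close> at the preimages \<open>s'\<close> and \<open>t'\<close> combines with the ratio
  of the Jacobians, and the combination is again controlled by the constant for \<open>s\<close> and
  \<open>t\<close>. In terms of square roots this is the inequality \<open>key\<close>.\<close>

lemma harnack_summand:
  assumes c: "0 < c" "c \<le> 1" and h: "harnack h" and st: "-1 < s" "s < 1" "-1 < t" "t < 1"
    and a: "\<bar>a\<bar> \<ge> 2"
  shows "ennreal (harnack_const s t) * gauss_transfer_summand c h (t + a) \<le> gauss_transfer_summand c h (s + a)"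
proof -
  define m where "m = max ((1 + s) / (1 + t)) ((1 - s) / (1 - t))"
  have m: "m > 0" using harnack_max_pos[OF st] by (simp add: m_def)
  define s' where "s' = - (c / (s + a))"
  define t' where "t' = - (c / (t + a))"
  have sa: "\<bar>s + a\<bar> > 1" and ta: "\<bar>t + a\<bar> > 1" using st a by linarith+
  have unit: "-1 < - (c / x) \<and> - (c / x) < 1" if "\<bar>x\<bar> > 1" for x
  proof -
    have "\<bar>c / x\<bar> < 1" using that c by (simp add: field_simps)
    then show ?thesis by linarith
  qed
  have s': "-1 < s'" "s' < 1" and t': "-1 < t'" "t' < 1"
    using unit[OF sa] unit[OF ta] by (auto simp: s'_def t'_def)
  define m' where "m' = max ((1 + s') / (1 + t')) ((1 - s') / (1 - t'))"
  have m': "m' > 0" using harnack_max_pos[OF s' t'] by (simp add: m'_def)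
  have key: "m' * \<bar>s + a\<bar> \<le> m * \<bar>t + a\<bar>"
  proof -
    have 1: "(1 + s') / (1 + t') * \<bar>s + a\<bar> \<le> m * \<bar>t + a\<bar>"
    proof -
      \<comment> \<open>Clearing the denominator in \<open>s'\<close> turns \<open>1 + s'\<close>
        into a translation by \<open>a - c\<close>. Because \<open>\<bar>a\<bar> \<ge> 2\<close> and
        \<open>c \<le> 1\<close>, this shift has modulus at least 1, which is what
        \<open>harnack_ratio\<close> asks for; the other end point gives
        \<open>a + c\<close>.\<close>
      have e: "(1 + s') * \<bar>s + a\<bar> = \<bar>s + (a - c)\<bar>" "(1 + t') * \<bar>t + a\<bar> = \<bar>t + (a - c)\<bar>"
      proof -
        have "(1 - c / x) * \<bar>x\<bar> = \<bar>x - c\<bar>" if "\<bar>x\<bar> > 1" for x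
          using that c by (cases "x > 0") (auto simp: field_simps)
        from this[OF sa] this[OF ta] show "(1 + s') * \<bar>s + a\<bar> = \<bar>s + (a - c)\<bar>" "(1 + t') * \<bar>t + a\<bar> = \<bar>t + (a - c)\<bar>"
          by (simp_all add: s'_def t'_def add_diff_eq)
      qed
      have "\<bar>s + (a - c)\<bar> \<le> m * \<bar>t + (a - c)\<bar>"
        unfolding m_def using a c by (intro harnack_ratio st) linarith
      then have "(1 + s') * \<bar>s + a\<bar> \<le> (m * \<bar>t + a\<bar>) * (1 + t')"
        unfolding e[symmetric] by (simp add: mult_ac)
      then show ?thesis using t' by (simp add: pos_divide_le_eq)
    qed
    have 2: "(1 - s') / (1 - t') * \<bar>s + a\<bar> \<le> m * \<bar>t + a\<bar>"
    proof -
      have e: "(1 - s') * \<bar>s + a\<bar> = \<bar>s + (a + c)\<bar>" "(1 - t') * \<bar>t + a\<bar> = \<bar>t + (a + c)\<bar>"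
      proof -
        have "(1 + c / x) * \<bar>x\<bar> = \<bar>x + c\<bar>" if "\<bar>x\<bar> > 1" for x
          using that c by (cases "x > 0") (auto simp: field_simps)
        from this[OF sa] this[OF ta] show "(1 - s') * \<bar>s + a\<bar> = \<bar>s + (a + c)\<bar>" "(1 - t') * \<bar>t + a\<bar> = \<bar>t + (a + c)\<bar>"
          by (simp_all add: s'_def t'_def add.assoc)
      qed
      have "\<bar>s + (a + c)\<bar> \<le> m * \<bar>t + (a + c)\<bar>"
        unfolding m_def using a c by (intro harnack_ratio st) linarith
      then have "(1 - s') * \<bar>s + a\<bar> \<le> (m * \<bar>t + a\<bar>) * (1 - t')"
        unfolding e[symmetric] by (simp add: mult_ac)
      then show ?thesis using t' by (simp add: pos_divide_le_eq)
    qed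
    show ?thesis unfolding m'_def using 1 2 by (simp add: max_def)
  qed
  have "(m' * \<bar>s + a\<bar>)\<^sup>2 \<le> (m * \<bar>t + a\<bar>)\<^sup>2"
    using key m' by (intro power_mono) auto
  then have "1 / m\<^sup>2 * (c / (t + a)\<^sup>2) \<le> c / (s + a)\<^sup>2 * (1 / m'\<^sup>2)"
    using m m' sa ta c by (simp add: field_simps power_mult_distrib)
  then have "ennreal (1 / m\<^sup>2 * (c / (t + a)\<^sup>2)) * h t' \<le> ennreal (c / (s + a)\<^sup>2 * (1 / m'\<^sup>2)) * h t'"
    by (intro mult_right_mono ennreal_leI) auto
  also have "\<dots> = ennreal (c / (s + a)\<^sup>2) * (ennreal (1 / m'\<^sup>2) * h t')"
    using c by (subst ennreal_mult) (auto simp: mult.assoc)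
  also have "\<dots> \<le> ennreal (c / (s + a)\<^sup>2) * h s'"
    using harnackD[OF h s' t'] by (intro mult_left_mono) (auto simp: harnack_const_def m'_def)
  finally have "ennreal (1 / m\<^sup>2 * (c / (t + a)\<^sup>2)) * h t' \<le> ennreal (c / (s + a)\<^sup>2) * h s'" .
  moreover have "ennreal (1 / m\<^sup>2 * (c / (t + a)\<^sup>2)) = ennreal (1 / m\<^sup>2) * ennreal (c / (t + a)\<^sup>2)"
    using c by (intro ennreal_mult) auto
  ultimately show ?thesis
    by (simp only: gauss_transfer_summand_def harnack_const_def m_def s'_def t'_def mult.assoc)
qed

lemma harnack_gauss_transfer:
  assumes c: "0 < c" "c \<le> 1" and h: "harnack h"
  shows "harnack (gauss_transfer c h)"
  unfolding harnack_def
proof (intro allI impI)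
  fix s t :: real assume "-1 < s \<and> s < 1 \<and> -1 < t \<and> t < 1"
  then have st: "-1 < s" "s < 1" "-1 < t" "t < 1" by auto
  have "ennreal (harnack_const s t) * gauss_transfer c h t
    = (\<Sum>n. ennreal (harnack_const s t) * gauss_transfer_summand c h (t + 2 * real (Suc n))
       + ennreal (harnack_const s t) * gauss_transfer_summand c h (t - 2 * real (Suc n)))"
    by (simp add: gauss_transfer_def distrib_left[symmetric] del: of_nat_Suc)
  also have "\<dots> \<le> gauss_transfer c h s"
    unfolding gauss_transfer_def
  proof (intro suminf_le allI add_mono summableI)
    fix n
    show "ennreal (harnack_const s t) * gauss_transfer_summand c h (t + 2 * real (Suc n)) \<le> gauss_transfer_summand c h (s + 2 * real (Suc n))"
      by (intro harnack_summand[OF c h st]) simp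
    show "ennreal (harnack_const s t) * gauss_transfer_summand c h (t - 2 * real (Suc n)) \<le> gauss_transfer_summand c h (s - 2 * real (Suc n))"
      using harnack_summand[OF c h st, of "- (2 * real (Suc n))"] by (simp only: diff_conv_add_uminus abs_minus_cancel) simp
  qed
  finally show "ennreal (harnack_const s t) * gauss_transfer c h t \<le> gauss_transfer c h s" .
qed

lemma harnack_one: "harnack (\<lambda>_. 1)"
  unfolding harnack_def
proof (intro allI impI)
  fix s t :: real assume st: "-1 < s \<and> s < 1 \<and> -1 < t \<and> t < 1"
  define m where "m = max ((1 + s) / (1 + t)) ((1 - s) / (1 - t))"
  have "m \<ge> 1" using st by (cases "s \<ge> t") (auto simp: m_def le_max_iff_disj field_simps)
  then have "m\<^sup>2 \<ge> 1" by (rule one_le_power)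
  then have "harnack_const s t \<le> 1" unfolding harnack_const_def m_def[symmetric] by (simp add: divide_le_eq)
  then show "ennreal (harnack_const s t) * 1 \<le> 1" by (simp add: ennreal_le_1)
qed

section \<open>Iterates of the constant density and loss of mass\<close>

definition gauss_iterate :: "real \<Rightarrow> nat \<Rightarrow> real \<Rightarrow> ennreal" where
  "gauss_iterate c n = (gauss_transfer c ^^ n) (\<lambda>_. 1)"

lemma gauss_iterate_0: "gauss_iterate c 0 = (\<lambda>_. 1)"
  by (simp add: gauss_iterate_def)

lemma gauss_iterate_Suc: "gauss_iterate c (Suc n) = gauss_transfer c (gauss_iterate c n)"
  by (simp add: gauss_iterate_def)

lemma gauss_iterate_measurable [measurable]: "gauss_iterate c n \<in> borel_measurable borel"
  unfolding gauss_iterate_def by measurable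

lemma harnack_gauss_iterate: "0 < c \<Longrightarrow> c \<le> 1 \<Longrightarrow> harnack (gauss_iterate c n)"
  by (induction n) (simp_all add: gauss_iterate_0 gauss_iterate_Suc harnack_one harnack_gauss_transfer)

lemma gauss_transfer_even:
  assumes "\<And>t. h (- t) = h t"
  shows "gauss_transfer c h (- t) = gauss_transfer c h t"
proof -
  have v: "gauss_transfer_summand c h (- x) = gauss_transfer_summand c h x" for x
    using assms[of "c / x"] assms[of "- (c / x)"] by (simp add: gauss_transfer_summand_def)
  have "gauss_transfer_summand c h (- t + a) = gauss_transfer_summand c h (t - a)"
     "gauss_transfer_summand c h (- t - a) = gauss_transfer_summand c h (t + a)" for a
    using v[of "t - a"] v[of "t + a"] by simp_all
  then show ?thesis by (simp add: gauss_transfer_def add.commute del: of_nat_Suc)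
qed

lemma gauss_iterate_even: "gauss_iterate c n (- t) = gauss_iterate c n t"
proof (induction n arbitrary: t)
  case (Suc n)
  then show ?case unfolding gauss_iterate_Suc by (rule gauss_transfer_even)
qed (simp add: gauss_iterate_0)

lemma gauss_iterate_mass_step:
  assumes c: "0 < c" "c \<le> 1"
  shows "(\<integral>\<^sup>+t. gauss_iterate c (Suc n) t * indicator {-1..<1} t \<partial>lborel)
    = (\<integral>\<^sup>+t. gauss_iterate c n t * gauss_koopman c (indicator {-1..<1}) t \<partial>lborel)"
  unfolding gauss_iterate_Suc by (rule gauss_transfer_dual[OF c, symmetric]) (auto split: split_indicator)

lemma gauss_koopman_indicator_le:
  assumes c: "0 < c" "c \<le> 1"
  shows "gauss_koopman c (indicator {-1..<1}) t \<le> (indicator {-1..<1} t :: ennreal)"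
  using gauss_koopman_outside[OF c, of t "indicator {-1..<1} :: real \<Rightarrow> ennreal"]
  by (cases "t \<in> {-1..<1}") (auto simp: gauss_koopman_def indicator_def)

lemma gauss_iterate_mass:
  assumes c: "0 < c" "c \<le> 1"
  shows "(\<integral>\<^sup>+t. gauss_iterate c n t * indicator {-1..<1} t \<partial>lborel) \<le> 2"
proof (induction n)
  case (Suc n)
  have "(\<integral>\<^sup>+t. gauss_iterate c (Suc n) t * indicator {-1..<1} t \<partial>lborel)
    \<le> (\<integral>\<^sup>+t. gauss_iterate c n t * indicator {-1..<1} t \<partial>lborel)"
    unfolding gauss_iterate_mass_step[OF c]
    by (intro nn_integral_mono mult_left_mono gauss_koopman_indicator_le c) auto
  then show ?case using Suc by (rule order_trans)
qed (simp add: gauss_iterate_0)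

text \<open>With the centre as one of the two points the constant is explicit. The value at 0 bounds
  \<open>h\<close> from above on compact subintervals and, up to the factor 1/4, from below on the
  whole interval.\<close>

lemma harnack_at_zero:
  assumes h: "harnack h" and t: "-1 < t" "t < 1"
  shows "ennreal ((1 - \<bar>t\<bar>)\<^sup>2) * h t \<le> h 0" and "ennreal (1/4) * h 0 \<le> h t"
proof -
  have "max (1 / (1 + t)) (1 / (1 - t)) = 1 / (1 - \<bar>t\<bar>)"
    using t by (cases "t \<ge> 0") (auto simp: max_def field_simps)
  then have "harnack_const 0 t = (1 - \<bar>t\<bar>)\<^sup>2"
    using t by (simp add: harnack_const_def power_divide)
  then show "ennreal ((1 - \<bar>t\<bar>)\<^sup>2) * h t \<le> h 0" using harnackD[OF h _ _ t, of 0] by simp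
  have m: "max (1 + t) (1 - t) = 1 + \<bar>t\<bar>" by (simp add: max_def)
  have "(1 + \<bar>t\<bar>)\<^sup>2 \<le> 2\<^sup>2" using t by (intro power_mono) auto
  then have "1 / 4 \<le> harnack_const t 0" using t by (simp add: harnack_const_def m field_simps add_pos_nonneg)
  then have "ennreal (1/4) * h 0 \<le> ennreal (harnack_const t 0) * h 0"
    by (intro mult_right_mono ennreal_leI) auto
  also have "\<dots> \<le> h t" using harnackD[OF h t, of 0] by simp
  finally show "ennreal (1/4) * h 0 \<le> h t" .
qed

text \<open>Points of \<open>(c, 1)\<close> are killed in one step. If the iterates stayed above
  \<open>\<epsilon>\<close> at 0, they would stay above \<open>\<epsilon> / 4\<close> on the whole
  interval, and every step would lose at least the mass \<open>d = \<epsilon> / 4 * (1 - c)\<close>;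
  the total mass is only 2.\<close>

lemma gauss_iterate_small_subcritical:
  assumes c: "0 < c" "c < 1" and e: "\<epsilon> > 0"
  shows "\<exists>n. gauss_iterate c n 0 < ennreal \<epsilon>"
proof (rule ccontr)
  assume "\<not> ?thesis"
  then have big: "ennreal \<epsilon> \<le> gauss_iterate c n 0" for n by (simp add: not_less)
  have c': "c \<le> 1" using c by simp
  define a where "a n = (\<integral>\<^sup>+t. gauss_iterate c n t * indicator {-1..<1} t \<partial>lborel)" for n
  define d where "d = \<epsilon> / 4 * (1 - c)"
  have d: "d > 0" using e c by (simp add: d_def)
  have step: "a (Suc n) + ennreal d \<le> a n" for n
  proof -
    have "ennreal d = (\<integral>\<^sup>+t. ennreal (\<epsilon> / 4) * indicator {c<..<1} t \<partial>lborel)"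
      using c e by (simp add: nn_integral_cmult_indicator d_def ennreal_mult[symmetric])
    also have "\<dots> \<le> (\<integral>\<^sup>+t. gauss_iterate c n t * indicator {c<..<1} t \<partial>lborel)"
    proof (rule nn_integral_mono)
      fix t
      have "ennreal (\<epsilon> / 4) \<le> gauss_iterate c n t" if t: "t \<in> {c<..<1}"
      proof -
        have "ennreal (\<epsilon> / 4) = ennreal (1 / 4) * ennreal \<epsilon>" using e by (simp add: ennreal_mult[symmetric])
        also have "\<dots> \<le> ennreal (1 / 4) * gauss_iterate c n 0" by (intro mult_left_mono big) auto
        also have "\<dots> \<le> gauss_iterate c n t"
          using t c by (intro harnack_at_zero(2) harnack_gauss_iterate) auto
        finally show ?thesis .
      qed
      then show "ennreal (\<epsilon> / 4) * indicator {c<..<1} t \<le> gauss_iterate c n t * indicator {c<..<1} t"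
        by (auto split: split_indicator)
    qed
    finally have "a (Suc n) + ennreal d \<le> a (Suc n) + (\<integral>\<^sup>+t. gauss_iterate c n t * indicator {c<..<1} t \<partial>lborel)"
      by (intro add_left_mono)
    also have "\<dots> = (\<integral>\<^sup>+t. gauss_iterate c n t * gauss_koopman c (indicator {-1..<1}) t + gauss_iterate c n t * indicator {c<..<1} t \<partial>lborel)"
      unfolding a_def gauss_iterate_mass_step[OF c(1) c']
      by (intro nn_integral_add[symmetric]) measurable
    also have "\<dots> \<le> a n"
      unfolding a_def
    proof (intro nn_integral_mono)
      fix t
      have "gauss_koopman c (indicator {-1..<1}) t + indicator {c<..<1} t \<le> (indicator {-1..<1} t :: ennreal)"
      proof (cases "t \<in> {c<..<1}")
        case True
        then have "0 < c / t" "c / t \<le> 1" using c by (auto simp: field_simps)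
        then have "gauss_koopman c (indicator {-1..<1}) t = (0 :: ennreal)" by (simp add: gauss_koopman_def)
        then show ?thesis using True c by (simp add: indicator_def)
      next
        case False
        then show ?thesis using gauss_koopman_indicator_le[OF c(1) c', of t] by simp
      qed
      then have "gauss_iterate c n t * (gauss_koopman c (indicator {-1..<1}) t + indicator {c<..<1} t) \<le> gauss_iterate c n t * indicator {-1..<1} t"
        by (rule mult_left_mono) simp
      then show "gauss_iterate c n t * gauss_koopman c (indicator {-1..<1}) t + gauss_iterate c n t * indicator {c<..<1} t
         \<le> gauss_iterate c n t * indicator {-1..<1} t" by (simp add: distrib_left)
    qed
    finally show ?thesis .
  qed
  have bound: "a n + ennreal (real n * d) \<le> 2" for n
  proof (induction n)
    case 0
    then show ?case using gauss_iterate_mass[OF c(1) c', of 0] by (simp add: a_def)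
  next
    case (Suc n)
    have "a (Suc n) + ennreal (real (Suc n) * d) = (a (Suc n) + ennreal d) + ennreal (real n * d)"
      using d by (simp add: algebra_simps ennreal_plus[symmetric] del: ennreal_plus)
    also have "\<dots> \<le> a n + ennreal (real n * d)" by (intro add_right_mono step)
    finally show ?case using Suc by (rule order_trans)
  qed
  obtain n :: nat where n: "real n * d > 2" using d reals_Archimedean3 by blast
  have "ennreal (real n * d) \<le> a n + ennreal (real n * d)" by simp
  also have "\<dots> \<le> 2" by (rule bound)
  finally have "ennreal (real n * d) \<le> ennreal 2" by simp
  then show False using n by (subst (asm) ennreal_le_iff) auto
qed

section \<open>The critical parameter: invariant density and maximum principle\<close>

lemma gauss_transfer_mono: "(\<And>x. h x \<le> k x) \<Longrightarrow> gauss_transfer c h t \<le> gauss_transfer c k t"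
  unfolding gauss_transfer_def gauss_transfer_summand_def
  by (intro suminf_le allI add_mono mult_left_mono summableI) auto

lemma gauss_transfer_SUP:
  assumes inc: "incseq g"
  shows "gauss_transfer c (\<lambda>x. SUP n. g n x) t = (SUP n. gauss_transfer c (g n) t)"
proof -
  have v: "gauss_transfer_summand c (\<lambda>x. SUP n. g n x) x = (SUP n. gauss_transfer_summand c (g n) x)" for x
    by (simp add: gauss_transfer_summand_def SUP_mult_left_ennreal)
  have incv: "incseq (\<lambda>n. gauss_transfer_summand c (g n) x)" for x
    using inc by (auto simp: gauss_transfer_summand_def incseq_def le_fun_def intro: mult_left_mono)
  have "incseq (\<lambda>n. gauss_transfer_summand c (g n) x + gauss_transfer_summand c (g n) y)" for x y
    using incv[of x] incv[of y] by (auto simp: incseq_def intro: add_mono)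
  then show ?thesis
    unfolding gauss_transfer_def v ennreal_SUP_add[OF incv incv, symmetric]
    by (rule ennreal_suminf_SUP_eq)
qed

definition hyp_density :: "real \<Rightarrow> ennreal" where
  "hyp_density t = ennreal (1 / (1 - t\<^sup>2))"

text \<open>The density of the hyperbolic length of \<open>(-1, 1)\<close> is invariant; the series telescopes.\<close>

lemma gauss_transfer_hyp_density:
  assumes t: "-1 < t" "t < 1"
  shows "gauss_transfer 1 hyp_density t = hyp_density t"
proof -
  \<comment> \<open>The two halves come from splitting \<open>1 / (x\<^sup>2 - 1)\<close> into
    \<open>1 / (2 * (x - 1))\<close> minus \<open>1 / (2 * (x + 1))\<close>, with
    \<open>x = t + 2 * (n + 1)\<close> for \<open>p\<close> and \<open>x = 2 * (n + 1) - t\<close>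
    for \<open>q\<close>.\<close>
  define p where "p n = 1 / (2 * (t + 2 * real n + 1))" for n
  define q where "q n = 1 / (2 * (2 * real n + 1 - t))" for n
  have lim: "p \<longlonglongrightarrow> 0" "q \<longlonglongrightarrow> 0" unfolding p_def q_def by real_asymp+
  have "(\<lambda>n. (p n - p (Suc n)) + (q n - q (Suc n))) sums ((p 0 - 0) + (q 0 - 0))"
    by (intro sums_add telescope_sums' lim)
  moreover have "p 0 + q 0 = 1 / (1 - t\<^sup>2)"
  proof -
    have "1 - t\<^sup>2 = (1 + t) * (1 - t)" by (simp add: algebra_simps power2_eq_square)
    then show ?thesis using t by (simp add: p_def q_def divide_simps) (simp add: algebra_simps)
  qed
  ultimately have sums: "(\<lambda>n. (p n - p (Suc n)) + (q n - q (Suc n))) sums (1 / (1 - t\<^sup>2))" by simp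
  have summand: "gauss_transfer_summand 1 hyp_density x = ennreal (1 / (x\<^sup>2 - 1))" if "\<bar>x\<bar> > 1" for x
  proof -
    have x: "x\<^sup>2 > 1" using one_less_power[OF that, of 2] by simp
    have "1 / x\<^sup>2 * (1 / (1 - (- (1 / x))\<^sup>2)) = 1 / (x\<^sup>2 - 1)"
      using x that by (simp add: power_divide field_simps)
    moreover have "1 - (- (1 / x))\<^sup>2 > 0" using x by (simp add: power_divide divide_less_eq)
    ultimately show ?thesis
      unfolding gauss_transfer_summand_def hyp_density_def by (subst ennreal_mult[symmetric]) auto
  qed
  have P: "gauss_transfer_summand 1 hyp_density (t + 2 * real (Suc n)) = ennreal (p n - p (Suc n))"
    and Pn: "0 \<le> p n - p (Suc n)"
    and Q: "gauss_transfer_summand 1 hyp_density (t - 2 * real (Suc n)) = ennreal (q n - q (Suc n))"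
    and Qn: "0 \<le> q n - q (Suc n)" for n
  proof -
    define x where "x = t + 2 * real (Suc n)"
    have x: "x > 1" using t by (simp add: x_def)
    have "p n - p (Suc n) = 1 / (2 * (x - 1)) - 1 / (2 * (x + 1))"
      unfolding p_def x_def by (intro arg_cong2[where f="(-)"] arg_cong2[where f="(/)"] refl) simp_all
    also have "\<dots> = 1 / (x\<^sup>2 - 1)"
    proof -
      have "x\<^sup>2 - 1 = (x - 1) * (x + 1)" by (simp add: algebra_simps power2_eq_square)
      then show ?thesis using x by (simp add: divide_simps) (simp add: algebra_simps)
    qed
    finally have e: "p n - p (Suc n) = 1 / (x\<^sup>2 - 1)" .
    show "gauss_transfer_summand 1 hyp_density (t + 2 * real (Suc n)) = ennreal (p n - p (Suc n))"
      using summand[of x] x unfolding e by (simp add: x_def)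
    have "x\<^sup>2 > 1" using x by (simp add: one_less_power)
    then show "0 \<le> p n - p (Suc n)" unfolding e by simp
    define y where "y = 2 * real (Suc n) - t"
    have y: "y > 1" using t by (simp add: y_def)
    have "q n - q (Suc n) = 1 / (2 * (y - 1)) - 1 / (2 * (y + 1))"
      unfolding q_def y_def by (intro arg_cong2[where f="(-)"] arg_cong2[where f="(/)"] refl) simp_all
    also have "\<dots> = 1 / (y\<^sup>2 - 1)"
    proof -
      have "y\<^sup>2 - 1 = (y - 1) * (y + 1)" by (simp add: algebra_simps power2_eq_square)
      then show ?thesis using y by (simp add: divide_simps) (simp add: algebra_simps)
    qed
    finally have e: "q n - q (Suc n) = 1 / (y\<^sup>2 - 1)" .
    have "t - 2 * real (Suc n) = - y" by (simp add: y_def)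
    then show "gauss_transfer_summand 1 hyp_density (t - 2 * real (Suc n)) = ennreal (q n - q (Suc n))"
      using summand[of "- y"] y unfolding e by simp
    have "y\<^sup>2 > 1" using y by (simp add: one_less_power)
    then show "0 \<le> q n - q (Suc n)" unfolding e by simp
  qed
  have "gauss_transfer 1 hyp_density t = (\<Sum>n. ennreal ((p n - p (Suc n)) + (q n - q (Suc n))))"
    unfolding gauss_transfer_def P Q using Pn Qn by (simp only: ennreal_plus)
  also have "\<dots> = hyp_density t"
    unfolding hyp_density_def using Pn Qn by (intro suminf_ennreal_eq[OF _ sums] add_nonneg_nonneg)
  finally show ?thesis .
qed

text \<open>The Harnack constant is positive, so one infinite value would make \<open>h\<close>
  infinite on all of \<open>(-1, 1)\<close>.\<close>

lemma harnack_finite: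
  assumes h: "harnack h" and fin: "(\<integral>\<^sup>+t. h t * indicator {-1..<1} t \<partial>lborel) < \<infinity>"
    and t: "-1 < t" "t < 1"
  shows "h t < \<infinity>"
proof (rule ccontr)
  assume "\<not> h t < \<infinity>"
  then have top: "h t = top" by (simp add: less_top[symmetric])
  have "h s = top" if "-1 < s" "s < 1" for s
    using harnackD[OF h that t] harnack_const_pos[OF that t] top
    by (simp add: ennreal_mult_top top_unique)
  then have "(\<integral>\<^sup>+t. top * indicator {-1<..<1::real} t \<partial>lborel) \<le> (\<integral>\<^sup>+t. h t * indicator {-1..<1} t \<partial>lborel)"
    by (intro nn_integral_mono) (auto split: split_indicator)
  moreover have "(\<integral>\<^sup>+t. top * indicator {-1<..<1::real} t \<partial>lborel) = (top :: ennreal)"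
    by (subst nn_integral_cmult_indicator) (auto simp: ennreal_top_mult)
  ultimately show False using fin by (simp add: top_unique)
qed

text \<open>Using the inequality in both directions encloses \<open>h s\<close> between
  \<open>harnack_const s t * h t\<close> and \<open>h t / harnack_const t s\<close>, and both
  constants tend to 1 as \<open>s\<close> approaches \<open>t\<close>.\<close>

lemma harnack_continuous:
  assumes h: "harnack h" and fin: "\<And>t. -1 < t \<Longrightarrow> t < 1 \<Longrightarrow> h t < \<infinity>"
  shows "continuous_on {-1<..<1} (\<lambda>t. enn2real (h t))"
proof (rule continuous_at_imp_continuous_on, rule ballI)
  fix t :: real assume "t \<in> {-1<..<1}"
  then have t: "-1 < t" "t < 1" by auto
  define f where "f s = enn2real (h s)" for s
  have f: "h s = ennreal (f s)" if "-1 < s" "s < 1" for s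
    using fin[OF that] by (simp add: f_def)
  have f0: "0 \<le> f s" for s by (simp add: f_def)
  have bnd: "harnack_const s r * f r \<le> f s" if "-1 < s" "s < 1" "-1 < r" "r < 1" for s r
    using harnackD[OF h that] harnack_const_pos[OF that] f0
    by (simp add: f that ennreal_mult[symmetric] ennreal_le_iff)
  have "isCont f t" unfolding isCont_def
  proof (rule tendsto_sandwich)
    have c1: "isCont (\<lambda>s. harnack_const s t) t"
      using t unfolding harnack_const_def by (intro continuous_intros) (auto simp: max_def)
    have c2: "isCont (\<lambda>s. harnack_const t s) t"
      using t unfolding harnack_const_def by (intro continuous_intros) (auto simp: max_def)
    have k1: "harnack_const t t = 1" using t by (simp add: harnack_const_def)
    show "(\<lambda>s. harnack_const s t * f t) \<midarrow>t\<rightarrow> f t"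
      using tendsto_mult_right[OF c1[unfolded isCont_def k1], of "f t"] by simp
    show "(\<lambda>s. f t / harnack_const t s) \<midarrow>t\<rightarrow> f t"
      using tendsto_divide[OF tendsto_const c2[unfolded isCont_def k1], of "f t"] by simp
    have ev: "\<forall>\<^sub>F s in at t. s \<in> {-1<..<1}"
      using t by (intro eventually_at_in_open') auto
    show "\<forall>\<^sub>F s in at t. harnack_const s t * f t \<le> f s"
      using ev by eventually_elim (use bnd t in auto)
    show "\<forall>\<^sub>F s in at t. f s \<le> f t / harnack_const t s"
      using ev
    proof eventually_elim
      case (elim s)
      then show ?case using bnd[of t s] harnack_const_pos[of t s] t by (simp add: pos_le_divide_eq mult.commute)
    qed
  qed
  then show "isCont (\<lambda>t. enn2real (h t)) t" by (simp add: f_def[abs_def])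
qed

lemma AE_eq_continuous_imp_eq:
  fixes f g :: "real \<Rightarrow> real"
  assumes S: "open S" and f: "continuous_on S f" and g: "continuous_on S g"
    and ae: "AE t in lborel. t \<in> S \<longrightarrow> f t = g t" and t: "t \<in> S"
  shows "f t = g t"
proof (rule ccontr)
  assume "f t \<noteq> g t"
  define U where "U = {x \<in> S. f x - g x \<in> - {0}}"
  have "open U"
  proof -
    have "U = S \<inter> (\<lambda>x. f x - g x) -` (- {0})" by (auto simp: U_def)
    then show ?thesis
      using continuous_open_preimage[OF continuous_on_diff[OF f g] S, of "- {0}"] by (simp add: open_Compl)
  qed
  moreover have "U \<noteq> {}" using t \<open>f t \<noteq> g t\<close> by (auto simp: U_def)
  moreover have "U \<in> null_sets lborel"
  proof -
    have "AE x in lborel. x \<notin> U" using ae by eventually_elim (auto simp: U_def)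
    then show ?thesis using \<open>open U\<close> by (simp add: AE_iff_null_sets)
  qed
  ultimately show False
    using open_not_negligible[of U] by (auto simp: negligible_iff_null_sets null_sets_completionI)
qed

text \<open>Between \<open>t\<close> and the midpoint of -1 and \<open>t\<close>, Harnack gives
  \<open>h \<ge> h t / 4\<close>. This window has length \<open>(1 + t) / 2\<close>, so
  \<open>h t * (1 + t) / 8\<close> is at most the mass of \<open>h\<close> near -1. That mass is
  made smaller than \<open>\<epsilon> / 16\<close>, and the remaining factor \<open>1 - t\<close> is
  at most 2.\<close>

lemma harnack_boundary_decay:
  assumes h: "harnack h" and fin: "(\<integral>\<^sup>+t. h t * indicator {-1..<1} t \<partial>lborel) < \<infinity>"
    and [measurable]: "h \<in> borel_measurable borel" and e: "\<epsilon> > 0"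
  shows "\<exists>\<delta>>0. \<forall>t. -1 < t \<and> t < -1 + \<delta> \<longrightarrow> enn2real (h t) * (1 - t\<^sup>2) < \<epsilon>"
proof -
  define f where "f t = enn2real (h t) * indicator {-1<..<1} t" for t :: real
  have hf: "h s = ennreal (f s)" if "-1 < s" "s < 1" for s
    using harnack_finite[OF h fin that] that by (simp add: f_def)
  have f0: "0 \<le> f s" for s by (simp add: f_def)
  have [measurable]: "f \<in> borel_measurable borel" unfolding f_def by measurable
  have "(\<integral>\<^sup>+t. ennreal (norm (f t)) \<partial>lborel) \<le> (\<integral>\<^sup>+t. h t * indicator {-1..<1} t \<partial>lborel)"
    using hf f0 by (intro nn_integral_mono) (auto simp: f_def split: split_indicator)
  then have int: "integrable lborel f"
    using fin by (intro integrableI_bounded) auto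
  have "(\<lambda>n. \<integral>t. indicator {..-1 + 1 / real (Suc n)} t * f t \<partial>lborel) \<longlonglongrightarrow> (\<integral>t. 0 \<partial>(lborel :: real measure))"
  proof (rule integral_dominated_convergence[where w=f])
    show "AE t in lborel. (\<lambda>n. indicator {..-1 + 1 / real (Suc n)} t * f t) \<longlonglongrightarrow> 0"
    proof (rule AE_I2)
      fix t :: real
      show "(\<lambda>n. indicator {..-1 + 1 / real (Suc n)} t * f t) \<longlonglongrightarrow> 0"
      proof (cases "t > -1")
        case True
        have "(\<lambda>n. 1 / real (Suc n)) \<longlonglongrightarrow> 0" by (rule LIMSEQ_Suc[OF lim_const_over_n])
        then have "\<forall>\<^sub>F n in sequentially. 1 / real (Suc n) < t + 1" using True by (intro order_tendstoD) auto
        then have "\<forall>\<^sub>F n in sequentially. indicator {..-1 + 1 / real (Suc n)} t * f t = 0"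
          by eventually_elim (auto simp: indicator_def)
        then show ?thesis by (rule tendsto_eventually)
      qed (simp add: f_def)
    qed
    show "AE t in lborel. norm (indicator {..-1 + 1 / real (Suc n)} t * f t) \<le> f t" for n
      using f0 by (auto split: split_indicator)
  qed (use int in auto)
  then have "\<forall>\<^sub>F n in sequentially. (\<integral>t. indicator {..-1 + 1 / real (Suc n)} t * f t \<partial>lborel) < \<epsilon> / 16"
    using e by (intro order_tendstoD(2)[where y="\<integral>t. 0 \<partial>(lborel :: real measure)"]) auto
  then obtain n where n: "(\<integral>t. indicator {..-1 + 1 / real (Suc n)} t * f t \<partial>lborel) < \<epsilon> / 16"
    by (auto simp: eventually_sequentially)
  define \<delta> where "\<delta> = min 1 (1 / real (Suc n))"
  have "\<delta> > 0" by (simp add: \<delta>_def)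
  moreover have "enn2real (h t) * (1 - t\<^sup>2) < \<epsilon>" if t: "-1 < t" "t < -1 + \<delta>" for t
  proof -
    have "\<delta> \<le> 1" "\<delta> \<le> 1 / real (Suc n)" by (simp_all add: \<delta>_def)
    then have t0: "t < 0" "t \<le> -1 + 1 / real (Suc n)" using t by linarith+
    have lower: "f t / 4 \<le> f s" if s: "s \<in> {(t - 1) / 2..t}" for s
    proof -
      have s': "-1 < s" "s < 1" using s t t0 by auto
      have m1: "(1 + s) / (1 + t) \<le> 2" using s t t0 by (simp add: divide_le_eq)
      have m2: "(1 - s) / (1 - t) \<le> 2" using s t t0 by (simp add: divide_le_eq)
      have "(max ((1 + s) / (1 + t)) ((1 - s) / (1 - t)))\<^sup>2 \<le> 2\<^sup>2"
        using m1 m2 harnack_max_pos[OF s' t(1)] t0 by (intro power_mono) auto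
      then have "1 / 4 \<le> harnack_const s t"
        using harnack_max_pos[OF s' t(1)] t0 unfolding harnack_const_def by (simp add: field_simps)
      then have "f t / 4 \<le> harnack_const s t * f t"
        using mult_right_mono[OF _ f0[of t]] by fastforce
      also have "\<dots> \<le> f s"
        using harnackD[OF h s' t(1)] t0 harnack_const_pos[OF s' t(1)] f0
        by (simp add: hf s' t ennreal_mult[symmetric] ennreal_le_iff)
      finally show ?thesis .
    qed
    have "f t / 4 * ((1 + t) / 2) = (\<integral>s. f t / 4 * indicator {(t - 1) / 2..t} s \<partial>lborel)"
      using t by (simp add: field_simps)
    also have "\<dots> \<le> (\<integral>t. indicator {..-1 + 1 / real (Suc n)} t * f t \<partial>lborel)"
    proof (rule integral_mono)
      show "integrable lborel (\<lambda>s. f t / 4 * indicator {(t - 1) / 2..t} s)"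
        by (intro integrable_mult_right integrable_real_indicator) (auto simp: emeasure_lborel_Icc_eq)
      show "integrable lborel (\<lambda>t. indicator {..-1 + 1 / real (Suc n)} t * f t)"
        using integrable_mult_indicator[OF _ int, of "{..-1 + 1 / real (Suc n)}"] by simp
      fix s
      show "f t / 4 * indicator {(t - 1) / 2..t} s \<le> indicator {..-1 + 1 / real (Suc n)} s * f s"
        using lower[of s] f0[of s] t0 by (auto split: split_indicator)
    qed
    also have "\<dots> < \<epsilon> / 16" by (rule n)
    finally have "f t * (1 + t) < \<epsilon> / 2" by (simp add: field_simps)
    moreover have "enn2real (h t) * (1 - t\<^sup>2) = f t * (1 + t) * (1 - t)"
      using t t0 by (simp add: f_def algebra_simps power2_eq_square)
    moreover have "f t * (1 + t) * (1 - t) \<le> f t * (1 + t) * 2"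
      using t t0 f0 by (intro mult_left_mono) auto
    ultimately show ?thesis by linarith
  qed
  ultimately show ?thesis by blast
qed

text \<open>The lower limit of the iterates is a fixed point of the transfer operator (Fatou and
  conservation of mass).  Relative to the invariant density it vanishes at the end points, by
  integrability and Harnack, so it would attain its maximum; the maximum propagates along the
  parabolic branch \<open>t \<mapsto> -1/(t + 2)\<close> to the end point \<open>-1\<close>.\<close>

lemma gauss_iterate_small_critical:
  assumes e: "\<epsilon> > 0"
  shows "\<exists>n. gauss_iterate 1 n 0 < ennreal \<epsilon>"
proof (rule ccontr)
  assume "\<not> ?thesis"
  then have big: "ennreal \<epsilon> \<le> gauss_iterate 1 n 0" for n by (simp add: not_less)
  \<comment> \<open>The lower limit is written as an increasing supremum of infima: the Harnack
    inequality passes through both operations, and monotone convergence controls the mass and the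
    transfer operator.\<close>
  define g where "g N t = (INF n\<in>{N..}. gauss_iterate 1 n t)" for N t
  define h where "h t = (SUP N. g N t)" for t
  have inc: "incseq g"
    unfolding g_def by (intro incseq_SucI le_funI INF_superset_mono) auto
  have gm[measurable]: "g N \<in> borel_measurable borel" for N
    unfolding g_def by measurable
  have hm[measurable]: "h \<in> borel_measurable borel" unfolding h_def by measurable
  have Hg: "harnack (g N)" for N
    unfolding harnack_def g_def
  proof (intro allI impI INF_greatest)
    fix s t :: real and n assume st: "-1 < s \<and> s < 1 \<and> -1 < t \<and> t < 1" and n: "n \<in> {N..}"
    have "ennreal (harnack_const s t) * (INF n\<in>{N..}. gauss_iterate 1 n t) \<le> ennreal (harnack_const s t) * gauss_iterate 1 n t"
      using n by (intro mult_left_mono INF_lower) auto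
    also have "\<dots> \<le> gauss_iterate 1 n s"
      using st by (intro harnackD harnack_gauss_iterate) auto
    finally show "ennreal (harnack_const s t) * (INF n\<in>{N..}. gauss_iterate 1 n t) \<le> gauss_iterate 1 n s" .
  qed
  have H: "harnack h"
    unfolding harnack_def
  proof (intro allI impI)
    fix s t :: real assume st: "-1 < s \<and> s < 1 \<and> -1 < t \<and> t < 1"
    show "ennreal (harnack_const s t) * h t \<le> h s"
      unfolding h_def SUP_mult_left_ennreal
      using st by (intro SUP_mono) (auto intro: harnackD[OF Hg])
  qed
  have super: "gauss_transfer 1 h t \<le> h t" for t
  proof -
    have "gauss_transfer 1 h t = (SUP N. gauss_transfer 1 (g N) t)"
      unfolding h_def[abs_def] by (rule gauss_transfer_SUP[OF inc])
    also have "\<dots> \<le> (SUP N. g (Suc N) t)"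
    proof (intro SUP_mono bexI[of _ _])
      fix N
      show "gauss_transfer 1 (g N) t \<le> g (Suc N) t"
        unfolding g_def
      proof (rule INF_greatest)
        fix n assume "n \<in> {Suc N..}"
        then obtain k where k: "n = Suc k" "k \<ge> N" by (cases n) auto
        show "gauss_transfer 1 (\<lambda>t. INF n\<in>{N..}. gauss_iterate 1 n t) t \<le> gauss_iterate 1 n t"
          unfolding k(1) gauss_iterate_Suc using k(2) by (intro gauss_transfer_mono INF_lower) auto
      qed
    qed auto
    also have "\<dots> \<le> h t" unfolding h_def by (intro SUP_least SUP_upper) auto
    finally show ?thesis .
  qed
  have mass: "(\<integral>\<^sup>+t. h t * indicator {-1..<1} t \<partial>lborel) \<le> 2"
  proof -
    have "(\<integral>\<^sup>+t. h t * indicator {-1..<1} t \<partial>lborel) = (\<integral>\<^sup>+t. (SUP N. g N t * indicator {-1..<1} t) \<partial>lborel)"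
      unfolding h_def by (simp add: SUP_mult_right_ennreal)
    also have "\<dots> = (SUP N. \<integral>\<^sup>+t. g N t * indicator {-1..<1} t \<partial>lborel)"
      using inc by (intro nn_integral_monotone_convergence_SUP) (auto simp: incseq_def le_fun_def intro!: mult_right_mono)
    also have "\<dots> \<le> 2"
    proof (rule SUP_least)
      fix N
      have "(\<integral>\<^sup>+t. g N t * indicator {-1..<1} t \<partial>lborel) \<le> (\<integral>\<^sup>+t. gauss_iterate 1 N t * indicator {-1..<1} t \<partial>lborel)"
        unfolding g_def by (intro nn_integral_mono mult_right_mono INF_lower) auto
      also have "\<dots> \<le> 2" by (rule gauss_iterate_mass) auto
      finally show "(\<integral>\<^sup>+t. g N t * indicator {-1..<1} t \<partial>lborel) \<le> 2" .
    qed
    finally show ?thesis .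
  qed
  then have fin: "(\<integral>\<^sup>+t. h t * indicator {-1..<1} t \<partial>lborel) < \<infinity>"
    by (simp add: le_less_trans[OF _ ennreal_numeral_less_top])
  \<comment> \<open>For \<open>c = 1\<close> the points killed inside the interval form a null set,
    so one step preserves mass.\<close>
  have mass_eq: "(\<integral>\<^sup>+t. gauss_transfer 1 h t * indicator {-1..<1} t \<partial>lborel) = (\<integral>\<^sup>+t. h t * indicator {-1..<1} t \<partial>lborel)"
  proof -
    have "(\<integral>\<^sup>+t. gauss_transfer 1 h t * indicator {-1..<1} t \<partial>lborel) = (\<integral>\<^sup>+t. h t * gauss_koopman 1 (indicator {-1..<1}) t \<partial>lborel)"
      by (rule gauss_transfer_dual[symmetric]) (auto split: split_indicator)
    also have "\<dots> = (\<integral>\<^sup>+t. h t * indicator {-1..<1} t \<partial>lborel)"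
    proof (rule nn_integral_cong_AE)
      have "AE t in lborel. t \<noteq> (0::real)" "AE t in lborel. t \<noteq> (1::real)" "AE t in lborel. t \<noteq> (-1::real)"
        by (rule AE_lborel_singleton)+
      then show "AE t in lborel. h t * gauss_koopman 1 (indicator {-1..<1}) t = h t * indicator {-1..<1} t"
      proof eventually_elim
        case (elim t)
        have "gauss_koopman 1 (indicator {-1..<1}) t = (indicator {-1..<1} t :: ennreal)"
        proof (cases "t \<in> {-1..<1}")
          case True
          have "- (1 / t) \<notin> {-1..<1}"
          proof (cases "t > 0")
            case True
            then have "1 / t > 1" using \<open>t \<in> {-1..<1}\<close> by (simp add: field_simps)
            then show ?thesis by simp
          next
            case False
            then have "- (1 / t) > 1" using \<open>t \<in> {-1..<1}\<close> elim by (simp add: field_simps)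
            then show ?thesis by simp
          qed
          then show ?thesis using True period_red_bounds[of "- (1 / t)"] by (simp add: gauss_koopman_def)
        next
          case False
          then show ?thesis using gauss_koopman_outside[of 1 t "indicator {-1..<1} :: real \<Rightarrow> ennreal"] by simp
        qed
        then show ?case by simp
      qed
    qed
    finally show ?thesis .
  qed
  have finT: "(\<integral>\<^sup>+t. gauss_transfer 1 h t * indicator {-1..<1} t \<partial>lborel) < \<infinity>"
    using mass_eq fin by simp
  have HT: "harnack (gauss_transfer 1 h)" by (rule harnack_gauss_transfer[OF _ _ H]) auto
  have Tfin: "gauss_transfer 1 h t < \<infinity>" if "-1 < t" "t < 1" for t
    by (rule harnack_finite[OF HT finT that])
  have hfin: "h t < \<infinity>" if "-1 < t" "t < 1" for t
    by (rule harnack_finite[OF H fin that])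
  have AE_eq: "AE t in lborel. t \<in> {-1<..<1} \<longrightarrow> enn2real (gauss_transfer 1 h t) = enn2real (h t)"
  proof -
    have "(\<integral>\<^sup>+t. (h t - gauss_transfer 1 h t) * indicator {-1..<1} t \<partial>lborel)
      = (\<integral>\<^sup>+t. h t * indicator {-1..<1} t - gauss_transfer 1 h t * indicator {-1..<1} t \<partial>lborel)"
      by (intro nn_integral_cong) (auto split: split_indicator)
    also have "\<dots> = (\<integral>\<^sup>+t. h t * indicator {-1..<1} t \<partial>lborel) - (\<integral>\<^sup>+t. gauss_transfer 1 h t * indicator {-1..<1} t \<partial>lborel)"
      using finT super by (intro nn_integral_diff) (auto intro!: mult_right_mono)
    also have "\<dots> = 0" using mass_eq fin by simp
    finally have "AE t in lborel. (h t - gauss_transfer 1 h t) * indicator {-1..<1} t = 0"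
      by (subst (asm) nn_integral_0_iff_AE) auto
    then show ?thesis
    proof eventually_elim
      case (elim t)
      then show ?case using super[of t] Tfin[of t]
        by (auto split: split_indicator_asm simp: ennreal_minus_eq_0 intro: antisym dest!: ennreal_minus_eq_0)
    qed
  qed
  \<comment> \<open>The maximum is examined at individual points, so equality almost everywhere has
    to be upgraded. Both sides are Harnack functions of finite mass, hence continuous.\<close>
  have fixpt: "gauss_transfer 1 h t = h t" if t: "-1 < t" "t < 1" for t
  proof -
    have "enn2real (gauss_transfer 1 h t) = enn2real (h t)"
      by (rule AE_eq_continuous_imp_eq[OF open_greaterThanLessThan _ _ AE_eq])
        (use t in \<open>auto intro!: harnack_continuous H HT hfin Tfin\<close>)
    then show ?thesis using hfin[OF t] Tfin[OF t] by (metis ennreal_enn2real infinity_ennreal_def)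
  qed
  define \<phi> where "\<phi> t = enn2real (h t) * (1 - t\<^sup>2)" for t
  have h_even: "h (- t) = h t" for t by (simp add: h_def g_def gauss_iterate_even)
  have pos: "\<phi> 0 > 0"
  proof -
    have "ennreal \<epsilon> \<le> g 0 0" unfolding g_def by (intro INF_greatest big)
    also have "\<dots> \<le> h 0" unfolding h_def by (intro SUP_upper) auto
    finally have "ennreal \<epsilon> \<le> h 0" .
    moreover have "0 < ennreal \<epsilon>" using e by simp
    ultimately have "0 < h 0" by (rule less_le_trans[rotated])
    then show ?thesis using hfin[of 0] by (simp add: \<phi>_def enn2real_positive_iff)
  qed
  obtain \<delta> where \<delta>: "\<delta> > 0" "\<And>t. -1 < t \<Longrightarrow> t < -1 + \<delta> \<Longrightarrow> \<phi> t < \<phi> 0"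
    using harnack_boundary_decay[OF H fin hm pos] unfolding \<phi>_def by blast
  have \<delta>1: "\<delta> \<le> 1" using \<delta>(2)[of 0] by force
  have \<phi>_even: "\<phi> (- t) = \<phi> t" for t by (simp add: \<phi>_def h_even)
  have "continuous_on {-1<..<1} \<phi>"
    unfolding \<phi>_def by (intro continuous_intros harnack_continuous H hfin)
  then have "continuous_on {-1 + \<delta>..1 - \<delta>} \<phi>"
    by (rule continuous_on_subset) (use \<delta> in auto)
  then obtain t0 where t0: "t0 \<in> {-1 + \<delta>..1 - \<delta>}" "\<And>t. t \<in> {-1 + \<delta>..1 - \<delta>} \<Longrightarrow> \<phi> t \<le> \<phi> t0"
    using continuous_attains_sup[of "{-1 + \<delta>..1 - \<delta>}" \<phi>] \<delta>1 by auto
  define M where "M = \<phi> t0"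
  have M0: "\<phi> 0 \<le> M" using t0(2)[of 0] \<delta>1 by (simp add: M_def)
  have max: "\<phi> t \<le> M" if "-1 < t" "t < 1" for t
  proof -
    consider "t < -1 + \<delta>" | "- t < -1 + \<delta>" | "t \<in> {-1 + \<delta>..1 - \<delta>}" by fastforce
    then show ?thesis
    proof cases
      case 1
      then show ?thesis using \<delta>(2)[of t] that M0 by simp
    next
      case 2
      then show ?thesis using \<delta>(2)[of "- t"] that M0 by (simp add: \<phi>_even)
    next
      case 3
      then show ?thesis using t0(2) by (simp add: M_def)
    qed
  qed
  have sq: "1 - t\<^sup>2 > 0" if "-1 < t" "t < 1" for t :: real
    using that by (simp add: abs_square_less_1)
  have hle: "h t \<le> ennreal M * hyp_density t" if t: "-1 < t" "t < 1" for t
  proof -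
    have "enn2real (h t) \<le> M * (1 / (1 - t\<^sup>2))"
      using max[OF t] sq[OF t] by (simp add: \<phi>_def pos_le_divide_eq)
    then have "ennreal (enn2real (h t)) \<le> ennreal (M * (1 / (1 - t\<^sup>2)))" by (rule ennreal_leI)
    then show ?thesis using hfin[OF t] sq[OF t] M0 pos by (simp add: hyp_density_def ennreal_mult[symmetric])
  qed
  \<comment> \<open>Both \<open>h\<close> and the invariant density solve the fixed point equation,
    and \<open>h \<le> M\<close> times the density holds on every branch. Equality of the sums at
    \<open>t\<close> thus forces equality on each branch; the branch \<open>t + 2\<close> is
    isolated by cancelling the remaining sum \<open>R h\<close>, which is finite.\<close>
  have propagate: "\<phi> (- (1 / (t + 2))) = M" if t: "-1 < t" "t < 1" and eq: "\<phi> t = M" for t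
  proof -
    define y where "y = - (1 / (t + 2))"
    have y: "-1 < y" "y < 1" using t by (auto simp: y_def field_simps)
    have unit: "-1 < - (1 / x) \<and> - (1 / x) < 1" if "\<bar>x\<bar> > 1" for x :: real
    proof -
      have "\<bar>1 / x\<bar> < 1" using that by (simp add: field_simps)
      then show ?thesis by linarith
    qed
    define R where "R k = gauss_transfer_summand 1 k (t - 2) + (\<Sum>n. gauss_transfer_summand 1 k (t + 2 * real (Suc (Suc n)))
      + gauss_transfer_summand 1 k (t - 2 * real (Suc (Suc n))))" for k
    have split: "gauss_transfer 1 k t = gauss_transfer_summand 1 k (t + 2) + R k" for k
    proof -
      have "gauss_transfer 1 k t = (\<Sum>n. gauss_transfer_summand 1 k (t + 2 * real (Suc (n + 1))) + gauss_transfer_summand 1 k (t - 2 * real (Suc (n + 1))))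
         + (\<Sum>n<1. gauss_transfer_summand 1 k (t + 2 * real (Suc n)) + gauss_transfer_summand 1 k (t - 2 * real (Suc n)))"
        unfolding gauss_transfer_def by (rule suminf_offset) (rule summableI)
      then show ?thesis by (simp add: R_def add_ac)
    qed
    have sm: "gauss_transfer_summand 1 h x \<le> ennreal M * gauss_transfer_summand 1 hyp_density x" if "\<bar>x\<bar> > 1" for x
    proof -
      have "gauss_transfer_summand 1 h x \<le> ennreal (1 / x\<^sup>2) * (ennreal M * hyp_density (- (1 / x)))"
        unfolding gauss_transfer_summand_def using unit[OF that] by (intro mult_left_mono hle) auto
      then show ?thesis by (simp add: gauss_transfer_summand_def mult_ac)
    qed
    have RR: "R h \<le> ennreal M * R hyp_density"
      unfolding R_def distrib_left ennreal_suminf_cmult[symmetric]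
      using t by (intro add_mono suminf_le allI summableI sm) auto
    have "h t = ennreal M * hyp_density t"
    proof -
      have "enn2real (h t) = M * (1 / (1 - t\<^sup>2))" using eq sq[OF t] by (simp add: \<phi>_def field_simps)
      then have "ennreal (enn2real (h t)) = ennreal (M * (1 / (1 - t\<^sup>2)))" by simp
      then show ?thesis using hfin[OF t] sq[OF t] M0 pos by (simp add: hyp_density_def ennreal_mult[symmetric])
    qed
    then have "gauss_transfer_summand 1 h (t + 2) + R h = ennreal M * (gauss_transfer_summand 1 hyp_density (t + 2) + R hyp_density)"
      unfolding split[symmetric] fixpt[OF t] gauss_transfer_hyp_density[OF t] .
    then have "R h + ennreal M * gauss_transfer_summand 1 hyp_density (t + 2) \<le> R h + gauss_transfer_summand 1 h (t + 2)"
      using RR by (simp add: distrib_left add.commute add_left_mono)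
    moreover have "R h \<noteq> \<infinity>"
      using Tfin[OF t] unfolding split by (auto simp: less_top)
    ultimately have "ennreal M * gauss_transfer_summand 1 hyp_density (t + 2) \<le> gauss_transfer_summand 1 h (t + 2)"
      unfolding ennreal_add_left_cancel_le by blast
    then have "ennreal (1 / (t + 2)\<^sup>2 * (M * (1 / (1 - y\<^sup>2)))) \<le> ennreal (1 / (t + 2)\<^sup>2 * enn2real (h y))"
      using hfin[OF y] sq[OF y] M0 pos
      by (simp add: gauss_transfer_summand_def hyp_density_def y_def[symmetric] ennreal_mult mult_ac del: times_divide_eq_right times_divide_eq_left)
    then have "1 / (t + 2)\<^sup>2 * (M * (1 / (1 - y\<^sup>2))) \<le> 1 / (t + 2)\<^sup>2 * enn2real (h y)"
      by (subst (asm) ennreal_le_iff) auto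
    then have "M * (1 / (1 - y\<^sup>2)) \<le> enn2real (h y)"
      using t by (subst (asm) mult_le_cancel_left_pos) auto
    then have "M \<le> \<phi> y" using sq[OF y] by (simp add: \<phi>_def pos_divide_le_eq)
    then show ?thesis using max[OF y] by (simp add: y_def)
  qed
  define T where "T k = ((\<lambda>t. - (1 / (t + 2))) ^^ k) t0" for k
  \<comment> \<open>In the coordinate \<open>1 / (1 + t)\<close> the branch is translation by 1,
    with -1 as its parabolic fixed point at infinity. This gives the orbit in closed form and its
    convergence to -1.\<close>
  have T: "-1 < T k \<and> T k < 1 \<and> \<phi> (T k) = M \<and> 1 + T k = 1 / (real k + 1 / (1 + t0))" for k
  proof (induction k)
    case 0
    then show ?case using t0(1) \<delta> by (auto simp: T_def M_def)
  next
    case (Suc k)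
    have TS: "T (Suc k) = - (1 / (T k + 2))" by (simp add: T_def)
    have pos1: "1 + t0 > 0" using t0(1) \<delta> by auto
    have "-1 < T k" "T k < 1" using Suc by auto
    then have "-1 < T (Suc k)" "T (Suc k) < 1" by (auto simp: TS field_simps)
    moreover have "\<phi> (T (Suc k)) = M" unfolding TS using Suc by (intro propagate) auto
    moreover have "1 + T (Suc k) = 1 / (real (Suc k) + 1 / (1 + t0))"
    proof -
      define X where "X = real k + 1 / (1 + t0)"
      have X: "X > 0" using pos1 unfolding X_def by (intro add_nonneg_pos) auto
      have TX: "T k = 1 / X - 1" using Suc by (simp add: X_def)
      have "1 + T (Suc k) = 1 / (X + 1)" unfolding TS TX using X by (simp add: field_simps)
      then show ?thesis by (simp add: X_def add_ac)
    qed
    ultimately show ?case by simp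
  qed
  obtain k :: nat where k: "real k > 1 / \<delta>" using reals_Archimedean2 by blast
  have pos1: "1 + t0 > 0" using t0(1) \<delta> by auto
  have "1 + T k < \<delta>"
  proof -
    have X: "0 < real k + 1 / (1 + t0)" using pos1 by (intro add_nonneg_pos) auto
    have "1 / \<delta> < real k + 1 / (1 + t0)" using k divide_pos_pos[OF zero_less_one pos1] by linarith
    then have "1 / (real k + 1 / (1 + t0)) < \<delta>"
      using \<delta>(1) X by (simp add: divide_less_eq less_divide_eq mult.commute del: divide_less_eq_1_pos)
    then show ?thesis using T[of k] by simp
  qed
  then have "\<phi> (T k) < \<phi> 0" using T[of k] by (intro \<delta>(2)) auto
  then show False using T[of k] M0 by simp
qed

subsection \<open>Uniqueness for integrable densities\<close>

text \<open>The density of the image of \<open>F dt\<close> under the inversion that sends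
  \<open>t\<close> to \<open>- (c / t)\<close>. It exchanges the relations on the two axes of the
  cross.\<close>

definition reflect_density :: "real \<Rightarrow> (real \<Rightarrow> complex) \<Rightarrow> real \<Rightarrow> complex" where
  "reflect_density c F s = (c / s\<^sup>2) *\<^sub>R F (- (c / s))"

lemma integral_reflect_density:
  assumes c: "c > 0" and [measurable]: "F \<in> borel_measurable borel" "b \<in> borel_measurable borel"
  shows "(\<integral>s. reflect_density c F s * b (- (c / s)) \<partial>lborel) = (\<integral>t. F t * b t \<partial>lborel)"
  using integral_inversion[OF c, of "\<lambda>t. F t * b t"] by (simp add: reflect_density_def)

lemma integral_reflect_density':
  assumes c: "c > 0" and [measurable]: "F \<in> borel_measurable borel" "b \<in> borel_measurable borel"
  shows "(\<integral>s. reflect_density c F s * b s \<partial>lborel) = (\<integral>t. F t * b (- (c / t)) \<partial>lborel)"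
proof -
  have "- (c / - (c / s)) = s" for s using c by simp
  then show ?thesis
    using integral_reflect_density[OF c, of F "\<lambda>t. b (- (c / t))"] by simp
qed

lemma reflect_density_twice:
  "c > 0 \<Longrightarrow> s \<noteq> 0 \<Longrightarrow> reflect_density c (reflect_density c F) s = F s"
  by (simp add: reflect_density_def power_divide power2_eq_square)

text \<open>The periodic extension of \<open>b\<close> pairs to 0 with \<open>F\<close>. Its part
  inside the interval is \<open>b\<close>; its part outside becomes \<open>gauss_koopman c b\<close>
  after the inversion, with \<open>F\<close> replaced by its reflection.\<close>

lemma integral_koopman_step:
  assumes c: "0 < c" "c \<le> 1" and F: "char_annih F"
    and bm[measurable]: "b \<in> borel_measurable borel" and bd: "\<And>t. norm (b t) \<le> K"
    and supp: "\<And>t. t \<notin> {-1..<1} \<Longrightarrow> b t = (0::complex)"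
  shows "(\<integral>t. F t * b t \<partial>lborel) = - (\<integral>s. reflect_density c F s * gauss_koopman c b s \<partial>lborel)"
proof -
  have int: "integrable lborel F" using F by (simp add: char_annih_def)
  then have Fm[measurable]: "F \<in> borel_measurable borel" by auto
  define out where "out t = (if t \<in> {-1..<1} then 0 else b (period_red t))" for t
  have om[measurable]: "out \<in> borel_measurable borel" unfolding out_def by measurable
  have K: "0 \<le> K" using bd[of 0] norm_ge_zero order_trans by blast
  have e: "b (period_red t) = b t + out t" for t
    using supp[of t] by (auto simp: out_def period_red_id)
  have "0 = (\<integral>t. F t * b (period_red t) \<partial>lborel)"
    by (rule char_annih_periodic[OF F bm bd, symmetric])
  also have "\<dots> = (\<integral>t. F t * b t \<partial>lborel) + (\<integral>t. F t * out t \<partial>lborel)"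
    unfolding e distrib_left
    by (intro Bochner_Integration.integral_add integrable_mult_bounded[OF int, where B=K])
      (use bd K in \<open>auto simp: out_def\<close>)
  also have "(\<integral>t. F t * out t \<partial>lborel) = (\<integral>s. reflect_density c F s * out (- (c / s)) \<partial>lborel)"
    by (rule integral_reflect_density[OF c(1) Fm om, symmetric])
  also have "(\<lambda>s. out (- (c / s))) = gauss_koopman c b"
    by (simp add: fun_eq_iff out_def gauss_koopman_def)
  finally show ?thesis by (simp add: eq_neg_iff_add_eq_0)
qed

lemma norm_koopman_funpow:
  assumes "\<And>t. ennreal (norm (b t :: complex)) \<le> b' t"
  shows "ennreal (norm ((gauss_koopman c ^^ n) b t)) \<le> (gauss_koopman c ^^ n) b' t"
proof (induction n arbitrary: t)
  case (Suc n)
  then show ?case by (simp add: gauss_koopman_def)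
qed (simp add: assms)

text \<open>Every step replaces \<open>F\<close> by its reflection and \<open>b\<close> by
  \<open>gauss_koopman c b\<close>. Reflecting twice returns \<open>F\<close> except at 0, where
  division by zero intervenes; hence the condition \<open>t \<noteq> 0\<close>. A single
  \<open>W\<close> dominating both densities therefore serves all \<open>n\<close>.\<close>

lemma norm_integral_koopman_le:
  assumes c: "0 < c" "c \<le> 1" and F: "char_annih F" and G: "char_annih (reflect_density c F)"
    and bm: "b \<in> borel_measurable borel" and bd: "\<And>t. norm (b t) \<le> K"
    and supp: "\<And>t. t \<notin> {-1..<1} \<Longrightarrow> b t = (0::complex)"
    and W: "\<And>t. t \<noteq> 0 \<Longrightarrow> norm (F t) \<le> W t" "\<And>t. t \<noteq> 0 \<Longrightarrow> norm (reflect_density c F t) \<le> W t"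
  shows "ennreal (norm (\<integral>t. F t * b t \<partial>lborel)) \<le> (\<integral>\<^sup>+t. ennreal (W t) * ennreal (norm ((gauss_koopman c ^^ n) b t)) \<partial>lborel)"
  using F G bm bd supp W
proof (induction n arbitrary: F b)
  case 0
  have K: "0 \<le> K" using 0(4)[of 0] norm_ge_zero order_trans by blast
  have int: "integrable lborel (\<lambda>t. F t * b t)"
    using 0 by (intro integrable_mult_bounded[where B=K]) (auto simp: char_annih_def)
  have "ennreal (norm (\<integral>t. F t * b t \<partial>lborel)) \<le> (\<integral>\<^sup>+t. ennreal (norm (F t * b t)) \<partial>lborel)"
    by (rule integral_norm_bound_ennreal[OF int])
  also have "\<dots> \<le> (\<integral>\<^sup>+t. ennreal (W t) * ennreal (norm (b t)) \<partial>lborel)"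
  proof (rule nn_integral_mono_AE)
    show "AE t in lborel. ennreal (norm (F t * b t)) \<le> ennreal (W t) * ennreal (norm (b t))"
      using AE_lborel_singleton[of "0::real"]
    proof eventually_elim
      case (elim t)
      have "ennreal (norm (F t * b t)) = ennreal (norm (F t)) * ennreal (norm (b t))"
        by (simp add: norm_mult ennreal_mult)
      also have "\<dots> \<le> ennreal (W t) * ennreal (norm (b t))"
        using 0(6)[OF elim] by (intro mult_right_mono ennreal_leI) auto
      finally show ?case .
    qed
  qed
  finally show ?case by simp
next
  case (Suc n)
  have Fm[measurable]: "F \<in> borel_measurable borel" using Suc.prems(1) by (auto simp: char_annih_def)
  have intF: "integrable lborel F" using Suc.prems(1) by (simp add: char_annih_def)
  have K: "0 \<le> K" using Suc.prems(4)[of 0] norm_ge_zero order_trans by blast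
  define F' where "F' = reflect_density c F"
  have tw: "reflect_density c F' t = F t" if "t \<noteq> 0" for t
    using reflect_density_twice[OF c(1) that] by (simp add: F'_def)
  have F'm[measurable]: "F' \<in> borel_measurable borel" unfolding F'_def reflect_density_def by measurable
  have "char_annih (reflect_density c F')"
  proof -
    have m[measurable]: "reflect_density c F' \<in> borel_measurable borel" unfolding reflect_density_def by measurable
    have ae: "AE t in lborel. reflect_density c F' t = F t"
      using AE_lborel_singleton[of "0::real"] by eventually_elim (rule tw)
    have "integrable lborel (reflect_density c F')"
      by (rule integrable_cong_AE_imp[OF intF]) (use ae in auto)
    moreover have "(\<integral>t. reflect_density c F' t * cis (pi * of_int j * t) \<partial>lborel) = (\<integral>t. F t * cis (pi * of_int j * t) \<partial>lborel)" for j :: int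
      by (rule integral_cong_AE) (use ae in auto)
    ultimately show ?thesis using Suc.prems(1) by (simp add: char_annih_def)
  qed
  moreover have "norm (gauss_koopman c b t) \<le> K" for t
    using Suc.prems(4) K by (simp add: gauss_koopman_def)
  ultimately have "ennreal (norm (\<integral>t. F' t * gauss_koopman c b t \<partial>lborel))
     \<le> (\<integral>\<^sup>+t. ennreal (W t) * ennreal (norm ((gauss_koopman c ^^ n) (gauss_koopman c b) t)) \<partial>lborel)"
    using Suc.prems(2,3,6,7) tw
    by (intro Suc.IH) (simp_all add: F'_def[symmetric] gauss_koopman_measurable gauss_koopman_outside[OF c] del: atLeastLessThan_iff)
  moreover have "(\<integral>t. F t * b t \<partial>lborel) = - (\<integral>t. F' t * gauss_koopman c b t \<partial>lborel)"
    unfolding F'_def by (rule integral_koopman_step[OF c Suc.prems(1,3,4,5)])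
  ultimately show ?case by (simp add: funpow_swap1)
qed

lemma gauss_iterate_small:
  assumes "0 < c" "c \<le> 1" "\<epsilon> > 0"
  shows "\<exists>n. gauss_iterate c n 0 < ennreal \<epsilon>"
  using gauss_iterate_small_subcritical[of c \<epsilon>] gauss_iterate_small_critical[of \<epsilon>] assms by (cases "c = 1") auto

text \<open>Duality with the constant 1 turns the integral into the mass that the n-th iterate puts
  on \<open>{-\<rho>..\<rho>}\<close>, and there Harnack bounds the iterate by its value at 0. The
  number \<open>\<eta>\<close> is chosen so that the bound times the length
  \<open>2 * \<rho>\<close> equals \<open>\<epsilon>\<close>.\<close>

lemma koopman_mass_small:
  assumes c: "0 < c" "c \<le> 1" and \<rho>: "0 < \<rho>" "\<rho> < 1" and e: "\<epsilon> > 0"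
  shows "\<exists>n. (\<integral>\<^sup>+t. (gauss_koopman c ^^ n) (indicator {-\<rho>..\<rho>}) t \<partial>lborel) \<le> ennreal \<epsilon>"
proof -
  define \<eta> where "\<eta> = \<epsilon> * (1 - \<rho>)\<^sup>2 / (2 * \<rho>)"
  have "\<eta> > 0" using \<rho> e by (simp add: \<eta>_def)
  then obtain n where n: "gauss_iterate c n 0 < ennreal \<eta>" using gauss_iterate_small[OF c] by blast
  have "(\<integral>\<^sup>+t. 1 * (gauss_koopman c ^^ n) (indicator {-\<rho>..\<rho>}) t \<partial>lborel)
     = (\<integral>\<^sup>+t. (gauss_transfer c ^^ n) (\<lambda>_. 1) t * indicator {-\<rho>..\<rho>} t \<partial>lborel)"
    using \<rho> by (intro gauss_transfer_funpow_dual c) (auto simp: indicator_def)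
  also have "\<dots> = (\<integral>\<^sup>+t. gauss_iterate c n t * indicator {-\<rho>..\<rho>} t \<partial>lborel)"
    by (simp add: gauss_iterate_def)
  also have "\<dots> \<le> (\<integral>\<^sup>+t. ennreal (\<eta> / (1 - \<rho>)\<^sup>2) * indicator {-\<rho>..\<rho>} t \<partial>lborel)"
  proof (rule nn_integral_mono)
    fix t
    have "gauss_iterate c n t \<le> ennreal (\<eta> / (1 - \<rho>)\<^sup>2)" if t: "t \<in> {-\<rho>..\<rho>}"
    proof -
      have "(1 - \<rho>)\<^sup>2 \<le> (1 - \<bar>t\<bar>)\<^sup>2" using t \<rho> by (intro power_mono) auto
      then have "ennreal ((1 - \<rho>)\<^sup>2) * gauss_iterate c n t \<le> ennreal ((1 - \<bar>t\<bar>)\<^sup>2) * gauss_iterate c n t"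
        by (intro mult_right_mono ennreal_leI) auto
      also have "\<dots> \<le> gauss_iterate c n 0"
        using t \<rho> by (intro harnack_at_zero harnack_gauss_iterate c) auto
      also have "\<dots> \<le> ennreal \<eta>" using n by simp
      finally have "ennreal (1 / (1 - \<rho>)\<^sup>2) * (ennreal ((1 - \<rho>)\<^sup>2) * gauss_iterate c n t) \<le> ennreal (1 / (1 - \<rho>)\<^sup>2) * ennreal \<eta>"
        by (intro mult_left_mono) auto
      moreover have "ennreal (1 / (1 - \<rho>)\<^sup>2) * ennreal ((1 - \<rho>)\<^sup>2) = 1"
        using \<rho> by (subst ennreal_mult[symmetric]) auto
      ultimately show ?thesis using \<open>\<eta> > 0\<close> by (simp add: mult.assoc[symmetric] ennreal_mult[symmetric])
    qed
    then show "gauss_iterate c n t * indicator {-\<rho>..\<rho>} t \<le> ennreal (\<eta> / (1 - \<rho>)\<^sup>2) * indicator {-\<rho>..\<rho>} t"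
      by (auto split: split_indicator)
  qed
  also have "\<dots> = ennreal (\<eta> / (1 - \<rho>)\<^sup>2) * ennreal (2 * \<rho>)"
    using \<rho> by (subst nn_integral_cmult_indicator) auto
  also have "\<dots> = ennreal \<epsilon>"
    using \<rho> e by (subst ennreal_mult[symmetric]) (auto simp: \<eta>_def)
  finally show ?thesis by auto
qed

text \<open>Testing \<open>F\<close> against its conjugate phase yields the norm \<open>I\<close> of
  \<open>F\<close> on \<open>{-\<rho>..\<rho>}\<close>. In the iterated bound, \<open>W\<close> is
  split at a height \<open>k\<close>: the excess over \<open>k\<close> has integral below
  \<open>e / 2\<close> and meets iterates bounded by 1, while the bounded part is paid for by the
  small integral of the iterate. The height is fixed before \<open>n\<close> is chosen.\<close>

lemma char_annih_vanish_on_unit: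
  assumes c: "0 < c" "c \<le> 1" and F: "char_annih F" and G: "char_annih (reflect_density c F)"
    and \<rho>: "0 < \<rho>" "\<rho> < 1"
  shows "AE t in lborel. t \<in> {-\<rho>..\<rho>} \<longrightarrow> F t = 0"
proof -
  have iF: "integrable lborel F" and iG: "integrable lborel (reflect_density c F)"
    using F G by (auto simp: char_annih_def)
  have [measurable]: "F \<in> borel_measurable borel" "reflect_density c F \<in> borel_measurable borel"
    using iF iG by auto
  define W where "W t = norm (F t) + norm (reflect_density c F t)" for t
  have iW: "integrable lborel W" unfolding W_def using iF iG by auto
  have [measurable]: "W \<in> borel_measurable borel" unfolding W_def by measurable
  have W0: "0 \<le> W t" for t by (simp add: W_def)
  \<comment> \<open>Where \<open>F\<close> vanishes, division by zero gives the value 0, so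
    \<open>F t * b t\<close> is the modulus of \<open>F t\<close> on all of
    \<open>{-\<rho>..\<rho>}\<close>.\<close>
  define b where "b t = (if t \<in> {-\<rho>..\<rho>} then cnj (F t) / complex_of_real (norm (F t)) else 0)" for t
  have [measurable]: "cnj \<in> borel_measurable borel"
    by (intro borel_measurable_continuous_onI continuous_intros)
  have bm[measurable]: "b \<in> borel_measurable borel" unfolding b_def by measurable
  have bd: "norm (b t) \<le> 1" for t by (simp add: b_def norm_divide)
  have supp: "b t = 0" if "t \<notin> {-1..<1}" for t using that \<rho> by (auto simp: b_def)
  have Fb: "F t * b t = complex_of_real (norm (F t) * indicator {-\<rho>..\<rho>} t)" for t
  proof -
    have "F t * (cnj (F t) / complex_of_real (norm (F t))) = complex_of_real (norm (F t))"
      by (simp add: complex_norm_square[symmetric] power2_eq_square)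
    then show ?thesis by (simp add: b_def indicator_def)
  qed
  define I where "I = (\<integral>t. norm (F t) * indicator {-\<rho>..\<rho>} t \<partial>lborel)"
  have I0: "I \<ge> 0" unfolding I_def by (intro integral_nonneg_AE) auto
  have nI: "norm (\<integral>t. F t * b t \<partial>lborel) = I"
    unfolding Fb integral_complex_of_real I_def[symmetric] using I0 by simp
  have lim: "(\<lambda>k. \<integral>t. max 0 (W t - real k) \<partial>lborel) \<longlonglongrightarrow> (\<integral>t. 0 \<partial>(lborel :: real measure))"
  proof (rule integral_dominated_convergence[where w=W])
    show "AE t in lborel. (\<lambda>k. max 0 (W t - real k)) \<longlonglongrightarrow> 0"
    proof (rule AE_I2)
      fix t
      have "\<forall>\<^sub>F k in sequentially. max 0 (W t - real k) = 0"
        using eventually_ge_at_top[of "nat \<lceil>W t\<rceil>"] by eventually_elim linarith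
      then show "(\<lambda>k. max 0 (W t - real k)) \<longlonglongrightarrow> 0" by (rule tendsto_eventually)
    qed
    show "AE t in lborel. norm (max 0 (W t - real k)) \<le> W t" for k
      using W0 by (intro AE_I2) auto
  qed (use iW in auto)
  have "I \<le> e" if e: "e > 0" for e
  proof -
    have "\<forall>\<^sub>F k in sequentially. (\<integral>t. max 0 (W t - real k) \<partial>lborel) < e / 2"
      using e by (intro order_tendstoD(2)[OF lim]) auto
    then obtain k where k: "(\<integral>t. max 0 (W t - real k) \<partial>lborel) < e / 2" by (auto simp: eventually_sequentially)
    have ik: "integrable lborel (\<lambda>t. max 0 (W t - real k))"
      by (rule Bochner_Integration.integrable_bound[OF iW]) (use W0 in auto)
    define C where "C n = (gauss_koopman c ^^ n) (indicator {-\<rho>..\<rho>} :: real \<Rightarrow> ennreal)" for n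
    have Cm[measurable]: "C n \<in> borel_measurable borel" for n
      unfolding C_def by (rule gauss_koopman_funpow_props(1)[OF c]) (use \<rho> in \<open>auto simp: indicator_def\<close>)
    have C1: "C n t \<le> 1" for n t
      unfolding C_def by (induction n arbitrary: t) (auto simp: gauss_koopman_def indicator_def)
    have "e / (2 * (real k + 1)) > 0" using e by simp
    then obtain n where n: "(\<integral>\<^sup>+t. C n t \<partial>lborel) \<le> ennreal (e / (2 * (real k + 1)))"
      using koopman_mass_small[OF c \<rho>] unfolding C_def by blast
    have "ennreal I \<le> (\<integral>\<^sup>+t. ennreal (W t) * ennreal (norm ((gauss_koopman c ^^ n) b t)) \<partial>lborel)"
      using norm_integral_koopman_le[OF c F G bm bd supp, of W n] unfolding nI by (auto simp: W_def)
    also have "\<dots> \<le> (\<integral>\<^sup>+t. ennreal (W t) * C n t \<partial>lborel)"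
    proof (intro nn_integral_mono mult_left_mono)
      have "ennreal (norm (b t)) \<le> indicator {-\<rho>..\<rho>} t" for t
        using bd[of t] by (auto simp: b_def indicator_def ennreal_le_1)
      then show "ennreal (norm ((gauss_koopman c ^^ n) b t)) \<le> C n t" for t
        unfolding C_def by (rule norm_koopman_funpow)
    qed simp
    also have "\<dots> \<le> (\<integral>\<^sup>+t. ennreal (max 0 (W t - real k)) + ennreal (real k) * C n t \<partial>lborel)"
    proof (rule nn_integral_mono)
      fix t
      have "ennreal (W t) \<le> ennreal (max 0 (W t - real k)) + ennreal (real k)"
      proof -
        have "ennreal (W t) \<le> ennreal (max 0 (W t - real k) + real k)" by (rule ennreal_leI) linarith
        also have "\<dots> = ennreal (max 0 (W t - real k)) + ennreal (real k)" by (rule ennreal_plus) simp_all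
        finally show ?thesis .
      qed
      then have "ennreal (W t) * C n t \<le> (ennreal (max 0 (W t - real k)) + ennreal (real k)) * C n t"
        by (rule mult_right_mono) simp
      also have "\<dots> = ennreal (max 0 (W t - real k)) * C n t + ennreal (real k) * C n t" by (rule distrib_right)
      also have "\<dots> \<le> ennreal (max 0 (W t - real k)) * 1 + ennreal (real k) * C n t"
        by (rule add_right_mono, rule mult_left_mono[OF C1]) simp
      finally show "ennreal (W t) * C n t \<le> ennreal (max 0 (W t - real k)) + ennreal (real k) * C n t" by simp
    qed
    also have "\<dots> = (\<integral>\<^sup>+t. ennreal (max 0 (W t - real k)) \<partial>lborel) + ennreal (real k) * (\<integral>\<^sup>+t. C n t \<partial>lborel)"
      by (subst nn_integral_add) (auto simp: nn_integral_cmult)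
    also have "(\<integral>\<^sup>+t. ennreal (max 0 (W t - real k)) \<partial>lborel) = ennreal (\<integral>t. max 0 (W t - real k) \<partial>lborel)"
      by (rule nn_integral_eq_integral[OF ik]) auto
    also have "ennreal (\<integral>t. max 0 (W t - real k) \<partial>lborel) + ennreal (real k) * (\<integral>\<^sup>+t. C n t \<partial>lborel)
      \<le> ennreal (e / 2) + ennreal (real k) * ennreal (e / (2 * (real k + 1)))"
      using k n by (intro add_mono mult_left_mono ennreal_leI) auto
    also have "\<dots> = ennreal (e / 2 + real k * (e / (2 * (real k + 1))))"
      using e by (simp add: ennreal_mult[symmetric])
    also have "\<dots> \<le> ennreal e"
      using e by (intro ennreal_leI) (simp add: field_simps)
    finally show ?thesis using e by (simp add: ennreal_le_iff)
  qed
  then have "I \<le> 0" by (rule field_le_epsilon[of I 0, simplified])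
  then have I: "I = 0" using I0 by simp
  have "integrable lborel (\<lambda>t. norm (F t) * indicator {-\<rho>..\<rho>} t)"
    using integrable_mult_indicator[OF _ integrable_norm[OF iF], of "{-\<rho>..\<rho>}"] by (simp add: mult.commute)
  then have "AE t in lborel. norm (F t) * indicator {-\<rho>..\<rho>} t = 0"
    using I unfolding I_def by (subst (asm) integral_nonneg_eq_0_iff_AE) auto
  then show ?thesis by eventually_elim (auto simp: indicator_def)
qed

text \<open>The reflected density satisfies the same hypotheses, so it vanishes on
  \<open>(-1, 1)\<close> too; for \<open>F\<close> itself this means vanishing where
  \<open>\<bar>t\<bar> > c\<close>. As \<open>c \<le> 1\<close>, the two regions cover the line up
  to two points.\<close>

lemma char_annih_vanish:
  assumes c: "0 < c" "c \<le> 1" and F: "char_annih F" and G: "char_annih (reflect_density c F)"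
  shows "AE t in lborel. F t = 0"
proof -
  have unit: "AE t in lborel. \<bar>t\<bar> < 1 \<longrightarrow> F t = 0" if F: "char_annih F" and G: "char_annih (reflect_density c F)" for F
  proof -
    have "AE t in lborel. \<forall>n. t \<in> {- (1 - 1 / real (n + 2))..1 - 1 / real (n + 2)} \<longrightarrow> F t = 0"
      unfolding AE_all_countable
      by (intro allI char_annih_vanish_on_unit[OF c F G]) (auto simp: field_simps)
    then show ?thesis
    proof eventually_elim
      case (elim t)
      show ?case
      proof
        assume t: "\<bar>t\<bar> < 1"
        then obtain n :: nat where "real n > 1 / (1 - \<bar>t\<bar>)" using reals_Archimedean2 by blast
        then have "1 / (1 - \<bar>t\<bar>) < real (n + 2)" by simp
        then have "1 / real (n + 2) < 1 - \<bar>t\<bar>" using t by (simp add: field_simps)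
        then have "t \<in> {- (1 - 1 / real (n + 2))..1 - 1 / real (n + 2)}" by (auto simp: abs_le_iff)
        then show "F t = 0" using elim by blast
      qed
    qed
  qed
  have [measurable]: "F \<in> borel_measurable borel" using F by (auto simp: char_annih_def)
  define F' where "F' = reflect_density c F"
  have [measurable]: "F' \<in> borel_measurable borel" unfolding F'_def reflect_density_def by measurable
  have tw: "AE t in lborel. reflect_density c F' t = F t"
    using AE_lborel_singleton[of "0::real"] unfolding F'_def by eventually_elim (rule reflect_density_twice[OF c(1)])
  have m: "reflect_density c F' \<in> borel_measurable borel" unfolding reflect_density_def by measurable
  have F2: "char_annih (reflect_density c F')"
  proof -
    have "integrable lborel (reflect_density c F')"
    proof (rule integrable_cong_AE_imp)
      show "integrable lborel F" using F by (simp add: char_annih_def)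
    qed (use tw m in auto)
    moreover have "(\<integral>t. reflect_density c F' t * cis (pi * of_int j * t) \<partial>lborel) = (\<integral>t. F t * cis (pi * of_int j * t) \<partial>lborel)" for j :: int
      by (rule integral_cong_AE) (use tw m in auto)
    ultimately show ?thesis using F by (simp add: char_annih_def)
  qed
  have 1: "AE t in lborel. \<bar>t\<bar> < 1 \<longrightarrow> F t = 0" by (rule unit[OF F G])
  have 2: "AE t in lborel. \<bar>t\<bar> < 1 \<longrightarrow> F' t = 0" by (rule unit[OF G[folded F'_def] F2])
  have 3: "AE t in lborel. \<bar>c / t\<bar> < 1 \<longrightarrow> F t = 0"
  proof -
    have "(\<integral>\<^sup>+t. ennreal (norm (F t)) * indicator {t. \<bar>c / t\<bar> < 1} t \<partial>lborel)
       = (\<integral>\<^sup>+s. ennreal (c / s\<^sup>2) * (ennreal (norm (F (- (c / s)))) * indicator {t. \<bar>c / t\<bar> < 1} (- (c / s))) \<partial>lborel)"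
      using c(1) by (intro nn_integral_inversion[symmetric]) measurable
    also have "\<dots> = (\<integral>\<^sup>+s. ennreal (norm (F' s)) * indicator {s. \<bar>s\<bar> < 1} s \<partial>lborel)"
      using c(1) by (intro nn_integral_cong) (auto simp: F'_def reflect_density_def ennreal_mult[symmetric] indicator_def)
    also have "\<dots> = (\<integral>\<^sup>+s. 0 \<partial>(lborel::real measure))"
      using 2 by (intro nn_integral_cong_AE) (auto simp: indicator_def)
    finally have "(\<integral>\<^sup>+t. ennreal (norm (F t)) * indicator {t. \<bar>c / t\<bar> < 1} t \<partial>lborel) = 0" by simp
    then have "AE t in lborel. ennreal (norm (F t)) * indicator {t. \<bar>c / t\<bar> < 1} t = 0"
      by (subst (asm) nn_integral_0_iff_AE) auto
    then show ?thesis by eventually_elim (auto simp: indicator_def)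
  qed
  have "AE t in lborel. t \<noteq> (1::real)" "AE t in lborel. t \<noteq> (-1::real)"
    by (rule AE_lborel_singleton)+
  with 1 3 show ?thesis
  proof eventually_elim
    case (elim t)
    show ?case
    proof (cases "\<bar>t\<bar> < 1")
      case False
      then have "\<bar>t\<bar> > 1" using elim by auto
      then have "\<bar>c / t\<bar> < 1" using c by (simp add: field_simps)
      then show ?thesis using elim by blast
    qed (use elim in blast)
  qed
qed

text \<open>This is the theorem of Hedenmalm and Montes-Rodriguez on Heisenberg uniqueness pairs.\<close>

lemma L1_lattice_uniqueness:
  assumes c: "0 < c" "c \<le> 1" and F: "integrable lborel F"
    and 1: "\<And>j::int. (\<integral>t. F t * cis (pi * of_int j * t) \<partial>lborel) = 0"
    and 2: "\<And>j::int. (\<integral>t. F t * cis (- (pi * of_int j * c / t)) \<partial>lborel) = 0"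
  shows "AE t in lborel. F t = 0"
proof (rule char_annih_vanish[OF c])
  show "char_annih F" using F 1 by (simp add: char_annih_def)
  have [measurable]: "F \<in> borel_measurable borel" using F by auto
  show "char_annih (reflect_density c F)"
    unfolding char_annih_def
  proof (intro conjI allI)
    show "integrable lborel (reflect_density c F)"
      using integrable_inversion[OF c(1) F] by (simp add: reflect_density_def[abs_def])
    show "(\<integral>t. reflect_density c F t * cis (pi * of_int j * t) \<partial>lborel) = 0" for j :: int
      using integral_reflect_density'[OF c(1), of F "\<lambda>t. cis (pi * of_int j * t)"] 2[of j]
      by (simp add: mult.assoc)
  qed
qed

subsection \<open>Cauchy kernels\<close>

lemma integral_FTC_UNIV:
  fixes f F :: "real \<Rightarrow> 'a::euclidean_space"
  assumes "\<And>x. (F has_vector_derivative f x) (at x)" "\<And>x. isCont f x" "integrable lborel f"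
    and "(F \<longlongrightarrow> A) at_bot" "(F \<longlongrightarrow> B) at_top"
  shows "(\<integral>x. f x \<partial>lborel) = B - A"
proof -
  have "(LBINT x=-\<infinity>..\<infinity>. f x) = B - A"
    using assms by (intro interval_integral_FTC_integrable)
      (auto simp: ereal_tendsto_simps einterval_eq_UNIV set_integrable_def)
  then show ?thesis by (simp add: interval_lebesgue_integral_def einterval_eq_UNIV set_lebesgue_integral_def)
qed

lemma has_real_derivative_arctan_shift:
  fixes x y :: real
  assumes "y \<noteq> 0"
  shows "((\<lambda>t. arctan ((t - x) / y)) has_real_derivative y / ((t - x)\<^sup>2 + y\<^sup>2)) (at t)"
proof -
  define S where "S = (t - x)\<^sup>2 + y\<^sup>2"
  have S: "S > 0" using assms by (simp add: S_def add_nonneg_pos)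
  have e: "1 + ((t - x) / y)\<^sup>2 = S / y\<^sup>2" using assms by (simp add: S_def power_divide field_simps)
  have "((\<lambda>t. arctan ((t - x) / y)) has_real_derivative inverse (1 + ((t - x) / y)\<^sup>2) * (1 / y)) (at t)"
    by (auto intro!: derivative_eq_intros simp: divide_inverse)
  moreover have "inverse (1 + ((t - x) / y)\<^sup>2) * (1 / y) = y / S"
    unfolding e using assms S by (simp add: power2_eq_square)
  ultimately show ?thesis by (simp add: S_def)
qed

lemma integrable_inverse_quadratic:
  fixes x y :: real
  assumes y: "y \<noteq> 0"
  shows "integrable lborel (\<lambda>t. 1 / ((t - x)\<^sup>2 + y\<^sup>2))"
proof -
  have pos: "(t - x)\<^sup>2 + y\<^sup>2 > 0" for t using y by (simp add: add_nonneg_pos)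
  define b where "b = \<bar>y\<bar>"
  have b: "b > 0" "b\<^sup>2 = y\<^sup>2" using y by (auto simp: b_def)
  have der: "((\<lambda>t. arctan ((t - x) / b) / b) has_real_derivative 1 / ((t - x)\<^sup>2 + y\<^sup>2)) (at t)" for t
    using DERIV_cdivide[OF has_real_derivative_arctan_shift[of b x t], of b] b by simp
  have "set_integrable lborel (einterval (-\<infinity>) \<infinity>) (\<lambda>t. 1 / ((t - x)\<^sup>2 + y\<^sup>2))"
  proof (rule interval_integral_FTC_nonneg[where F="\<lambda>t. arctan ((t - x) / b) / b"])
    show "isCont (\<lambda>t. 1 / ((t - x)\<^sup>2 + y\<^sup>2)) t" for t
      using pos[of t] by (intro continuous_intros) auto
    show "AE t in lborel. -\<infinity> < ereal t \<longrightarrow> ereal t < \<infinity> \<longrightarrow> 0 \<le> 1 / ((t - x)\<^sup>2 + y\<^sup>2)"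
      by simp
    have 1: "filterlim (\<lambda>t. (t - x) / b) at_top at_top" using b(1) by real_asymp
    have 2: "filterlim (\<lambda>t. (t - x) / b) at_bot at_bot" using b(1) by real_asymp
    show "(((\<lambda>t. arctan ((t - x) / b) / b) \<circ> real_of_ereal) \<longlongrightarrow> - (pi / 2) / b) (at_right (-\<infinity>))"
      unfolding ereal_tendsto_simps by (intro tendsto_divide filterlim_compose[OF tendsto_arctan_at_bot 2] tendsto_const) (use b in auto)
    show "(((\<lambda>t. arctan ((t - x) / b) / b) \<circ> real_of_ereal) \<longlongrightarrow> (pi / 2) / b) (at_left \<infinity>)"
      unfolding ereal_tendsto_simps by (intro tendsto_divide filterlim_compose[OF tendsto_arctan_at_top 1] tendsto_const) (use b in auto)
  qed (use der in auto)
  then show ?thesis by (simp add: einterval_eq_UNIV set_integrable_def)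
qed

definition cauchy_kernel :: "complex \<Rightarrow> real \<Rightarrow> complex" where
  "cauchy_kernel z t = 1 / (complex_of_real t - z)"

lemma cauchy_denom_nonzero: "Im z \<noteq> 0 \<Longrightarrow> complex_of_real t - z \<noteq> 0"
  by (auto simp: complex_eq_iff)

lemma cauchy_kernel_measurable [measurable]: "cauchy_kernel z \<in> borel_measurable borel"
  unfolding cauchy_kernel_def by measurable

lemma norm_cauchy_kernel_square:
  "(norm (cauchy_kernel z t))\<^sup>2 = 1 / ((t - Re z)\<^sup>2 + (Im z)\<^sup>2)"
  by (simp add: cauchy_kernel_def norm_divide power_divide cmod_power2)

lemma integrable_norm_cauchy_kernel_square:
  "Im z \<noteq> 0 \<Longrightarrow> integrable lborel (\<lambda>t. (norm (cauchy_kernel z t))\<^sup>2)"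
  unfolding norm_cauchy_kernel_square by (rule integrable_inverse_quadratic)

lemma integrable_cauchy_kernel_mult:
  assumes "Im z \<noteq> 0" "Im w \<noteq> 0"
  shows "integrable lborel (\<lambda>t. cauchy_kernel z t * cauchy_kernel w t)"
proof (rule Bochner_Integration.integrable_bound)
  show "integrable lborel (\<lambda>t. (norm (cauchy_kernel z t))\<^sup>2 + (norm (cauchy_kernel w t))\<^sup>2)"
    using assms by (intro Bochner_Integration.integrable_add integrable_norm_cauchy_kernel_square)
  show "AE t in lborel. norm (cauchy_kernel z t * cauchy_kernel w t)
      \<le> norm ((norm (cauchy_kernel z t))\<^sup>2 + (norm (cauchy_kernel w t))\<^sup>2)"
  proof (rule AE_I2)
    fix t
    have "2 * norm (cauchy_kernel z t) * norm (cauchy_kernel w t) \<le> (norm (cauchy_kernel z t))\<^sup>2 + (norm (cauchy_kernel w t))\<^sup>2"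
      by (rule sum_squares_bound)
    moreover have "0 \<le> norm (cauchy_kernel z t) * norm (cauchy_kernel w t)" by simp
    ultimately have "norm (cauchy_kernel z t) * norm (cauchy_kernel w t) \<le> (norm (cauchy_kernel z t))\<^sup>2 + (norm (cauchy_kernel w t))\<^sup>2"
      by linarith
    then show "norm (cauchy_kernel z t * cauchy_kernel w t) \<le> norm ((norm (cauchy_kernel z t))\<^sup>2 + (norm (cauchy_kernel w t))\<^sup>2)"
      by (simp add: norm_mult)
  qed
qed measurable

lemma cauchy_kernel_diff:
  assumes "Im z \<noteq> 0" "Im w \<noteq> 0"
  shows "cauchy_kernel z t - cauchy_kernel w t = (z - w) * (cauchy_kernel z t * cauchy_kernel w t)"
  using cauchy_denom_nonzero[OF assms(1), of t] cauchy_denom_nonzero[OF assms(2), of t]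
  by (simp add: cauchy_kernel_def divide_simps)

lemma integrable_cauchy_kernel_diff:
  assumes "Im z \<noteq> 0" "Im w \<noteq> 0"
  shows "integrable lborel (\<lambda>t. cauchy_kernel z t - cauchy_kernel w t)"
  unfolding cauchy_kernel_diff[OF assms]
  by (intro integrable_mult_right integrable_cauchy_kernel_mult assms)

lemma continuous_cauchy_kernel: "Im z \<noteq> 0 \<Longrightarrow> isCont (cauchy_kernel z) t"
  unfolding cauchy_kernel_def by (intro continuous_intros) (auto simp: complex_eq_iff)

text \<open>\<open>P z\<close> is a logarithm of \<open>t - z\<close> up to a constant, with the
  argument written as an arctangent so that it is smooth along the whole line. In the difference the
  logarithms of the moduli cancel at both ends, and each arctangent increases by
  \<open>pi * sgn (Im z)\<close>. The formula plays the part of the residue theorem below; only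
  differences are integrable.\<close>

lemma integral_cauchy_kernel_diff:
  assumes z: "Im z \<noteq> 0" and w: "Im w \<noteq> 0"
  shows "(\<integral>t. cauchy_kernel z t - cauchy_kernel w t \<partial>lborel) = \<i> * complex_of_real (pi * (sgn (Im z) - sgn (Im w)))"
proof -
  define P where "P z t = complex_of_real (ln ((t - Re z)\<^sup>2 + (Im z)\<^sup>2) / 2) + \<i> * complex_of_real (arctan ((t - Re z) / Im z))" for z t
  have der: "(P z has_vector_derivative cauchy_kernel z t) (at t)" if z: "Im z \<noteq> 0" for z t
  proof -
    define x y where "x = Re z" and "y = Im z"
    have y: "y \<noteq> 0" using z by (simp add: y_def)
    have pos: "(t - x)\<^sup>2 + y\<^sup>2 > 0" using y by (simp add: add_nonneg_pos)
    have 1: "((\<lambda>t. ln ((t - x)\<^sup>2 + y\<^sup>2) / 2) has_real_derivative (t - x) / ((t - x)\<^sup>2 + y\<^sup>2)) (at t)"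
    proof -
      have "((\<lambda>t. ln ((t - x)\<^sup>2 + y\<^sup>2) / 2) has_real_derivative 1 / ((t - x)\<^sup>2 + y\<^sup>2) * (2 * (t - x)) / 2) (at t)"
      proof (rule DERIV_cdivide, rule DERIV_chain2[where f=ln and g="\<lambda>t. (t - x)\<^sup>2 + y\<^sup>2"])
        show "(ln has_real_derivative 1 / ((t - x)\<^sup>2 + y\<^sup>2)) (at ((t - x)\<^sup>2 + y\<^sup>2))"
          by (rule DERIV_ln_divide[OF pos])
        show "((\<lambda>t. (t - x)\<^sup>2 + y\<^sup>2) has_real_derivative 2 * (t - x)) (at t)"
          by (auto intro!: derivative_eq_intros)
      qed
      moreover have "1 / S * (2 * (t - x)) / 2 = (t - x) / S" for S by (cases "S = 0") (simp_all add: field_simps)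
      ultimately show ?thesis by metis
    qed
    have 2: "((\<lambda>t. arctan ((t - x) / y)) has_real_derivative y / ((t - x)\<^sup>2 + y\<^sup>2)) (at t)"
      by (rule has_real_derivative_arctan_shift[OF y])
    have "cauchy_kernel z t = complex_of_real ((t - x) / ((t - x)\<^sup>2 + y\<^sup>2)) + \<i> * complex_of_real (y / ((t - x)\<^sup>2 + y\<^sup>2))"
      using pos unfolding x_def y_def
      by (simp add: cauchy_kernel_def complex_eq_iff Re_divide Im_divide)
        (simp add: power2_eq_square[of "(t - Re z)\<^sup>2 + (Im z)\<^sup>2"])
    moreover have "(P z has_vector_derivative complex_of_real ((t - x) / ((t - x)\<^sup>2 + y\<^sup>2)) + \<i> * complex_of_real (y / ((t - x)\<^sup>2 + y\<^sup>2))) (at t)"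
      unfolding P_def x_def[symmetric] y_def[symmetric]
      by (intro has_vector_derivative_add has_vector_derivative_mult_right has_vector_derivative_of_real 1 2)
    ultimately show ?thesis by simp
  qed
  have split: "P z t - P w t = complex_of_real ((ln ((t - Re z)\<^sup>2 + (Im z)\<^sup>2) - ln ((t - Re w)\<^sup>2 + (Im w)\<^sup>2)) / 2)
     + \<i> * complex_of_real (arctan ((t - Re z) / Im z) - arctan ((t - Re w) / Im w))" for t
    by (simp add: P_def complex_eq_iff diff_divide_distrib)
  have lnlim: "((\<lambda>t. (ln ((t - x)\<^sup>2 + y\<^sup>2) - ln ((t - x')\<^sup>2 + y'\<^sup>2)) / 2) \<longlongrightarrow> 0) at_top"
     "((\<lambda>t. (ln ((t - x)\<^sup>2 + y\<^sup>2) - ln ((t - x')\<^sup>2 + y'\<^sup>2)) / 2) \<longlongrightarrow> 0) at_bot" for x y x' y' :: real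
    by real_asymp+
  have at: "((\<lambda>t. arctan ((t - x) / y)) \<longlongrightarrow> sgn y * (pi / 2)) at_top"
     "((\<lambda>t. arctan ((t - x) / y)) \<longlongrightarrow> - (sgn y * (pi / 2))) at_bot" if "y \<noteq> 0" for x y :: real
  proof -
    show "((\<lambda>t. arctan ((t - x) / y)) \<longlongrightarrow> sgn y * (pi / 2)) at_top"
    proof (cases "y > 0")
      case True
      then have "filterlim (\<lambda>t. (t - x) / y) at_top at_top" by real_asymp
      then show ?thesis using filterlim_compose[OF tendsto_arctan_at_top] True by fastforce
    next
      case False
      then have "y < 0" using that by simp
      then have "filterlim (\<lambda>t. (t - x) / y) at_bot at_top" by real_asymp
      then show ?thesis using filterlim_compose[OF tendsto_arctan_at_bot] \<open>y < 0\<close> by fastforce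
    qed
    show "((\<lambda>t. arctan ((t - x) / y)) \<longlongrightarrow> - (sgn y * (pi / 2))) at_bot"
    proof (cases "y > 0")
      case True
      then have "filterlim (\<lambda>t. (t - x) / y) at_bot at_bot" by real_asymp
      then show ?thesis using filterlim_compose[OF tendsto_arctan_at_bot] True by fastforce
    next
      case False
      then have "y < 0" using that by simp
      then have "filterlim (\<lambda>t. (t - x) / y) at_top at_bot" by real_asymp
      then show ?thesis using filterlim_compose[OF tendsto_arctan_at_top] \<open>y < 0\<close> by fastforce
    qed
  qed
  have "(\<integral>t. cauchy_kernel z t - cauchy_kernel w t \<partial>lborel)
     = (complex_of_real 0 + \<i> * complex_of_real (sgn (Im z) * (pi / 2) - sgn (Im w) * (pi / 2)))
     - (complex_of_real 0 + \<i> * complex_of_real (- (sgn (Im z) * (pi / 2)) - - (sgn (Im w) * (pi / 2))))"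
  proof (rule integral_FTC_UNIV)
    show "((\<lambda>t. P z t - P w t) has_vector_derivative cauchy_kernel z t - cauchy_kernel w t) (at t)" for t
      by (intro has_vector_derivative_diff der z w)
    show "isCont (\<lambda>t. cauchy_kernel z t - cauchy_kernel w t) t" for t
      by (intro continuous_intros continuous_cauchy_kernel z w)
    show "integrable lborel (\<lambda>t. cauchy_kernel z t - cauchy_kernel w t)"
      by (rule integrable_cauchy_kernel_diff[OF z w])
    show "((\<lambda>t. P z t - P w t) \<longlongrightarrow> complex_of_real 0 + \<i> * complex_of_real (- (sgn (Im z) * (pi / 2)) - - (sgn (Im w) * (pi / 2)))) at_bot"
      unfolding split by (intro tendsto_intros lnlim at z w)
    show "((\<lambda>t. P z t - P w t) \<longlongrightarrow> complex_of_real 0 + \<i> * complex_of_real (sgn (Im z) * (pi / 2) - sgn (Im w) * (pi / 2))) at_top"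
      unfolding split by (intro tendsto_intros lnlim at z w)
  qed
  also have "\<dots> = \<i> * complex_of_real (pi * (sgn (Im z) - sgn (Im w)))"
    by (simp add: complex_eq_iff algebra_simps)
  finally show ?thesis .
qed

section \<open>Resolvents as Cauchy kernels, and their products\<close>

lemma resolvent_eq_cauchy_kernel:
  assumes "a \<noteq> 0"
  shows "resolvent a t = (\<i> / complex_of_real a) * cauchy_kernel (- \<i> / complex_of_real a) t"
proof -
  have "complex_of_real t - - \<i> / complex_of_real a \<noteq> 0"
    using assms by (intro cauchy_denom_nonzero) (simp add: Im_divide)
  then show ?thesis
    using assms resolvent_denom_nonzero[of "a * t"]
    by (simp add: resolvent_def cauchy_kernel_def divide_simps) (simp add: algebra_simps)
qed

lemma Im_resolvent_pole: "Im (- \<i> / complex_of_real a) = - 1 / a"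
  by (simp add: Im_divide power2_eq_square)

lemma integrable_resolvent_mult:
  assumes "a > 0" "b > 0"
  shows "integrable lborel (\<lambda>t. resolvent a t * resolvent b t)"
proof -
  have "resolvent a t * resolvent b t = ((\<i> / complex_of_real a) * (\<i> / complex_of_real b))
     * (cauchy_kernel (- \<i> / complex_of_real a) t * cauchy_kernel (- \<i> / complex_of_real b) t)" for t
  proof -
    have a: "a \<noteq> 0" and b: "b \<noteq> 0" using assms by auto
    show ?thesis by (simp only: resolvent_eq_cauchy_kernel[OF a] resolvent_eq_cauchy_kernel[OF b] mult_ac)
  qed
  moreover have "integrable lborel (\<lambda>t. cauchy_kernel (- \<i> / complex_of_real a) t * cauchy_kernel (- \<i> / complex_of_real b) t)"
    using assms by (intro integrable_cauchy_kernel_mult) (simp_all add: Im_divide)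
  ultimately show ?thesis by (simp only: integrable_mult_right)
qed

lemma integral_resolvent_mult:
  assumes ab: "a > 0" "b > 0" "a \<noteq> b"
  shows "(\<integral>t. resolvent a t * resolvent b t \<partial>lborel) = 0"
proof -
  have "resolvent a t * resolvent b t = (\<i> / complex_of_real (a - b)) *
      (cauchy_kernel (- \<i> / complex_of_real a) t - cauchy_kernel (- \<i> / complex_of_real b) t)" for t
  proof -
    have "complex_of_real c * resolvent c t = \<i> * cauchy_kernel (- \<i> / complex_of_real c) t" if "c > 0" for c
      using that by (simp add: resolvent_eq_cauchy_kernel)
    then show ?thesis
      unfolding resolvent_identity[OF ab(3)] using ab by (simp add: right_diff_distrib diff_divide_distrib)
  qed
  moreover have "(\<integral>t. cauchy_kernel (- \<i> / complex_of_real a) t - cauchy_kernel (- \<i> / complex_of_real b) t \<partial>lborel) = 0"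
  proof -
    have s: "sgn (Im (- \<i> / complex_of_real c)) = -1" and n: "Im (- \<i> / complex_of_real c) \<noteq> 0" if "c > 0" for c
      unfolding Im_resolvent_pole using that by simp_all
    show ?thesis
      unfolding integral_cauchy_kernel_diff[OF n[OF ab(1)] n[OF ab(2)]] s[OF ab(1)] s[OF ab(2)] by simp
  qed
  ultimately show ?thesis by simp
qed

text \<open>A double pole is the limit of two simple ones. The parameter is perturbed upwards, since
  the modulus of \<open>resolvent a t\<close> decreases in \<open>a\<close>; the integrand at
  \<open>a\<close> itself is then a majorant.\<close>

lemma integral_resolvent_mult_limit:
  assumes a: "a > 0" and b: "b > 0"
  shows "(\<integral>t. resolvent a t * resolvent b t \<partial>lborel) = 0"
proof (cases "a = b")
  case True
  define c where "c = (\<lambda>n. a + 1 / real (Suc n))"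
  have lim0: "(\<lambda>n. 1 / real (Suc n)) \<longlonglongrightarrow> 0" by (rule LIMSEQ_Suc[OF lim_const_over_n])
  have lim: "c \<longlonglongrightarrow> a" unfolding c_def using tendsto_add[OF tendsto_const[of a] lim0] by simp
  have ca: "a \<le> c n" "c n \<noteq> b" "c n > 0" for n using a True by (auto simp: c_def add_pos_pos)
  have "(\<lambda>n. \<integral>t. resolvent (c n) t * resolvent b t \<partial>lborel) \<longlonglongrightarrow> (\<integral>t. resolvent a t * resolvent b t \<partial>lborel)"
  proof (rule integral_dominated_convergence[where w="\<lambda>t. norm (resolvent a t * resolvent b t)"])
    show "AE t in lborel. (\<lambda>n. resolvent (c n) t * resolvent b t) \<longlonglongrightarrow> resolvent a t * resolvent b t"
      using resolvent_continuous_arg lim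
      by (intro AE_I2 tendsto_intros isCont_tendsto_compose[where g="\<lambda>a. resolvent a _"]) (auto simp: continuous_on_eq_continuous_at)
    show "AE t in lborel. norm (resolvent (c n) t * resolvent b t) \<le> norm (resolvent a t * resolvent b t)" for n
    proof (rule AE_I2)
      fix t
      have "norm (1 - \<i> * complex_of_real (a * t)) \<le> norm (1 - \<i> * complex_of_real (c n * t))"
      proof -
        have "(a * t)\<^sup>2 \<le> (c n * t)\<^sup>2"
          using ca(1)[of n] a by (simp add: power_mult_distrib mult_right_mono power_mono)
        then show ?thesis by (simp add: cmod_def)
      qed
      then have "norm (resolvent (c n) t) \<le> norm (resolvent a t)"
        using resolvent_denom_nonzero[of "a * t"] unfolding resolvent_def norm_divide
        by (intro divide_left_mono mult_pos_pos) (auto simp: resolvent_denom_nonzero simp del: of_real_mult)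
      then show "norm (resolvent (c n) t * resolvent b t) \<le> norm (resolvent a t * resolvent b t)"
        unfolding norm_mult by (rule mult_right_mono) simp
    qed
  qed (use integrable_resolvent_mult[OF a b] in auto)
  moreover have "(\<integral>t. resolvent (c n) t * resolvent b t \<partial>lborel) = 0" for n
    using ca[of n] b by (intro integral_resolvent_mult) auto
  ultimately show ?thesis by (simp add: LIMSEQ_const_iff)
qed (use integral_resolvent_mult a b in auto)

text \<open>One kernel decays too slowly to be integrable, so products of two are the simplest
  explicit members of \<open>hardy\<close>; they are the remainders in the point evaluations
  below.\<close>

lemma hardy_resolvent_mult:
  assumes a: "a > 0" and b: "b > 0"
  shows "hardy (\<lambda>t. resolvent a t * resolvent b t)"
proof (rule hardyI_resolvent_limit)
  show "integrable lborel (\<lambda>t. resolvent a t * resolvent b t)" by (rule integrable_resolvent_mult[OF a b])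
  show "(\<integral>t. resolvent a t * resolvent b t \<partial>lborel) = 0" by (rule integral_resolvent_mult_limit[OF a b])
  fix c :: real assume c: "c > 0" "c \<noteq> b"
  have "resolvent a t * resolvent b t * resolvent c t
     = (complex_of_real b / complex_of_real (b - c)) * (resolvent a t * resolvent b t)
     - (complex_of_real c / complex_of_real (b - c)) * (resolvent a t * resolvent c t)" for t
  proof -
    have "resolvent a t * resolvent b t * resolvent c t = resolvent a t * (resolvent b t * resolvent c t)" by (simp add: mult_ac)
    also have "\<dots> = resolvent a t * ((complex_of_real b * resolvent b t - complex_of_real c * resolvent c t) / complex_of_real (b - c))"
      using c by (subst resolvent_identity) auto
    finally show ?thesis by (simp add: right_diff_distrib diff_divide_distrib mult_ac del: of_real_diff)
  qed
  then show "(\<integral>t. resolvent a t * resolvent b t * resolvent c t \<partial>lborel) = 0"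
    using integrable_resolvent_mult[OF a b] integrable_resolvent_mult[OF a c(1)]
      integral_resolvent_mult_limit[OF a b] integral_resolvent_mult_limit[OF a c(1)] by simp
qed

text \<open>By \<open>resolvent_diff\<close> the integrand is, up to the factor
  \<open>2 * \<i> * a\<close>, the symmetric difference quotient of the resolvent. The integral
  therefore computes the Hilbert transform of a resolvent in closed form. Partial fractions in
  \<open>u\<close> leave one pole in each half-plane.\<close>

lemma integral_resolvent_reflected:
  assumes a: "a > 0"
  shows "((\<integral>u. resolvent a (t + u) * resolvent a (t - u) \<partial>lborel)
    = complex_of_real (pi / a) * resolvent a t)"
proof -
  define A where "A = 1 - \<i> * complex_of_real (a * t)"
  have A: "A \<noteq> 0" unfolding A_def by (rule resolvent_denom_nonzero)
  define w1 where "w1 = - \<i> / complex_of_real a - complex_of_real t"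
  define w2 where "w2 = complex_of_real t + \<i> / complex_of_real a"
  have Im: "Im w1 = - 1 / a" "Im w2 = 1 / a" by (simp_all add: w1_def w2_def Im_divide power2_eq_square)
  have "resolvent a (t + u) * resolvent a (t - u) = (\<i> / (2 * complex_of_real a * A)) * (cauchy_kernel w1 u - cauchy_kernel w2 u)" for u
  proof -
    have n1: "1 - \<i> * complex_of_real (a * (t + u)) \<noteq> 0" and n2: "1 - \<i> * complex_of_real (a * (t - u)) \<noteq> 0"
      by (rule resolvent_denom_nonzero)+
    have c1: "cauchy_kernel w1 u = - \<i> * complex_of_real a * resolvent a (t + u)"
    proof -
      have "complex_of_real u - w1 = (1 - \<i> * complex_of_real (a * (t + u))) * (\<i> / complex_of_real a)"
        using a by (simp add: w1_def field_simps)
      then show ?thesis using a unfolding cauchy_kernel_def resolvent_def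
        by (simp only:) (simp add: divide_simps del: of_real_mult)
    qed
    have c2: "cauchy_kernel w2 u = \<i> * complex_of_real a * resolvent a (t - u)"
    proof -
      have "complex_of_real u - w2 = (1 - \<i> * complex_of_real (a * (t - u))) * (- \<i> / complex_of_real a)"
        using a by (simp add: w2_def field_simps)
      then show ?thesis using a unfolding cauchy_kernel_def resolvent_def
        by (simp only:) (simp add: divide_simps del: of_real_mult)
    qed
    have "resolvent a (t + u) + resolvent a (t - u) = 2 * A * (resolvent a (t + u) * resolvent a (t - u))"
      using n1 n2 by (simp add: resolvent_def A_def divide_simps) (simp add: algebra_simps)
    then have "resolvent a (t + u) * resolvent a (t - u) = (resolvent a (t + u) + resolvent a (t - u)) / (2 * A)"
      using A by simp
    also have "\<dots> = (\<i> / (2 * complex_of_real a * A)) * (cauchy_kernel w1 u - cauchy_kernel w2 u)"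
      unfolding c1 c2 using a A by (simp add: field_simps)
    finally show ?thesis .
  qed
  then have "(\<integral>u. resolvent a (t + u) * resolvent a (t - u) \<partial>lborel)
     = (\<i> / (2 * complex_of_real a * A)) * (\<integral>u. cauchy_kernel w1 u - cauchy_kernel w2 u \<partial>lborel)"
    by simp
  also have "(\<integral>u. cauchy_kernel w1 u - cauchy_kernel w2 u \<partial>lborel) = \<i> * complex_of_real (pi * (- 2))"
    using a Im by (subst integral_cauchy_kernel_diff) (auto simp: sgn_if)
  also have "(\<i> / (2 * complex_of_real a * A)) * (\<i> * complex_of_real (pi * (- 2))) = complex_of_real (pi / a) * resolvent a t"
  proof -
    have "resolvent a t = 1 / A" by (simp add: resolvent_def A_def)
    then show ?thesis using a A by (simp add: field_simps)
  qed
  finally show ?thesis .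
qed

lemma resolvent_diff:
  "resolvent a x - resolvent a y = \<i> * complex_of_real (a * (x - y)) * (resolvent a x * resolvent a y)"
  using resolvent_denom_nonzero[of "a * x"] resolvent_denom_nonzero[of "a * y"]
  unfolding resolvent_def by (simp add: divide_simps) (simp add: algebra_simps)

subsection \<open>Test functions\<close>

definition smooth :: "(real \<Rightarrow> complex) \<Rightarrow> bool" where
  "smooth f \<longleftrightarrow> (\<exists>D :: nat \<Rightarrow> real \<Rightarrow> complex. D 0 = f \<and>
        (\<forall>k x. (D k has_vector_derivative D (Suc k) x) (at x)))"

lemma test_function_iff: "test_function \<phi> \<longleftrightarrow> smooth \<phi> \<and> compact (closure {x. \<phi> x \<noteq> 0})"
  by (simp add: test_function_def smooth_def)

lemma smooth_continuous: "smooth f \<Longrightarrow> continuous_on UNIV f"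
  unfolding smooth_def
  by (metis continuous_at_imp_continuous_on has_vector_derivative_continuous)

lemma smooth_affine:
  assumes "smooth f"
  shows "smooth (\<lambda>x. f (c * x + d))"
proof -
  obtain D where D: "D 0 = f" "\<And>k x. (D k has_vector_derivative D (Suc k) x) (at x)"
    using assms by (auto simp: smooth_def)
  define E where "E k x = (c ^ k) *\<^sub>R D k (c * x + d)" for k x
  have "E 0 = (\<lambda>x. f (c * x + d))" by (simp add: E_def D fun_eq_iff)
  moreover have "(E k has_vector_derivative E (Suc k) x) (at x)" for k x
  proof -
    have "((\<lambda>x. c * x + d) has_vector_derivative c) (at x)"
      by (auto intro!: derivative_eq_intros simp: has_real_derivative_iff_has_vector_derivative[symmetric])
    from vector_diff_chain_at[OF this D(2)[of k "c * x + d"]]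
    have "((\<lambda>x. D k (c * x + d)) has_vector_derivative c *\<^sub>R D (Suc k) (c * x + d)) (at x)"
      by (simp add: o_def)
    from has_vector_derivative_scaleR[OF DERIV_const[of "c ^ k"] this]
    show ?thesis by (simp add: E_def[abs_def] mult.commute)
  qed
  ultimately show ?thesis unfolding smooth_def by blast
qed

lemma smooth_mult:
  assumes "smooth f" "smooth g"
  shows "smooth (\<lambda>x. f x * g x)"
proof -
  obtain D where D: "D 0 = f" "\<And>k x. (D k has_vector_derivative D (Suc k) x) (at x)"
    using assms by (auto simp: smooth_def)
  obtain E where E: "E 0 = g" "\<And>k x. (E k has_vector_derivative E (Suc k) x) (at x)"
    using assms by (auto simp: smooth_def)
  \<comment> \<open>Leibniz' formula for all derivatives of the product; passing from
    \<open>k\<close> to \<open>Suc k\<close> is Pascal's rule.\<close>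
  define P where "P k x = (\<Sum>i\<le>k. of_nat (k choose i) * (D i x * E (k - i) x))" for k x
  have "P 0 = (\<lambda>x. f x * g x)" by (simp add: P_def D E fun_eq_iff)
  moreover have "(P k has_vector_derivative P (Suc k) x) (at x)" for k x
  proof -
    have der: "((\<lambda>x. of_nat (k choose i) * (D i x * E (k - i) x)) has_vector_derivative
        of_nat (k choose i) * (D i x * E (Suc (k - i)) x + D (Suc i) x * E (k - i) x)) (at x)" for i
      by (intro has_vector_derivative_mult_right has_vector_derivative_mult D E)
    have "(P k has_vector_derivative (\<Sum>i\<le>k. of_nat (k choose i) * (D i x * E (Suc (k - i)) x + D (Suc i) x * E (k - i) x))) (at x)"
      unfolding P_def by (intro has_vector_derivative_sum der)
    also have "(\<Sum>i\<le>k. of_nat (k choose i) * (D i x * E (Suc (k - i)) x + D (Suc i) x * E (k - i) x))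
       = (\<Sum>i\<le>k. of_nat (k choose i) * (D i x * E (Suc k - i) x)) + (\<Sum>i\<le>k. of_nat (k choose i) * (D (Suc i) x * E (Suc k - Suc i) x))"
      by (simp add: distrib_left sum.distrib Suc_diff_le)
    also have "(\<Sum>i\<le>k. of_nat (k choose i) * (D i x * E (Suc k - i) x)) = (\<Sum>i\<le>Suc k. of_nat (k choose i) * (D i x * E (Suc k - i) x))"
      by simp
    also have "\<dots> = D 0 x * E (Suc k) x + (\<Sum>i\<le>k. of_nat (k choose Suc i) * (D (Suc i) x * E (Suc k - Suc i) x))"
      by (subst sum.atMost_Suc_shift) simp
    also have "D 0 x * E (Suc k) x + (\<Sum>i\<le>k. of_nat (k choose Suc i) * (D (Suc i) x * E (Suc k - Suc i) x))
        + (\<Sum>i\<le>k. of_nat (k choose i) * (D (Suc i) x * E (Suc k - Suc i) x))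
      = D 0 x * E (Suc k) x + (\<Sum>i\<le>k. of_nat (Suc k choose Suc i) * (D (Suc i) x * E (Suc k - Suc i) x))"
      by (simp add: sum.distrib[symmetric] distrib_right add.assoc add.commute)
    also have "\<dots> = P (Suc k) x"
      unfolding P_def by (subst sum.atMost_Suc_shift) simp
    finally show ?thesis .
  qed
  ultimately show ?thesis unfolding smooth_def by blast
qed

lemma smooth_resolvent: "smooth (resolvent a)"
proof -
  define D where "D k t = fact k * (\<i> * complex_of_real a) ^ k * resolvent a t ^ Suc k" for k t
  have "D 0 = resolvent a" by (simp add: D_def fun_eq_iff)
  moreover have "(D k has_vector_derivative D (Suc k) x) (at x)" for k x
  proof -
    have n: "\<i> * complex_of_real a * complex_of_real x \<noteq> 1"
      using resolvent_denom_nonzero[of "a * x"] by (auto simp: mult.assoc)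
    have "((\<lambda>z. fact k * (\<i> * complex_of_real a) ^ k * (1 / (1 - \<i> * complex_of_real a * z)) ^ Suc k) has_field_derivative
        fact k * (\<i> * complex_of_real a) ^ k * (of_nat (Suc k) * (1 / (1 - \<i> * complex_of_real a * complex_of_real x)) ^ k * ((\<i> * complex_of_real a) / (1 - \<i> * complex_of_real a * complex_of_real x)\<^sup>2))) (at (complex_of_real x))"
    proof (intro DERIV_cmult DERIV_power_Suc[THEN DERIV_cong])
      show "((\<lambda>z. 1 / (1 - \<i> * complex_of_real a * z)) has_field_derivative ((\<i> * complex_of_real a) / (1 - \<i> * complex_of_real a * complex_of_real x)\<^sup>2)) (at (complex_of_real x))"
        using n by (auto intro!: derivative_eq_intros simp: power2_eq_square)
    qed (simp add: algebra_simps add_divide_distrib)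
    then have "((\<lambda>t. fact k * (\<i> * complex_of_real a) ^ k * (1 / (1 - \<i> * complex_of_real a * complex_of_real t)) ^ Suc k) has_vector_derivative
        fact k * (\<i> * complex_of_real a) ^ k * (of_nat (Suc k) * (1 / (1 - \<i> * complex_of_real a * complex_of_real x)) ^ k * ((\<i> * complex_of_real a) / (1 - \<i> * complex_of_real a * complex_of_real x)\<^sup>2))) (at x)"
      by (rule has_vector_derivative_real_field)
    moreover have "(\<lambda>t. fact k * (\<i> * complex_of_real a) ^ k * (1 / (1 - \<i> * complex_of_real a * complex_of_real t)) ^ Suc k) = D k"
      by (simp add: D_def resolvent_def fun_eq_iff mult.assoc)
    moreover have "fact k * (\<i> * complex_of_real a) ^ k * (of_nat (Suc k) * (1 / (1 - \<i> * complex_of_real a * complex_of_real x)) ^ k * ((\<i> * complex_of_real a) / (1 - \<i> * complex_of_real a * complex_of_real x)\<^sup>2)) = D (Suc k) x"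
    proof -
      have r: "1 / (1 - \<i> * complex_of_real a * complex_of_real x) = resolvent a x"
        by (simp add: resolvent_def mult.assoc)
      have r2: "(\<i> * complex_of_real a) / (1 - \<i> * complex_of_real a * complex_of_real x)\<^sup>2 = (\<i> * complex_of_real a) * (resolvent a x)\<^sup>2"
        unfolding r[symmetric] by (simp add: power_divide)
      show ?thesis
        unfolding r2 r D_def unfolding fact_Suc power_Suc power2_eq_square of_nat_mult by (simp only: mult_ac)
    qed
    ultimately show ?thesis by simp
  qed
  ultimately show ?thesis unfolding smooth_def by blast
qed

text \<open>The \<open>k\<close>-th derivative of \<open>exp (- 1 / t)\<close> is \<open>P\<^sub>k (1 / t) exp (- 1 / t)\<close> with polynomials \<open>P\<^sub>k\<close>.\<close>

fun bump_poly :: "nat \<Rightarrow> real poly" where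
  "bump_poly 0 = 1"
| "bump_poly (Suc k) = [:0, 0, 1:] * (bump_poly k - pderiv (bump_poly k))"

definition half_bump_deriv :: "nat \<Rightarrow> real \<Rightarrow> real" where
  "half_bump_deriv k t = (if t > 0 then poly (bump_poly k) (1 / t) * exp (- (1 / t)) else 0)"

definition half_bump :: "real \<Rightarrow> real" where
  "half_bump t = (if t > 0 then exp (- (1 / t)) else 0)"

lemma half_bump_deriv_0: "half_bump_deriv 0 = half_bump"
  by (simp add: half_bump_deriv_def half_bump_def fun_eq_iff)

lemma poly_exp_tendsto_0: "((\<lambda>x. poly p x * exp (- x)) \<longlongrightarrow> (0::real)) at_top"
proof (induction p)
  case (pCons a p)
  have "((\<lambda>x. poly p x * x * exp (- x)) \<longlongrightarrow> 0) at_top"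
  proof -
    have 1: "((\<lambda>x. poly q x * exp (- x)) \<longlongrightarrow> (0::real)) at_top" for q :: "real poly"
    proof -
      have "((\<lambda>x. \<Sum>i\<le>degree q. coeff q i * (x ^ i / exp x)) \<longlongrightarrow> (\<Sum>i\<le>degree q. coeff q i * 0)) at_top"
        by (intro tendsto_intros tendsto_power_div_exp_0)
      then show ?thesis by (simp add: poly_altdef sum_distrib_right sum_divide_distrib exp_minus divide_inverse mult.assoc)
    qed
    show ?thesis using 1[of "p * [:0, 1:]"] by (simp add: mult.commute)
  qed
  moreover have "((\<lambda>x. a * exp (- x)) \<longlongrightarrow> 0) at_top"
    by (intro tendsto_mult_right_zero filterlim_compose[OF exp_at_bot filterlim_uminus_at_bot_at_top])
  ultimately have "((\<lambda>x. a * exp (- x) + poly p x * x * exp (- x)) \<longlongrightarrow> 0 + 0) at_top"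
    by (intro tendsto_add)
  then show ?case by (simp add: algebra_simps)
qed simp

lemma half_bump_deriv_has_derivative:
  "(half_bump_deriv k has_real_derivative half_bump_deriv (Suc k) t) (at t)"
proof -
  consider "t > 0" | "t < 0" | "t = 0" by linarith
  then show ?thesis
  proof cases
    case 1
    have "((\<lambda>t. poly (bump_poly k) (1 / t) * exp (- (1 / t))) has_real_derivative half_bump_deriv (Suc k) t) (at t)"
      using 1 by (auto intro!: derivative_eq_intros simp: half_bump_deriv_def power2_eq_square field_simps)
    then show ?thesis
      by (rule has_field_derivative_transform_within_open[of _ _ _ "{0<..}"]) (use 1 in \<open>auto simp: half_bump_deriv_def\<close>)
  next
    case 2
    have "((\<lambda>t::real. 0) has_real_derivative half_bump_deriv (Suc k) t) (at t)"
      using 2 by (simp add: half_bump_deriv_def)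
    then show ?thesis
      by (rule has_field_derivative_transform_within_open[of _ _ _ "{..<0}"]) (use 2 in \<open>auto simp: half_bump_deriv_def\<close>)
  next
    case 3
    have "((\<lambda>h. half_bump_deriv k h / h) \<longlongrightarrow> 0) (at 0)"
    proof (rule filterlim_split_at)
      show "((\<lambda>h. half_bump_deriv k h / h) \<longlongrightarrow> 0) (at_left 0)"
        by (rule tendsto_eventually) (auto simp: eventually_at_filter half_bump_deriv_def)
      \<comment> \<open>Dividing by \<open>h\<close> multiplies the polynomial in
        \<open>1 / h\<close> by its variable, whence the factor \<open>[:0, 1:]\<close>; the
        exponential still dominates.\<close>
      have "((\<lambda>h. poly (bump_poly k * [:0, 1:]) (1 / h) * exp (- (1 / h))) \<longlongrightarrow> 0) (at_right 0)"
        using filterlim_compose[OF poly_exp_tendsto_0[of "bump_poly k * [:0, 1:]"] filterlim_inverse_at_top_right]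
        by (simp only: inverse_eq_divide)
      then show "((\<lambda>h. half_bump_deriv k h / h) \<longlongrightarrow> 0) (at_right 0)"
        by (rule Lim_transform_eventually) (auto simp: eventually_at_filter half_bump_deriv_def)
    qed
    then show ?thesis using 3 by (simp add: DERIV_def half_bump_deriv_def)
  qed
qed

lemma smooth_half_bump: "smooth (\<lambda>t. complex_of_real (half_bump t))"
  unfolding smooth_def
proof (intro exI conjI allI)
  show "(\<lambda>t. complex_of_real (half_bump_deriv 0 t)) = (\<lambda>t. complex_of_real (half_bump t))"
    by (simp add: half_bump_deriv_0)
  show "((\<lambda>t. complex_of_real (half_bump_deriv k t)) has_vector_derivative complex_of_real (half_bump_deriv (Suc k) x)) (at x)" for k x
    by (rule has_vector_derivative_of_real) (rule half_bump_deriv_has_derivative)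
qed

lemma half_bump_bounds: "0 \<le> half_bump t" "half_bump t \<le> 1"
  by (simp_all add: half_bump_def)

lemma half_bump_lipschitz: "\<bar>half_bump s - half_bump t\<bar> \<le> 2 * \<bar>s - t\<bar>"
proof -
  have "norm (half_bump s - half_bump t) \<le> 2 * norm (s - t)"
  proof (rule field_differentiable_bound[of UNIV])
    show "(half_bump has_field_derivative half_bump_deriv 1 x) (at x within UNIV)" for x
      using half_bump_deriv_has_derivative[of 0 x] by (simp add: half_bump_deriv_0)
    show "norm (half_bump_deriv 1 x) \<le> 2" for x
    proof (cases "x > 0")
      case True
      define y where "y = 1 / x"
      have y: "y > 0" using True by (simp add: y_def)
      have "y\<^sup>2 / 2 \<le> exp y" using exp_lower_Taylor_quadratic[of y] y by linarith
      then have "y\<^sup>2 * exp (- y) \<le> 2" by (simp add: exp_minus field_simps)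
      then show ?thesis using True by (simp add: half_bump_deriv_def y_def power2_eq_square)
    qed (simp add: half_bump_deriv_def)
  qed auto
  then show ?thesis by simp
qed

text \<open>A resolvent has no compact support, so the distributional Hilbert transform is tested on
  these approximations instead. Each of the two bumps tends to
  \<open>half_bump 1 = exp (- 1)\<close>; the resulting factor \<open>exp (- 2)\<close> appears on
  both sides of the limit relations and cancels.\<close>

definition resolvent_cutoff :: "real \<Rightarrow> nat \<Rightarrow> real \<Rightarrow> complex" where
  "resolvent_cutoff a n t = resolvent a t * (complex_of_real (half_bump (1 + t / real (Suc n))) * complex_of_real (half_bump (1 - t / real (Suc n))))"

lemma resolvent_cutoff_support: "\<bar>t\<bar> \<ge> real (Suc n) \<Longrightarrow> resolvent_cutoff a n t = 0"
proof -
  assume t: "\<bar>t\<bar> \<ge> real (Suc n)"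
  have "\<bar>t / real (Suc n)\<bar> \<ge> 1" using t by (simp add: field_simps)
  then have "1 + t / real (Suc n) \<le> 0 \<or> 1 - t / real (Suc n) \<le> 0" by linarith
  then have "half_bump (1 + t / real (Suc n)) = 0 \<or> half_bump (1 - t / real (Suc n)) = 0"
    unfolding half_bump_def by (metis not_less)
  then show ?thesis unfolding resolvent_cutoff_def by auto
qed

lemma test_function_resolvent_cutoff: "test_function (resolvent_cutoff a n)"
  unfolding test_function_iff
proof
  have "smooth (\<lambda>t. complex_of_real (half_bump (1 + t / real (Suc n))))"
    using smooth_affine[OF smooth_half_bump, of "1 / real (Suc n)" 1] by (simp add: add.commute)
  moreover have "smooth (\<lambda>t. complex_of_real (half_bump (1 - t / real (Suc n))))"
    using smooth_affine[OF smooth_half_bump, of "- 1 / real (Suc n)" 1] by simp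
  ultimately show "smooth (resolvent_cutoff a n)"
    unfolding resolvent_cutoff_def by (intro smooth_mult smooth_resolvent)
  have "{t. resolvent_cutoff a n t \<noteq> 0} \<subseteq> {- real (Suc n)..real (Suc n)}"
    using resolvent_cutoff_support[of n _ a] by (auto simp: abs_le_iff not_le) (smt (verit))+
  then have "bounded {t. resolvent_cutoff a n t \<noteq> 0}" by (rule bounded_subset[rotated]) simp
  then show "compact (closure {t. resolvent_cutoff a n t \<noteq> 0})" by simp
qed

lemma norm_resolvent_cutoff_le: "norm (resolvent_cutoff a n t) \<le> norm (resolvent a t)"
proof -
  have "norm (complex_of_real (half_bump (1 + t / real (Suc n))) * complex_of_real (half_bump (1 - t / real (Suc n)))) \<le> 1"
    unfolding norm_mult by (intro mult_le_one) (auto simp: half_bump_bounds)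
  then show ?thesis
    unfolding resolvent_cutoff_def norm_mult[of "resolvent a t"] by (intro mult_left_le) auto
qed

lemma resolvent_cutoff_tendsto:
  "(\<lambda>n. resolvent_cutoff a n t) \<longlonglongrightarrow> resolvent a t * complex_of_real (exp (- 2))"
proof -
  have c: "isCont half_bump 1"
    using half_bump_deriv_has_derivative[of 0 1] unfolding half_bump_deriv_0 by (rule DERIV_isCont)
  have l: "(\<lambda>n. t / real (Suc n)) \<longlonglongrightarrow> 0" by (rule LIMSEQ_Suc[OF lim_const_over_n])
  have "(\<lambda>n. half_bump (1 + t / real (Suc n))) \<longlonglongrightarrow> half_bump 1"
    using tendsto_add[OF tendsto_const[of 1] l] by (intro isCont_tendsto_compose[OF c]) simp
  moreover have "(\<lambda>n. half_bump (1 - t / real (Suc n))) \<longlonglongrightarrow> half_bump 1"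
    using tendsto_diff[OF tendsto_const[of 1] l] by (intro isCont_tendsto_compose[OF c]) simp
  ultimately have "(\<lambda>n. resolvent_cutoff a n t) \<longlonglongrightarrow> resolvent a t * (complex_of_real (half_bump 1) * complex_of_real (half_bump 1))"
    unfolding resolvent_cutoff_def by (intro tendsto_intros)
  moreover have "complex_of_real (half_bump 1) * complex_of_real (half_bump 1) = complex_of_real (exp (- 2))"
    by (simp add: half_bump_def exp_add[symmetric] flip: of_real_mult)
  ultimately show ?thesis by simp
qed

text \<open>The point is uniformity in \<open>n\<close>: the resolvent contributes \<open>a\<close>,
  each bump contributes 2, and the dilation by \<open>real (Suc n)\<close> only improves the
  constant.\<close>

lemma resolvent_cutoff_lipschitz:
  assumes a: "a > 0"
  shows "norm (resolvent_cutoff a n s - resolvent_cutoff a n t) \<le> (a + 4) * \<bar>s - t\<bar>"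
proof -
  define p q where "p t = complex_of_real (half_bump (1 + t / real (Suc n)))" and "q t = complex_of_real (half_bump (1 - t / real (Suc n)))" for t
  have pq: "norm (p t) \<le> 1" "norm (q t) \<le> 1" for t by (simp_all add: p_def q_def half_bump_bounds)
  have sc: "\<bar>s / real (Suc n) - t / real (Suc n)\<bar> \<le> \<bar>s - t\<bar>"
  proof -
    have "\<bar>s / real (Suc n) - t / real (Suc n)\<bar> = \<bar>s - t\<bar> / real (Suc n)" by (simp add: diff_divide_distrib[symmetric] abs_divide del: of_nat_Suc)
    also have "\<dots> \<le> \<bar>s - t\<bar>" by (simp add: divide_le_eq mult_right_le_one_le algebra_simps)
    finally show ?thesis .
  qed
  have dp: "norm (p s - p t) \<le> 2 * \<bar>s - t\<bar>"
    using half_bump_lipschitz[of "1 + s / real (Suc n)" "1 + t / real (Suc n)"] sc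
    unfolding p_def of_real_diff[symmetric] norm_of_real add_diff_cancel_left by (meson mult_left_mono order_trans zero_le_numeral)
  have dq: "norm (q s - q t) \<le> 2 * \<bar>s - t\<bar>"
    using half_bump_lipschitz[of "1 - s / real (Suc n)" "1 - t / real (Suc n)"] sc
    unfolding q_def of_real_diff[symmetric] norm_of_real diff_diff_eq2 minus_diff_eq
    by (simp add: abs_minus_commute)
  have dr: "norm (resolvent a s - resolvent a t) \<le> a * \<bar>s - t\<bar>"
  proof -
    have "norm (resolvent a s * resolvent a t) \<le> 1"
      unfolding norm_mult by (intro mult_le_one norm_resolvent_le) auto
    then have "a * \<bar>s - t\<bar> * norm (resolvent a s * resolvent a t) \<le> a * \<bar>s - t\<bar>"
      using a by (intro mult_left_le) auto
    then show ?thesis unfolding resolvent_diff using a by (simp add: abs_mult norm_mult mult.assoc del: of_real_mult of_real_diff)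
  qed
  have "resolvent_cutoff a n s - resolvent_cutoff a n t
     = (resolvent a s - resolvent a t) * (p s * q s) + resolvent a t * ((p s - p t) * q s) + resolvent a t * (p t * (q s - q t))"
    unfolding resolvent_cutoff_def p_def[symmetric] q_def[symmetric] by (simp add: algebra_simps)
  also have "norm \<dots> \<le> norm ((resolvent a s - resolvent a t) * (p s * q s)) + norm (resolvent a t * ((p s - p t) * q s)) + norm (resolvent a t * (p t * (q s - q t)))"
    by (intro norm_triangle_le add_right_mono norm_triangle_ineq)
  also have "\<dots> \<le> a * \<bar>s - t\<bar> * (1 * 1) + 1 * (2 * \<bar>s - t\<bar> * 1) + 1 * (1 * (2 * \<bar>s - t\<bar>))"
    unfolding norm_mult using a
    by (intro add_mono mult_mono dr dp dq pq norm_resolvent_le mult_nonneg_nonneg) auto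
  also have "\<dots> = (a + 4) * \<bar>s - t\<bar>" by (simp add: algebra_simps)
  finally show ?thesis .
qed

subsection \<open>The Hilbert transform and Hardy spaces\<close>

definition pv_kernel :: "real \<Rightarrow> real \<Rightarrow> complex" where
  "pv_kernel \<epsilon> u = (if \<bar>u\<bar> > \<epsilon> then complex_of_real (1 / u) else 0)"

lemma pv_kernel_measurable [measurable]: "pv_kernel \<epsilon> \<in> borel_measurable borel"
  unfolding pv_kernel_def by measurable

lemma norm_pv_kernel_le: "\<epsilon> > 0 \<Longrightarrow> norm (pv_kernel \<epsilon> u) \<le> 1 / \<epsilon>"
  by (auto simp: pv_kernel_def norm_divide frac_le)

lemma pv_kernel_minus: "pv_kernel \<epsilon> (- u) = - pv_kernel \<epsilon> u"
  by (simp add: pv_kernel_def)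

lemma hilbert_truncated_curve:
  assumes f: "integrable lborel f" and \<nu>: "\<And>B. B \<in> sets borel \<Longrightarrow> \<nu> B = curve_measure (\<lambda>t. t) f B"
    and e: "\<epsilon> > 0"
  shows "hilbert_truncated \<nu> \<epsilon> x = complex_of_real (1 / pi) * (\<integral>t. f t * pv_kernel \<epsilon> (x - t) \<partial>lborel)"
proof -
  have "cm_integral \<nu> (\<lambda>t. if \<bar>x - t\<bar> > \<epsilon> then complex_of_real (1 / (x - t)) else 0) = cm_integral \<nu> (\<lambda>t. pv_kernel \<epsilon> (x - t))"
    by (simp add: pv_kernel_def)
  also have "\<dots> = cm_integral (curve_measure (\<lambda>t. t) f) (\<lambda>t. pv_kernel \<epsilon> (x - t))"
    by (rule cm_integral_cong) (rule \<nu>)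
  also have "\<dots> = (\<integral>t. f t * pv_kernel \<epsilon> (x - t) \<partial>lborel)"
    by (rule cm_integral_curve[OF f, where q="\<lambda>t. t" and K="1 / \<epsilon>"]) (use norm_pv_kernel_le[OF e] in auto)
  finally show ?thesis by (simp add: hilbert_truncated_def)
qed

text \<open>Up to a constant factor, the integral over \<open>u > 0\<close> is the Hilbert transform of \<open>\<phi>\<close> without principal value.\<close>

definition diff_quot :: "(real \<Rightarrow> complex) \<Rightarrow> real \<Rightarrow> real \<Rightarrow> complex" where
  "diff_quot \<phi> t u = (\<phi> (t + u) - \<phi> (t - u)) / complex_of_real u"

definition sym_hilbert :: "(real \<Rightarrow> complex) \<Rightarrow> real \<Rightarrow> complex" where
  "sym_hilbert \<phi> t = complex_of_real (1 / (2 * pi)) * (\<integral>u. diff_quot \<phi> t u \<partial>lborel)"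

lemma lborel_integral_translate:
  fixes f :: "real \<Rightarrow> complex"
  shows "(\<integral>x. f (x + a) \<partial>lborel) = (\<integral>x. f x \<partial>lborel)"
  using lborel_integral_real_affine[of 1 f a] by (simp add: add.commute)

lemma lborel_integral_reflect:
  fixes f :: "real \<Rightarrow> complex"
  shows "(\<integral>x. f (- x) \<partial>lborel) = (\<integral>x. f x \<partial>lborel)"
  using lborel_integral_real_affine[of "-1" f 0] by simp

lemma lborel_integrable_translate:
  fixes f :: "real \<Rightarrow> 'a::{banach, second_countable_topology}"
  shows "integrable lborel f \<Longrightarrow> integrable lborel (\<lambda>x. f (x + a))"
  using lborel_integrable_real_affine[of f 1 a] by (simp add: add.commute)

lemma lborel_integrable_reflect:
  fixes f :: "real \<Rightarrow> 'a::{banach, second_countable_topology}"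
  shows "integrable lborel f \<Longrightarrow> integrable lborel (\<lambda>x. f (a - x))"
  using lborel_integrable_real_affine[of f "-1" a] by simp

lemma integrable_pv_kernel_mult:
  assumes "integrable lborel \<phi>" "\<epsilon> > 0"
  shows "integrable lborel (\<lambda>u. \<phi> u * pv_kernel \<epsilon> (u - t))" "integrable lborel (\<lambda>u. \<phi> u * pv_kernel \<epsilon> (t - u))"
     "integrable lborel (\<lambda>u. \<phi> (t + u) * pv_kernel \<epsilon> u)" "integrable lborel (\<lambda>u. \<phi> (t - u) * pv_kernel \<epsilon> u)"
  using assms lborel_integrable_translate[OF assms(1), of t] lborel_integrable_reflect[OF assms(1), of t]
  by (auto intro!: integrable_mult_bounded[where B="1 / \<epsilon>"] norm_pv_kernel_le simp: add.commute)

text \<open>The kernel is odd, so averaging the integral with its reflection about \<open>t\<close>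
  replaces \<open>\<phi>\<close> by a difference of values. The quotient stays bounded near
  \<open>u = 0\<close> for Lipschitz \<open>\<phi>\<close>, and the truncation can later be
  removed.\<close>

lemma pv_symmetrize:
  assumes \<phi>: "integrable lborel \<phi>" and e: "\<epsilon> > 0"
  shows "(\<integral>x. \<phi> x * pv_kernel \<epsilon> (x - t) \<partial>lborel) = (\<integral>u. (if \<bar>u\<bar> > \<epsilon> then diff_quot \<phi> t u else 0) \<partial>lborel) / 2"
proof -
  have 1: "(\<integral>x. \<phi> x * pv_kernel \<epsilon> (x - t) \<partial>lborel) = (\<integral>u. \<phi> (t + u) * pv_kernel \<epsilon> u \<partial>lborel)"
    using lborel_integral_translate[of "\<lambda>x. \<phi> x * pv_kernel \<epsilon> (x - t)" t] by (simp add: add.commute)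
  have 2: "(\<integral>u. \<phi> (t + u) * pv_kernel \<epsilon> u \<partial>lborel) = - (\<integral>u. \<phi> (t - u) * pv_kernel \<epsilon> u \<partial>lborel)"
    using lborel_integral_reflect[of "\<lambda>u. \<phi> (t + u) * pv_kernel \<epsilon> u"] by (simp add: pv_kernel_minus)
  have "(\<integral>u. \<phi> (t + u) * pv_kernel \<epsilon> u \<partial>lborel) + (\<integral>u. \<phi> (t + u) * pv_kernel \<epsilon> u \<partial>lborel)
     = (\<integral>u. \<phi> (t + u) * pv_kernel \<epsilon> u \<partial>lborel) - (\<integral>u. \<phi> (t - u) * pv_kernel \<epsilon> u \<partial>lborel)"
    by (subst (2) 2) simp
  also have "\<dots> = (\<integral>u. \<phi> (t + u) * pv_kernel \<epsilon> u - \<phi> (t - u) * pv_kernel \<epsilon> u \<partial>lborel)"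
    by (rule Bochner_Integration.integral_diff[symmetric]) (rule integrable_pv_kernel_mult[OF \<phi> e])+
  also have "\<dots> = (\<integral>u. (if \<bar>u\<bar> > \<epsilon> then diff_quot \<phi> t u else 0) \<partial>lborel)"
    by (intro Bochner_Integration.integral_cong) (auto simp: pv_kernel_def diff_quot_def diff_divide_distrib)
  finally show ?thesis unfolding 1 by (simp add: mult.commute)
qed

text \<open>For fixed \<open>\<epsilon>\<close> the kernel is bounded by
  \<open>1 / \<epsilon>\<close>, so the double integral converges absolutely and the truncated
  transform can be moved from \<open>f\<close> to \<open>\<phi>\<close>.\<close>

lemma hilbert_truncated_Fubini:
  assumes f: "integrable lborel f" and \<phi>: "integrable lborel \<phi>" and e: "\<epsilon> > 0"
  shows "(\<integral>x. (\<integral>t. f t * pv_kernel \<epsilon> (x - t) \<partial>lborel) * \<phi> x \<partial>lborel)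
    = (\<integral>t. f t * (\<integral>x. \<phi> x * pv_kernel \<epsilon> (x - t) \<partial>lborel) \<partial>lborel)"
proof -
  have [measurable]: "f \<in> borel_measurable borel" "\<phi> \<in> borel_measurable borel" using f \<phi> by auto
  define G where "G x t = f t * pv_kernel \<epsilon> (x - t) * \<phi> x" for x t
  have Gm: "case_prod G \<in> borel_measurable (lborel \<Otimes>\<^sub>M lborel)" unfolding G_def by measurable
  have int1: "integrable lborel (G x)" for x
    unfolding G_def by (intro integrable_mult_left integrable_pv_kernel_mult f e)
  have "integrable (lborel \<Otimes>\<^sub>M lborel) (case_prod G)"
  proof (rule lborel_pair.Fubini_integrable[OF Gm])
    show "AE x in lborel. integrable lborel (\<lambda>t. case_prod G (x, t))" using int1 by simp
    show "integrable lborel (\<lambda>x. \<integral>t. norm (case_prod G (x, t)) \<partial>lborel)"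
    proof (rule Bochner_Integration.integrable_bound)
      show "integrable lborel (\<lambda>x. (1 / \<epsilon> * (\<integral>t. norm (f t) \<partial>lborel)) * norm (\<phi> x))" using \<phi> by simp
      show "(\<lambda>x. \<integral>t. norm (case_prod G (x, t)) \<partial>lborel) \<in> borel_measurable lborel"
        using Gm by measurable
      show "AE x in lborel. norm (\<integral>t. norm (case_prod G (x, t)) \<partial>lborel) \<le> norm ((1 / \<epsilon> * (\<integral>t. norm (f t) \<partial>lborel)) * norm (\<phi> x))"
      proof (rule AE_I2)
        fix x
        have "(\<integral>t. norm (G x t) \<partial>lborel) \<le> (\<integral>t. (1 / \<epsilon> * norm (\<phi> x)) * norm (f t) \<partial>lborel)"
        proof (rule integral_mono)
          fix t
          have "norm (f t) * norm (pv_kernel \<epsilon> (x - t)) * norm (\<phi> x) \<le> norm (f t) * (1 / \<epsilon>) * norm (\<phi> x)"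
            using e by (intro mult_right_mono mult_left_mono norm_pv_kernel_le) auto
          then show "norm (G x t) \<le> (1 / \<epsilon> * norm (\<phi> x)) * norm (f t)" by (simp add: G_def norm_mult mult_ac)
        qed (use int1 f in auto)
        also have "\<dots> = (1 / \<epsilon> * (\<integral>t. norm (f t) \<partial>lborel)) * norm (\<phi> x)" by simp
        finally show "norm (\<integral>t. norm (case_prod G (x, t)) \<partial>lborel) \<le> norm ((1 / \<epsilon> * (\<integral>t. norm (f t) \<partial>lborel)) * norm (\<phi> x))"
          using e by simp
      qed
    qed
  qed
  then have "(\<integral>t. (\<integral>x. G x t \<partial>lborel) \<partial>lborel) = (\<integral>x. (\<integral>t. G x t \<partial>lborel) \<partial>lborel)"
    by (rule lborel_pair.Fubini_integral)
  moreover have "(\<integral>x. G x t \<partial>lborel) = f t * (\<integral>x. \<phi> x * pv_kernel \<epsilon> (x - t) \<partial>lborel)" for t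
  proof -
    have "G x t = f t * (\<phi> x * pv_kernel \<epsilon> (x - t))" for x by (simp add: G_def)
    then show ?thesis by simp
  qed
  moreover have "(\<integral>t. G x t \<partial>lborel) = (\<integral>t. f t * pv_kernel \<epsilon> (x - t) \<partial>lborel) * \<phi> x" for x
    unfolding G_def by (rule integral_mult_left_zero)
  ultimately show ?thesis by simp
qed

text \<open>A weak form of the relation that \<open>g\<close> is the Hilbert transform of
  \<open>f\<close>, tested on the cutoffs. The conjugated test functions are included to make the
  relation stable under conjugation: the statement for \<open>f - \<i> * g\<close> is the one for
  \<open>f + \<i> * g\<close> applied to the conjugate pair.\<close>

definition hilbert_pair :: "(real \<Rightarrow> complex) \<Rightarrow> (real \<Rightarrow> complex) \<Rightarrow> bool" where
  "hilbert_pair f g \<longleftrightarrow> integrable lborel f \<and> integrable lborel g \<and> (\<integral>t. f t \<partial>lborel) = 0 \<and> (\<integral>t. g t \<partial>lborel) = 0 \<and>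
     (\<forall>a>0. \<forall>n. (\<integral>t. g t * resolvent_cutoff a n t \<partial>lborel) = (\<integral>t. f t * sym_hilbert (resolvent_cutoff a n) t \<partial>lborel) \<and>
        (\<integral>t. g t * cnj (resolvent_cutoff a n t) \<partial>lborel) = (\<integral>t. f t * sym_hilbert (\<lambda>t. cnj (resolvent_cutoff a n t)) t \<partial>lborel))"

text \<open>A majorant for symmetric difference quotients whose integral over \<open>u\<close> does
  not depend on \<open>t\<close>. This independence gives a bound uniform in \<open>t\<close>, as is
  needed for dominated convergence against an arbitrary integrable \<open>f\<close>.\<close>

definition quot_major :: "real \<Rightarrow> real \<Rightarrow> real \<Rightarrow> real" where
  "quot_major a t u = (4 * (a + 4) + 4) * (1 / (1 + u\<^sup>2)) + (norm (resolvent a (t + u)))\<^sup>2 + (norm (resolvent a (t - u)))\<^sup>2"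

lemma integrable_norm_resolvent_square:
  assumes "a > 0"
  shows "integrable lborel (\<lambda>t. (norm (resolvent a t))\<^sup>2)"
proof -
  have "integrable lborel (\<lambda>t. norm (resolvent a t * resolvent a t))"
    by (intro integrable_norm integrable_resolvent_mult assms)
  then show ?thesis by (simp add: norm_mult power2_eq_square)
qed

lemma quot_major_integral:
  assumes a: "a > 0"
  shows "integrable lborel (quot_major a t)"
    and "(\<integral>u. quot_major a t u \<partial>lborel) = (\<integral>u. quot_major a 0 u \<partial>lborel)"
proof -
  have i0: "integrable lborel (\<lambda>u::real. 1 / (1 + u\<^sup>2))"
    using integrable_inverse_quadratic[of 1 0] by (simp add: add.commute)
  have i1: "integrable lborel (\<lambda>u. (norm (resolvent a (t + u)))\<^sup>2)" for t
    using lborel_integrable_translate[OF integrable_norm_resolvent_square[OF a], of t] by (simp add: add.commute)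
  have i2: "integrable lborel (\<lambda>u. (norm (resolvent a (t - u)))\<^sup>2)" for t
    by (rule lborel_integrable_reflect[OF integrable_norm_resolvent_square[OF a]])
  show "integrable lborel (quot_major a t)" unfolding quot_major_def by (intro Bochner_Integration.integrable_add integrable_mult_right i0 i1 i2)
  have e1: "(\<integral>u. (norm (resolvent a (t + u)))\<^sup>2 \<partial>lborel) = (\<integral>u. (norm (resolvent a u))\<^sup>2 \<partial>lborel)" for t
    using lborel_integral_real_affine[of 1 "\<lambda>u. (norm (resolvent a u))\<^sup>2" t] by simp
  have e2: "(\<integral>u. (norm (resolvent a (t - u)))\<^sup>2 \<partial>lborel) = (\<integral>u. (norm (resolvent a u))\<^sup>2 \<partial>lborel)" for t
    using lborel_integral_real_affine[of "-1" "\<lambda>u. (norm (resolvent a u))\<^sup>2" t] by simp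
  show "(\<integral>u. quot_major a t u \<partial>lborel) = (\<integral>u. quot_major a 0 u \<partial>lborel)"
    unfolding quot_major_def
      Bochner_Integration.integral_add[OF Bochner_Integration.integrable_add[OF integrable_mult_right[OF i0] i1] i2]
      Bochner_Integration.integral_add[OF integrable_mult_right[OF i0] i1] e1 e2 ..
qed

lemma quot_major_nonneg: "a > 0 \<Longrightarrow> 0 \<le> quot_major a t u"
  unfolding quot_major_def by (intro add_nonneg_nonneg mult_nonneg_nonneg) auto

text \<open>For \<open>\<bar>u\<bar> \<le> 1\<close> the Lipschitz condition bounds the quotient by
  \<open>2 * (a + 4)\<close>, and \<open>1 + u\<^sup>2 \<le> 2\<close>. For larger \<open>u\<close>
  each of the two terms is split by
  \<open>x / \<bar>u\<bar> \<le> x\<^sup>2 + 1 / u\<^sup>2\<close>; this accounts for the squared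
  resolvents and the extra 4 in \<open>quot_major\<close>.\<close>

lemma quot_major_bound:
  assumes a: "a > 0" and dom: "\<And>x. norm (\<phi> x) \<le> norm (resolvent a x)"
    and lip: "\<And>x y. norm (\<phi> x - \<phi> y) \<le> (a + 4) * \<bar>x - y\<bar>"
  shows "norm (diff_quot \<phi> t u) \<le> quot_major a t u"
proof (cases "\<bar>u\<bar> \<le> 1")
  case True
  have "norm (diff_quot \<phi> t u) \<le> 2 * (a + 4)"
  proof (cases "u = 0")
    case False
    have "norm (\<phi> (t + u) - \<phi> (t - u)) \<le> (a + 4) * \<bar>(t + u) - (t - u)\<bar>" by (rule lip)
    also have "\<dots> = 2 * (a + 4) * \<bar>u\<bar>" by (simp add: abs_mult)
    finally show ?thesis using False by (simp add: diff_quot_def norm_divide pos_divide_le_eq)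
  qed (use a in \<open>simp add: diff_quot_def\<close>)
  also have "\<dots> \<le> 4 * (a + 4) * (1 / (1 + u\<^sup>2))"
  proof -
    have "u\<^sup>2 \<le> 1" using True by (simp add: abs_square_le_1)
    then have "(a + 4) * u\<^sup>2 \<le> (a + 4) * 1" using a by (intro mult_left_mono) auto
    then have "2 * (a + 4) * (1 + u\<^sup>2) \<le> 4 * (a + 4)" by (simp add: algebra_simps)
    moreover have "1 + u\<^sup>2 > 0" by (simp add: add_pos_nonneg)
    ultimately show ?thesis by (simp add: pos_le_divide_eq)
  qed
  also have "\<dots> \<le> quot_major a t u"
  proof -
    have "4 * (a + 4) * (1 / (1 + u\<^sup>2)) \<le> (4 * (a + 4) + 4) * (1 / (1 + u\<^sup>2))"
      by (intro mult_right_mono) auto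
    moreover have "0 \<le> (norm (resolvent a (t + u)))\<^sup>2" "0 \<le> (norm (resolvent a (t - u)))\<^sup>2" by simp_all
    ultimately show ?thesis unfolding quot_major_def by linarith
  qed
  finally show ?thesis .
next
  case False
  then have u: "\<bar>u\<bar> > 1" by simp
  have one: "x / \<bar>u\<bar> \<le> x\<^sup>2 + 2 * (1 / (1 + u\<^sup>2))" if "x \<ge> 0" for x :: real
  proof -
    define y where "y = 1 / \<bar>u\<bar>"
    have y: "y\<^sup>2 = 1 / u\<^sup>2" by (simp add: y_def power_divide)
    have "y * x \<le> y\<^sup>2 + x\<^sup>2" using sum_squares_bound[of y x] zero_le_power2[of y] zero_le_power2[of x] by linarith
    then have "x / \<bar>u\<bar> \<le> 1 / u\<^sup>2 + x\<^sup>2" unfolding y by (simp add: y_def mult.commute)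
    also have "1 / u\<^sup>2 \<le> 2 * (1 / (1 + u\<^sup>2))"
    proof -
      have "u\<^sup>2 > 1" using one_less_power[OF u, of 2] by simp
      moreover have "1 / v \<le> 2 * (1 / (1 + v))" if "v > 1" for v :: real using that by (simp add: field_simps)
      ultimately show ?thesis by blast
    qed
    finally show ?thesis by (simp add: add.commute)
  qed
  have "norm (diff_quot \<phi> t u) \<le> (norm (\<phi> (t + u)) + norm (\<phi> (t - u))) / \<bar>u\<bar>"
    unfolding diff_quot_def norm_divide norm_of_real by (intro divide_right_mono norm_triangle_ineq4) auto
  also have "\<dots> \<le> (norm (resolvent a (t + u)) + norm (resolvent a (t - u))) / \<bar>u\<bar>"
    by (intro divide_right_mono add_mono dom) auto
  also have "\<dots> = norm (resolvent a (t + u)) / \<bar>u\<bar> + norm (resolvent a (t - u)) / \<bar>u\<bar>" by (rule add_divide_distrib)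
  also have "\<dots> \<le> ((norm (resolvent a (t + u)))\<^sup>2 + 2 * (1 / (1 + u\<^sup>2))) + ((norm (resolvent a (t - u)))\<^sup>2 + 2 * (1 / (1 + u\<^sup>2)))"
    by (intro add_mono one) auto
  also have "\<dots> \<le> quot_major a t u"
  proof -
    have "4 * (1 / (1 + u\<^sup>2)) \<le> (4 * (a + 4) + 4) * (1 / (1 + u\<^sup>2))"
      using a by (intro mult_right_mono) auto
    then show ?thesis unfolding quot_major_def by linarith
  qed
  finally show ?thesis .
qed

text \<open>Dominated convergence twice: in \<open>u\<close> with the majorant
  \<open>quot_major a t\<close>, and in \<open>t\<close> with a multiple of the modulus of
  \<open>f\<close>, because the integral of the majorant is the same for all
  \<open>t\<close>.\<close>

lemma sym_hilbert_limits:
  assumes a: "a > 0" and dom: "\<And>x. norm (\<phi> x) \<le> norm (resolvent a x)"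
    and lip: "\<And>x y. norm (\<phi> x - \<phi> y) \<le> (a + 4) * \<bar>x - y\<bar>" and m[measurable]: "\<phi> \<in> borel_measurable borel"
    and int: "integrable lborel \<phi>" and f: "integrable lborel f" and \<epsilon>: "\<And>n. \<epsilon> n > 0" "\<epsilon> \<longlonglongrightarrow> 0"
  shows "(\<lambda>n. \<integral>t. f t * (complex_of_real (1 / pi) * (\<integral>x. \<phi> x * pv_kernel (\<epsilon> n) (x - t) \<partial>lborel)) \<partial>lborel)
     \<longlonglongrightarrow> (\<integral>t. f t * sym_hilbert \<phi> t \<partial>lborel)"
proof (rule tendsto_integral_mult_bounded[OF f, where B="1 / (2 * pi) * (\<integral>u. quot_major a 0 u \<partial>lborel)"])
  have qm: "(\<lambda>(t, u). diff_quot \<phi> t u) \<in> borel_measurable (lborel \<Otimes>\<^sub>M lborel)"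
    unfolding diff_quot_def by measurable
  have eq: "complex_of_real (1 / pi) * (\<integral>x. \<phi> x * pv_kernel (\<epsilon> n) (x - t) \<partial>lborel)
     = complex_of_real (1 / (2 * pi)) * (\<integral>u. (if \<bar>u\<bar> > \<epsilon> n then diff_quot \<phi> t u else 0) \<partial>lborel)" for n t
    by (simp add: pv_symmetrize[OF int \<epsilon>(1)])
  show "(\<lambda>t. complex_of_real (1 / pi) * (\<integral>x. \<phi> x * pv_kernel (\<epsilon> n) (x - t) \<partial>lborel)) \<in> borel_measurable lborel" for n
    by measurable
  show "sym_hilbert \<phi> \<in> borel_measurable lborel"
    unfolding sym_hilbert_def using qm by measurable
  have dm: "diff_quot \<phi> t \<in> borel_measurable borel" for t unfolding diff_quot_def by measurable
  show "norm (complex_of_real (1 / pi) * (\<integral>x. \<phi> x * pv_kernel (\<epsilon> n) (x - t) \<partial>lborel)) \<le> 1 / (2 * pi) * (\<integral>u. quot_major a 0 u \<partial>lborel)" for n t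
  proof -
    have "norm (\<integral>u. (if \<bar>u\<bar> > \<epsilon> n then diff_quot \<phi> t u else 0) \<partial>lborel) \<le> (\<integral>u. quot_major a t u \<partial>lborel)"
    proof (rule Bochner_Integration.integral_norm_bound_integral)
      show "integrable lborel (\<lambda>u. if \<bar>u\<bar> > \<epsilon> n then diff_quot \<phi> t u else 0)"
        by (rule Bochner_Integration.integrable_bound[OF quot_major_integral(1)[OF a, of t]])
          (use dm[of t] quot_major_bound[OF a dom lip, of t] quot_major_nonneg[OF a, of t] in auto)
      show "integrable lborel (quot_major a t)" by (rule quot_major_integral(1)[OF a])
      show "norm (if \<bar>u\<bar> > \<epsilon> n then diff_quot \<phi> t u else 0) \<le> quot_major a t u" for u
        using quot_major_bound[OF a dom lip, of t u] quot_major_nonneg[OF a, of t u] by simp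
    qed
    then show ?thesis
      unfolding eq norm_mult norm_of_real quot_major_integral(2)[OF a, of t]
      by (simp only: abs_of_nonneg divide_nonneg_nonneg zero_le_one mult_nonneg_nonneg zero_le_numeral pi_ge_zero mult_left_mono)
  qed
  have "(\<lambda>n. \<integral>u. (if \<bar>u\<bar> > \<epsilon> n then diff_quot \<phi> t u else 0) \<partial>lborel) \<longlonglongrightarrow> (\<integral>u. diff_quot \<phi> t u \<partial>lborel)" for t
  proof (rule integral_dominated_convergence[where w="quot_major a t"])
    show "integrable lborel (quot_major a t)" by (rule quot_major_integral(1)[OF a])
    show "AE u in lborel. norm (if \<bar>u\<bar> > \<epsilon> n then diff_quot \<phi> t u else 0) \<le> quot_major a t u" for n
      using quot_major_bound[OF a dom lip, of t] quot_major_nonneg[OF a, of t] by (intro AE_I2) simp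
    show "AE u in lborel. (\<lambda>n. if \<bar>u\<bar> > \<epsilon> n then diff_quot \<phi> t u else 0) \<longlonglongrightarrow> diff_quot \<phi> t u"
      using AE_lborel_singleton[of "0::real"]
    proof eventually_elim
      case (elim u)
      then have "\<forall>\<^sub>F n in sequentially. \<epsilon> n < \<bar>u\<bar>" using \<epsilon>(2) by (intro order_tendstoD) auto
      then have "\<forall>\<^sub>F n in sequentially. (if \<bar>u\<bar> > \<epsilon> n then diff_quot \<phi> t u else 0) = diff_quot \<phi> t u"
        by eventually_elim simp
      then show ?case by (rule tendsto_eventually)
    qed
  qed (use dm in auto)
  then show "AE t in lborel. (\<lambda>n. complex_of_real (1 / pi) * (\<integral>x. \<phi> x * pv_kernel (\<epsilon> n) (x - t) \<partial>lborel)) \<longlonglongrightarrow> sym_hilbert \<phi> t"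
    unfolding eq sym_hilbert_def by (intro AE_I2 tendsto_intros)
qed

text \<open>The majorant is also independent of the index of the cutoff, so the limit may be taken
  inside both integrals. What remains is \<open>integral_resolvent_reflected\<close>:
  \<open>sym_hilbert\<close> acts on a resolvent as multiplication by \<open>\<i>\<close>.\<close>

lemma sym_hilbert_cutoff_limit:
  assumes a: "a > 0" and f: "integrable lborel f"
  shows "(\<lambda>n. \<integral>t. f t * sym_hilbert (resolvent_cutoff a n) t \<partial>lborel)
     \<longlonglongrightarrow> (\<integral>t. f t * (\<i> * (resolvent a t * complex_of_real (exp (- 2)))) \<partial>lborel)"
proof (rule tendsto_integral_mult_bounded[OF f, where B="1 / (2 * pi) * (\<integral>u. quot_major a 0 u \<partial>lborel)"])
  have cm[measurable]: "resolvent_cutoff a n \<in> borel_measurable borel" for n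
    using test_function_resolvent_cutoff[of a n] unfolding test_function_iff
    by (auto intro: borel_measurable_continuous_onI smooth_continuous)
  have qm: "(\<lambda>(t, u). diff_quot (resolvent_cutoff a n) t u) \<in> borel_measurable (lborel \<Otimes>\<^sub>M lborel)" for n
    unfolding diff_quot_def by measurable
  show "sym_hilbert (resolvent_cutoff a n) \<in> borel_measurable lborel" for n
    unfolding sym_hilbert_def using qm by measurable
  have dm: "diff_quot (resolvent_cutoff a n) t \<in> borel_measurable borel" for t n unfolding diff_quot_def by measurable
  have bound: "norm (diff_quot (resolvent_cutoff a n) t u) \<le> quot_major a t u" for n t u
    by (rule quot_major_bound[OF a norm_resolvent_cutoff_le resolvent_cutoff_lipschitz[OF a]])
  have intd: "integrable lborel (diff_quot (resolvent_cutoff a n) t)" for n t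
    by (rule Bochner_Integration.integrable_bound[OF quot_major_integral(1)[OF a, of t]])
      (use dm[of n t] bound[of n t] quot_major_nonneg[OF a, of t] in auto)
  show "norm (sym_hilbert (resolvent_cutoff a n) t) \<le> 1 / (2 * pi) * (\<integral>u. quot_major a 0 u \<partial>lborel)" for n t
  proof -
    have "norm (\<integral>u. diff_quot (resolvent_cutoff a n) t u \<partial>lborel) \<le> (\<integral>u. quot_major a t u \<partial>lborel)"
      by (rule Bochner_Integration.integral_norm_bound_integral[OF intd quot_major_integral(1)[OF a] bound])
    then show ?thesis
      unfolding sym_hilbert_def norm_mult norm_of_real quot_major_integral(2)[OF a, of t]
      by (simp only: abs_of_nonneg divide_nonneg_nonneg zero_le_one mult_nonneg_nonneg zero_le_numeral pi_ge_zero mult_left_mono)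
  qed
  have lim: "(\<lambda>n. \<integral>u. diff_quot (resolvent_cutoff a n) t u \<partial>lborel)
     \<longlonglongrightarrow> (\<integral>u. complex_of_real (exp (- 2)) * (2 * \<i> * complex_of_real a * (resolvent a (t + u) * resolvent a (t - u))) \<partial>lborel)" for t
  proof (rule integral_dominated_convergence[where w="quot_major a t"])
    show "integrable lborel (quot_major a t)" by (rule quot_major_integral(1)[OF a])
    show "AE u in lborel. norm (diff_quot (resolvent_cutoff a n) t u) \<le> quot_major a t u" for n
      using bound by simp
    show "AE u in lborel. (\<lambda>n. diff_quot (resolvent_cutoff a n) t u) \<longlonglongrightarrow>
        complex_of_real (exp (- 2)) * (2 * \<i> * complex_of_real a * (resolvent a (t + u) * resolvent a (t - u)))"
      using AE_lborel_singleton[of "0::real"]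
    proof eventually_elim
      case (elim u)
      have "(\<lambda>n. diff_quot (resolvent_cutoff a n) t u) \<longlonglongrightarrow>
         (resolvent a (t + u) * complex_of_real (exp (- 2)) - resolvent a (t - u) * complex_of_real (exp (- 2))) / complex_of_real u"
        unfolding diff_quot_def using elim by (intro tendsto_intros resolvent_cutoff_tendsto) auto
      also have "(resolvent a (t + u) * complex_of_real (exp (- 2)) - resolvent a (t - u) * complex_of_real (exp (- 2))) / complex_of_real u
        = complex_of_real (exp (- 2)) * ((resolvent a (t + u) - resolvent a (t - u)) / complex_of_real u)"
        by (simp add: left_diff_distrib[symmetric] mult.commute)
      also have "(resolvent a (t + u) - resolvent a (t - u)) / complex_of_real u = 2 * \<i> * complex_of_real a * (resolvent a (t + u) * resolvent a (t - u))"
        unfolding resolvent_diff using elim by simp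
      finally show ?case .
    qed
  qed (use dm in auto)
  have val: "complex_of_real (1 / (2 * pi)) * (\<integral>u. complex_of_real (exp (- 2)) * (2 * \<i> * complex_of_real a * (resolvent a (t + u) * resolvent a (t - u))) \<partial>lborel)
     = \<i> * (resolvent a t * complex_of_real (exp (- 2)))" for t
  proof -
    have "(\<integral>u. complex_of_real (exp (- 2)) * (2 * \<i> * complex_of_real a * (resolvent a (t + u) * resolvent a (t - u))) \<partial>lborel)
       = complex_of_real (exp (- 2)) * (2 * \<i> * complex_of_real a * (complex_of_real (pi / a) * resolvent a t))"
      by (simp only: integral_mult_right_zero integral_resolvent_reflected[OF a])
    then show ?thesis using a by simp
  qed
  show "AE t in lborel. (\<lambda>n. sym_hilbert (resolvent_cutoff a n) t) \<longlonglongrightarrow> \<i> * (resolvent a t * complex_of_real (exp (- 2)))"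
    unfolding sym_hilbert_def val[symmetric] by (intro AE_I2 tendsto_intros lim)
qed measurable

lemma sym_hilbert_cnj: "sym_hilbert (\<lambda>t. cnj (\<phi> t)) t = cnj (sym_hilbert \<phi> t)"
proof -
  have "diff_quot (\<lambda>t. cnj (\<phi> t)) t u = cnj (diff_quot \<phi> t u)" for u by (simp add: diff_quot_def)
  then show ?thesis by (simp add: sym_hilbert_def)
qed

lemma hilbert_pair_cnj:
  assumes "hilbert_pair f g"
  shows "hilbert_pair (\<lambda>t. cnj (f t)) (\<lambda>t. cnj (g t))"
proof -
  have swap: "(\<integral>t. cnj (h t) * k t \<partial>lborel) = cnj (\<integral>t. h t * cnj (k t) \<partial>lborel)" for h k :: "real \<Rightarrow> complex"
    using Bochner_Integration.integral_cnj[of lborel "\<lambda>t. h t * cnj (k t)"] by simp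
  show ?thesis
    using assms by (simp add: hilbert_pair_def swap sym_hilbert_cnj)
qed

text \<open>In the limit of the cutoffs, the pairing of \<open>g\<close> with a resolvent is
  \<open>\<i>\<close> times that of \<open>f\<close>. Multiplying by \<open>\<i>\<close> once more
  cancels the pairing of \<open>f\<close>.\<close>

lemma hilbert_pair_hardy:
  assumes fg: "hilbert_pair f g"
  shows "hardy (\<lambda>t. f t + \<i> * g t)"
  unfolding hardy_def
proof (intro conjI allI impI)
  have f: "integrable lborel f" and g: "integrable lborel g" using fg by (auto simp: hilbert_pair_def)
  show "integrable lborel (\<lambda>t. f t + \<i> * g t)" using f g by simp
  show "(\<integral>t. f t + \<i> * g t \<partial>lborel) = 0" using f g fg by (simp add: hilbert_pair_def)
  fix a :: real assume a: "a > 0"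
  have cm: "resolvent_cutoff a n \<in> borel_measurable borel" for n
    using test_function_resolvent_cutoff[of a n] unfolding test_function_iff
    by (auto intro: borel_measurable_continuous_onI smooth_continuous)
  have "(\<lambda>n. \<integral>t. g t * resolvent_cutoff a n t \<partial>lborel) \<longlonglongrightarrow> (\<integral>t. g t * (resolvent a t * complex_of_real (exp (- 2))) \<partial>lborel)"
    by (rule tendsto_integral_mult_bounded[OF g, where B=1])
      (use cm resolvent_cutoff_tendsto order_trans[OF norm_resolvent_cutoff_le norm_resolvent_le] in auto)
  moreover have "(\<integral>t. g t * resolvent_cutoff a n t \<partial>lborel) = (\<integral>t. f t * sym_hilbert (resolvent_cutoff a n) t \<partial>lborel)" for n
    using fg a by (simp add: hilbert_pair_def)
  ultimately have "(\<integral>t. g t * (resolvent a t * complex_of_real (exp (- 2))) \<partial>lborel) = (\<integral>t. f t * (\<i> * (resolvent a t * complex_of_real (exp (- 2)))) \<partial>lborel)"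
    using sym_hilbert_cutoff_limit[OF a f] by (simp add: LIMSEQ_unique)
  moreover have "(\<integral>t. g t * (resolvent a t * complex_of_real (exp (- 2))) \<partial>lborel) = (\<integral>t. g t * resolvent a t \<partial>lborel) * complex_of_real (exp (- 2))"
    unfolding mult.assoc[symmetric] by (rule integral_mult_left_zero)
  moreover have "(\<integral>t. f t * (\<i> * (resolvent a t * complex_of_real (exp (- 2)))) \<partial>lborel) = \<i> * (\<integral>t. f t * resolvent a t \<partial>lborel) * complex_of_real (exp (- 2))"
  proof -
    have "f t * (\<i> * (resolvent a t * complex_of_real (exp (- 2)))) = (\<i> * (f t * resolvent a t)) * complex_of_real (exp (- 2))" for t
      by (simp add: mult_ac)
    then show ?thesis by (simp only: integral_mult_left_zero integral_mult_right_zero)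
  qed
  ultimately have e: "(\<integral>t. g t * resolvent a t \<partial>lborel) = \<i> * (\<integral>t. f t * resolvent a t \<partial>lborel)" by simp
  have "(\<integral>t. (f t + \<i> * g t) * resolvent a t \<partial>lborel) = (\<integral>t. f t * resolvent a t \<partial>lborel) + \<i> * (\<integral>t. g t * resolvent a t \<partial>lborel)"
    using integrable_mult_resolvent[OF f] integrable_mult_resolvent[OF g] by (simp add: distrib_right mult.assoc)
  then show "(\<integral>t. (f t + \<i> * g t) * resolvent a t \<partial>lborel) = 0" unfolding e by (simp add: mult.assoc[symmetric])
qed

lemma test_function_cnj:
  assumes "test_function \<phi>"
  shows "test_function (\<lambda>t. cnj (\<phi> t))"
proof -
  obtain D where D: "D 0 = \<phi>" "\<And>k x. (D k has_vector_derivative D (Suc k) x) (at x)"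
    and c: "compact (closure {x. \<phi> x \<noteq> 0})"
    using assms by (auto simp: test_function_def)
  have "((\<lambda>t. cnj (D k t)) has_vector_derivative cnj (D (Suc k) x)) (at x)" for k x
    using D(2) by (rule bounded_linear.has_vector_derivative[OF bounded_linear_cnj])
  then show ?thesis
    unfolding test_function_def using D(1) c by (intro conjI exI[of _ "\<lambda>k t. cnj (D k t)"]) auto
qed

lemma test_function_props:
  assumes "test_function \<phi>"
  shows "\<phi> \<in> borel_measurable borel" "\<exists>K. \<forall>t. norm (\<phi> t) \<le> K" "integrable lborel \<phi>"
proof -
  have c: "continuous_on UNIV \<phi>" and k: "compact (closure {x. \<phi> x \<noteq> 0})"
    using assms by (auto simp: test_function_iff smooth_continuous)
  show m: "\<phi> \<in> borel_measurable borel" using c by (rule borel_measurable_continuous_onI)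
  have "bounded (\<phi> ` closure {x. \<phi> x \<noteq> 0})"
    using k c by (intro compact_imp_bounded compact_continuous_image) (auto intro: continuous_on_subset)
  then obtain K where K: "\<And>t. t \<in> closure {x. \<phi> x \<noteq> 0} \<Longrightarrow> norm (\<phi> t) \<le> K" unfolding bounded_iff by blast
  have bd: "norm (\<phi> t) \<le> \<bar>K\<bar>" for t
  proof (cases "\<phi> t = 0")
    case False
    then have "t \<in> closure {x. \<phi> x \<noteq> 0}" using closure_subset[of "{x. \<phi> x \<noteq> 0}"] by auto
    then show ?thesis using K[of t] by linarith
  qed simp
  then show "\<exists>K. \<forall>t. norm (\<phi> t) \<le> K" by blast
  have "integrable lborel (\<lambda>t. indicator (closure {x. \<phi> x \<noteq> 0}) t *\<^sub>R \<phi> t)"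
    using k c by (intro borel_integrable_compact) (auto intro: continuous_on_subset)
  moreover have "indicator (closure {x. \<phi> x \<noteq> 0}) t *\<^sub>R \<phi> t = \<phi> t" for t
    using closure_subset[of "{x. \<phi> x \<noteq> 0}"] by (auto simp: indicator_def)
  ultimately show "integrable lborel \<phi>" by simp
qed

text \<open>\<open>sym_hilbert\<close> is the transpose of the Hilbert transform: the truncation is
  moved onto \<open>\<phi>\<close> by Fubini and removed there, where the domination and the
  Lipschitz bound on \<open>\<phi>\<close> provide the majorant.\<close>

lemma has_hilbert_transform_test:
  assumes f: "integrable lborel f" and g: "integrable lborel g"
    and \<nu>: "\<And>B. B \<in> sets borel \<Longrightarrow> \<nu> B = curve_measure (\<lambda>t. t) f B"
    and \<rho>: "\<And>B. B \<in> sets borel \<Longrightarrow> \<rho> B = curve_measure (\<lambda>t. t) g B"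
    and H: "has_hilbert_transform \<nu> \<rho>" and \<phi>: "test_function \<phi>"
    and a: "a > 0" and dom: "\<And>x. norm (\<phi> x) \<le> norm (resolvent a x)"
    and lip: "\<And>x y. norm (\<phi> x - \<phi> y) \<le> (a + 4) * \<bar>x - y\<bar>"
  shows "(\<integral>t. g t * \<phi> t \<partial>lborel) = (\<integral>t. f t * sym_hilbert \<phi> t \<partial>lborel)"
proof -
  obtain K where K: "\<And>t. norm (\<phi> t) \<le> K" using test_function_props(2)[OF \<phi>] by blast
  have m: "\<phi> \<in> borel_measurable borel" and int: "integrable lborel \<phi>" using test_function_props[OF \<phi>] by auto
  define \<epsilon> where "\<epsilon> n = 1 / real (Suc n)" for n
  have \<epsilon>: "\<epsilon> n > 0" for n by (simp add: \<epsilon>_def)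
  have \<epsilon>0: "\<epsilon> \<longlonglongrightarrow> 0" unfolding \<epsilon>_def by (rule LIMSEQ_Suc[OF lim_const_over_n])
  have "filterlim \<epsilon> (at_right 0) sequentially"
    using \<epsilon> \<epsilon>0 unfolding filterlim_at by (auto simp: less_imp_neq[symmetric])
  moreover have "((\<lambda>\<epsilon>. \<integral>x. hilbert_truncated \<nu> \<epsilon> x * \<phi> x \<partial>lborel) \<longlongrightarrow> cm_integral \<rho> \<phi>) (at_right 0)"
    using H \<phi> by (simp add: has_hilbert_transform_def)
  ultimately have "(\<lambda>n. \<integral>x. hilbert_truncated \<nu> (\<epsilon> n) x * \<phi> x \<partial>lborel) \<longlonglongrightarrow> cm_integral \<rho> \<phi>"
    by (rule filterlim_compose[rotated])
  moreover have "cm_integral \<rho> \<phi> = (\<integral>t. g t * \<phi> t \<partial>lborel)"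
  proof -
    have "cm_integral \<rho> \<phi> = cm_integral (curve_measure (\<lambda>t. t) g) \<phi>"
      by (rule cm_integral_cong) (rule \<rho>)
    also have "\<dots> = (\<integral>t. g t * \<phi> t \<partial>lborel)"
      by (rule cm_integral_curve[OF g, where q="\<lambda>t. t" and K=K]) (use m K in auto)
    finally show ?thesis .
  qed
  moreover have "(\<integral>x. hilbert_truncated \<nu> (\<epsilon> n) x * \<phi> x \<partial>lborel)
      = (\<integral>t. f t * (complex_of_real (1 / pi) * (\<integral>x. \<phi> x * pv_kernel (\<epsilon> n) (x - t) \<partial>lborel)) \<partial>lborel)" for n
  proof -
    have "(\<integral>x. hilbert_truncated \<nu> (\<epsilon> n) x * \<phi> x \<partial>lborel)
      = (\<integral>x. complex_of_real (1 / pi) * ((\<integral>t. f t * pv_kernel (\<epsilon> n) (x - t) \<partial>lborel) * \<phi> x) \<partial>lborel)"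
      by (simp only: hilbert_truncated_curve[OF f \<nu> \<epsilon>] mult.assoc)
    also have "\<dots> = complex_of_real (1 / pi) * (\<integral>t. f t * (\<integral>x. \<phi> x * pv_kernel (\<epsilon> n) (x - t) \<partial>lborel) \<partial>lborel)"
      by (simp only: integral_mult_right_zero hilbert_truncated_Fubini[OF f int \<epsilon>])
    also have "\<dots> = (\<integral>t. complex_of_real (1 / pi) * (f t * (\<integral>x. \<phi> x * pv_kernel (\<epsilon> n) (x - t) \<partial>lborel)) \<partial>lborel)"
      by (simp only: integral_mult_right_zero)
    also have "\<dots> = (\<integral>t. f t * (complex_of_real (1 / pi) * (\<integral>x. \<phi> x * pv_kernel (\<epsilon> n) (x - t) \<partial>lborel)) \<partial>lborel)"
      by (simp only: mult.left_commute)
    finally show ?thesis .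
  qed
  ultimately show ?thesis
    using sym_hilbert_limits[OF a dom lip m int f \<epsilon> \<epsilon>0] by (simp add: LIMSEQ_unique)
qed

lemma has_hilbert_transform_pair:
  assumes f: "integrable lborel f" "(\<integral>t. f t \<partial>lborel) = 0" and g: "integrable lborel g" "(\<integral>t. g t \<partial>lborel) = 0"
    and \<nu>: "\<And>B. B \<in> sets borel \<Longrightarrow> \<nu> B = curve_measure (\<lambda>t. t) f B"
    and \<rho>: "\<And>B. B \<in> sets borel \<Longrightarrow> \<rho> B = curve_measure (\<lambda>t. t) g B"
    and H: "has_hilbert_transform \<nu> \<rho>"
  shows "hilbert_pair f g"
  unfolding hilbert_pair_def
proof (intro conjI allI impI f g)
  fix a :: real and n assume a: "a > 0"
  show "(\<integral>t. g t * resolvent_cutoff a n t \<partial>lborel) = (\<integral>t. f t * sym_hilbert (resolvent_cutoff a n) t \<partial>lborel)"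
    by (rule has_hilbert_transform_test[OF f(1) g(1) \<nu> \<rho> H test_function_resolvent_cutoff a
        norm_resolvent_cutoff_le resolvent_cutoff_lipschitz[OF a]])
  have lip: "norm (cnj (resolvent_cutoff a n x) - cnj (resolvent_cutoff a n y)) \<le> (a + 4) * \<bar>x - y\<bar>" for x y
    using resolvent_cutoff_lipschitz[OF a, of n x y] by (metis complex_cnj_diff complex_mod_cnj)
  show "(\<integral>t. g t * cnj (resolvent_cutoff a n t) \<partial>lborel) = (\<integral>t. f t * sym_hilbert (\<lambda>t. cnj (resolvent_cutoff a n t)) t \<partial>lborel)"
    by (rule has_hilbert_transform_test[OF f(1) g(1) \<nu> \<rho> H test_function_cnj[OF test_function_resolvent_cutoff] a _ lip])
      (auto simp: norm_resolvent_cutoff_le)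
qed

subsection \<open>Point evaluation by Cauchy kernels\<close>

definition cresolvent :: "real \<Rightarrow> complex \<Rightarrow> complex" where
  "cresolvent a z = 1 / (1 - \<i> * complex_of_real a * z)"

lemma resolvent_eq_cresolvent: "resolvent a t = cresolvent a (complex_of_real t)"
  by (simp add: resolvent_def cresolvent_def mult.assoc)

definition chyp_approx :: "real \<Rightarrow> real \<Rightarrow> nat \<Rightarrow> complex \<Rightarrow> complex" where
  "chyp_approx a b n z = cresolvent (a / real (Suc n)) z ^ Suc n *
     (if b = 0 then 1 else 1 - cresolvent (real (Suc n) / b) z) ^ Suc n"

text \<open>For \<open>z\<close> in the upper half-plane both \<open>a * z\<close> and
  \<open>- (b / z)\<close> have nonnegative imaginary part, so the limit of powers applies to each
  factor as it does on the real line.\<close>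

lemma tendsto_chyp_approx:
  assumes z: "Im z > 0" and ab: "a \<ge> 0" "b \<ge> 0"
  shows "(\<lambda>n. chyp_approx a b n z) \<longlonglongrightarrow> exp (\<i> * (complex_of_real a * z - complex_of_real b / z))"
proof -
  have z0: "z \<noteq> 0" using z by auto
  have 1: "cresolvent (a / real (Suc n)) z = 1 / (1 - \<i> * (complex_of_real a * z / of_nat (Suc n)))" for n
    by (simp add: cresolvent_def del: of_nat_Suc)
  have 2: "(if b = 0 then 1 else 1 - cresolvent (real (Suc n) / b) z) = 1 / (1 - \<i> * (- (complex_of_real b / z) / of_nat (Suc n)))" for n
  proof (cases "b = 0")
    case False
    define N where "N = (of_nat (Suc n) :: complex)"
    have N: "N \<noteq> 0" "complex_of_real (real (Suc n)) = N" by (simp_all add: N_def del: of_nat_Suc)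
    define B where "B = complex_of_real b"
    have B: "B \<noteq> 0" using False by (simp add: B_def)
    have d: "B - \<i> * N * z \<noteq> 0"
    proof
      assume "B - \<i> * N * z = 0"
      then have "Re (B - \<i> * N * z) = 0" by simp
      then have "b + real (Suc n) * Im z = 0" by (simp add: B_def N_def)
      moreover have "real (Suc n) * Im z > 0" using z by (simp del: of_nat_Suc)
      ultimately show False using ab(2) by linarith
    qed
    have "1 - cresolvent (real (Suc n) / b) z = 1 - 1 / (1 - \<i> * (N / B) * z)"
      unfolding cresolvent_def of_real_divide N(2) B_def ..
    also have "1 - \<i> * (N / B) * z = (B - \<i> * N * z) / B" using B by (simp add: field_simps)
    also have "1 - 1 / ((B - \<i> * N * z) / B) = - \<i> * N * z / (B - \<i> * N * z)" using d by (simp add: field_simps)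
    also have "\<dots> = 1 / (1 - \<i> * (- (B / z) / N))"
    proof -
      have "1 - \<i> * (- (B / z) / N) = (B - \<i> * N * z) / (- \<i> * N * z)"
        using z0 N(1) by (simp add: field_simps)
      then show ?thesis by simp
    qed
    finally show ?thesis using False by (simp add: N_def B_def del: of_nat_Suc)
  qed simp
  have "Im (complex_of_real a * z) \<ge> 0" using z ab by simp
  moreover have "Im (- (complex_of_real b / z)) \<ge> 0"
    using z ab by (simp add: Im_divide)
  ultimately have "(\<lambda>n. chyp_approx a b n z) \<longlonglongrightarrow> exp (\<i> * (complex_of_real a * z)) * exp (\<i> * - (complex_of_real b / z))"
    unfolding chyp_approx_def 1 2 by (intro tendsto_mult tendsto_inverse_power_exp)
  then show ?thesis by (simp add: exp_add[symmetric] right_diff_distrib)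
qed

text \<open>The pair \<open>(p, w)\<close> stands for a function \<open>p\<close> holomorphic in the upper half-plane and its value \<open>w\<close>
  at \<open>z\<close>: then \<open>(p - w) / (t - z)\<close> is holomorphic there, too.\<close>

definition has_value :: "complex \<Rightarrow> (real \<Rightarrow> complex) \<Rightarrow> complex \<Rightarrow> bool" where
  "has_value z p w \<longleftrightarrow> hardy (\<lambda>t. (p t - w) * (cauchy_kernel z t - cauchy_kernel (- \<i>) t))"

lemma has_value_one: "has_value z (\<lambda>t. 1) 1"
  by (simp add: has_value_def hardy_def)

lemma cresolvent_denom: "Im z > 0 \<Longrightarrow> a \<ge> 0 \<Longrightarrow> 1 - \<i> * complex_of_real a * z \<noteq> 0"
proof
  assume z: "Im z > 0" "a \<ge> 0" and "1 - \<i> * complex_of_real a * z = 0"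
  then have "Re (1 - \<i> * complex_of_real a * z) = 0" by simp
  then have "1 + a * Im z = 0" by simp
  moreover have "a * Im z \<ge> 0" using z by simp
  ultimately show False by linarith
qed

text \<open>Write \<open>p * r - w * r(z)\<close> as \<open>(p - w) * r + w * (r - r(z))\<close>
  with \<open>r\<close> the resolvent. The first term is covered by
  \<open>hardy_mult_resolvent\<close>. In the second, \<open>r - r(z)\<close> contains the factor
  \<open>t - z\<close>, which removes the pole and leaves a multiple of
  \<open>resolvent a t * resolvent 1 t\<close>. The kernel at \<open>- \<i>\<close>, subtracted for
  integrability, is a multiple of \<open>resolvent 1\<close>.\<close>

lemma has_value_mult_resolvent:
  assumes z: "Im z > 0" and a: "a > 0" and p: "has_value z p w"
  shows "has_value z (\<lambda>t. p t * resolvent a t) (w * cresolvent a z)"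
proof -
  define k where "k t = cauchy_kernel z t - cauchy_kernel (- \<i>) t" for t
  have dz: "1 - \<i> * complex_of_real a * z \<noteq> 0" using cresolvent_denom[OF z] a by simp
  have i1: "cauchy_kernel (- \<i>) t = - \<i> * resolvent 1 t" for t
    using resolvent_eq_cauchy_kernel[of 1 t] by simp
  have k: "(resolvent a t - cresolvent a z) * k t = (complex_of_real a * cresolvent a z * (z + \<i>)) * (resolvent a t * resolvent 1 t)" for t
  proof -
    have c: "complex_of_real t - z \<noteq> 0" using z by (intro cauchy_denom_nonzero) simp
    have da: "1 - \<i> * complex_of_real a * complex_of_real t \<noteq> 0"
      using resolvent_denom_nonzero[of "a * t"] by (simp add: mult.assoc)
    have 1: "resolvent a t - cresolvent a z = \<i> * complex_of_real a * (complex_of_real t - z) * (resolvent a t * cresolvent a z)"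
      unfolding resolvent_eq_cresolvent cresolvent_def using dz da
      by (simp add: divide_simps) (simp add: algebra_simps)
    have 2: "k t = (z + \<i>) * (cauchy_kernel z t * cauchy_kernel (- \<i>) t)"
      using cauchy_kernel_diff[of z "- \<i>" t] z by (simp add: k_def)
    have 3: "(complex_of_real t - z) * cauchy_kernel z t = 1" using c by (simp add: cauchy_kernel_def)
    have "(resolvent a t - cresolvent a z) * k t
       = \<i> * complex_of_real a * (resolvent a t * cresolvent a z) * (z + \<i>) * cauchy_kernel (- \<i>) t * ((complex_of_real t - z) * cauchy_kernel z t)"
      unfolding 1 2 by (simp only: mult_ac)
    also have "\<dots> = complex_of_real a * cresolvent a z * (z + \<i>) * (resolvent a t * (\<i> * cauchy_kernel (- \<i>) t))"
      unfolding 3 by (simp only: mult_ac mult_1_left mult_1_right)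
    also have "\<i> * cauchy_kernel (- \<i>) t = resolvent 1 t" unfolding i1 by simp
    finally show ?thesis .
  qed
  have "hardy (\<lambda>t. ((p t - w) * k t) * resolvent a t + w * ((complex_of_real a * cresolvent a z * (z + \<i>)) * (resolvent a t * resolvent 1 t)))"
    using p a unfolding has_value_def k_def
    by (intro hardy_add hardy_mult_resolvent hardy_cmult hardy_resolvent_mult) auto
  then have "hardy (\<lambda>t. ((p t - w) * k t) * resolvent a t + w * ((resolvent a t - cresolvent a z) * k t))"
    unfolding k .
  moreover have "((p t - w) * k t) * resolvent a t + w * ((resolvent a t - cresolvent a z) * k t) = (p t * resolvent a t - w * cresolvent a z) * k t" for t
    by (simp add: algebra_simps)
  ultimately show ?thesis by (simp add: has_value_def k_def)
qed

lemma has_value_mult_one_minus_resolvent: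
  assumes z: "Im z > 0" and a: "a > 0" and p: "has_value z p w"
  shows "has_value z (\<lambda>t. p t * (1 - resolvent a t)) (w * (1 - cresolvent a z))"
proof -
  have "hardy (\<lambda>t. (p t - w) * (cauchy_kernel z t - cauchy_kernel (- \<i>) t)
     - (p t * resolvent a t - w * cresolvent a z) * (cauchy_kernel z t - cauchy_kernel (- \<i>) t))"
    using p has_value_mult_resolvent[OF z a p] unfolding has_value_def by (rule hardy_diff)
  moreover have "(p t - w) * K - (p t * resolvent a t - w * cresolvent a z) * K = (p t * (1 - resolvent a t) - w * (1 - cresolvent a z)) * K" for t K
    by (simp add: algebra_simps)
  ultimately show ?thesis by (simp add: has_value_def)
qed

lemma has_value_mult_resolvent_power:
  assumes "Im z > 0" "a > 0" "has_value z p w"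
  shows "has_value z (\<lambda>t. p t * resolvent a t ^ n) (w * cresolvent a z ^ n)"
proof (induction n)
  case (Suc n)
  show ?case using has_value_mult_resolvent[OF assms(1,2) Suc] by (simp only: power_Suc2 mult.assoc)
qed (use assms in simp)

lemma has_value_mult_one_minus_resolvent_power:
  assumes "Im z > 0" "a > 0" "has_value z p w"
  shows "has_value z (\<lambda>t. p t * (1 - resolvent a t) ^ n) (w * (1 - cresolvent a z) ^ n)"
proof (induction n)
  case (Suc n)
  show ?case using has_value_mult_one_minus_resolvent[OF assms(1,2) Suc] by (simp only: power_Suc2 mult.assoc)
qed (use assms in simp)

lemma has_value_hyp_approx:
  assumes z: "Im z > 0" and ab: "a \<ge> 0" "b \<ge> 0"
  shows "has_value z (hyp_approx a b n) (chyp_approx a b n z)"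
proof -
  have 1: "has_value z (\<lambda>t. resolvent (a / real (Suc n)) t ^ Suc n) (cresolvent (a / real (Suc n)) z ^ Suc n)"
  proof (cases "a = 0")
    case True
    then show ?thesis using has_value_one by (simp add: resolvent_def cresolvent_def)
  next
    case False
    then have "a / real (Suc n) > 0" using ab by simp
    from has_value_mult_resolvent_power[OF z this has_value_one, of "Suc n"] show ?thesis by simp
  qed
  show ?thesis
  proof (cases "b = 0")
    case True
    then show ?thesis using 1 by (simp add: hyp_approx_def[abs_def] chyp_approx_def)
  next
    case False
    then have "real (Suc n) / b > 0" using ab by simp
    from has_value_mult_one_minus_resolvent_power[OF z this 1, of "Suc n"] show ?thesis
      using False by (simp add: hyp_approx_def[abs_def] chyp_approx_def)
  qed
qed

text \<open>Cauchy's formula at \<open>z\<close>, obtained for the rational approximants from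
  \<open>has_value\<close> and carried to the limit. The kernel at \<open>- \<i>\<close> has its
  pole in the lower half-plane and contributes only convergence.\<close>

lemma integral_cauchy_hyp_exp:
  assumes z: "Im z > 0" and ab: "a \<ge> 0" "b \<ge> 0"
  shows "(\<integral>t. (cauchy_kernel z t - cauchy_kernel (- \<i>) t) * hyp_exp a b t \<partial>lborel)
    = 2 * pi * \<i> * exp (\<i> * (complex_of_real a * z - complex_of_real b / z))"
proof -
  define k where "k t = cauchy_kernel z t - cauchy_kernel (- \<i>) t" for t
  have int: "integrable lborel k" unfolding k_def using z by (intro integrable_cauchy_kernel_diff) auto
  have k: "(\<integral>t. k t \<partial>lborel) = 2 * pi * \<i>"
    unfolding k_def using z by (subst integral_cauchy_kernel_diff) auto
  have "(\<integral>t. k t * hyp_approx a b n t \<partial>lborel) = 2 * pi * \<i> * chyp_approx a b n z" for n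
  proof -
    have "hardy (\<lambda>t. (hyp_approx a b n t - chyp_approx a b n z) * k t)"
      using has_value_hyp_approx[OF z ab] by (simp add: has_value_def k_def)
    then have "0 = (\<integral>t. (hyp_approx a b n t - chyp_approx a b n z) * k t \<partial>lborel)" by (simp add: hardy_def)
    also have "\<dots> = (\<integral>t. k t * hyp_approx a b n t - chyp_approx a b n z * k t \<partial>lborel)"
      by (simp add: algebra_simps)
    also have "\<dots> = (\<integral>t. k t * hyp_approx a b n t \<partial>lborel) - chyp_approx a b n z * (2 * pi * \<i>)"
    proof -
      have "integrable lborel (\<lambda>t. k t * hyp_approx a b n t)"
        by (rule integrable_mult_bounded[OF int, where B=1]) (auto simp: norm_hyp_approx_le)
      then show ?thesis using int k by simp
    qed
    finally show ?thesis by (simp add: mult.commute)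
  qed
  then have "(\<lambda>n. 2 * pi * \<i> * chyp_approx a b n z) \<longlonglongrightarrow> (\<integral>t. k t * hyp_exp a b t \<partial>lborel)"
    using tendsto_integral_hyp_approx[OF int, of a b] by simp
  moreover have "(\<lambda>n. 2 * pi * \<i> * chyp_approx a b n z) \<longlonglongrightarrow> 2 * pi * \<i> * exp (\<i> * (complex_of_real a * z - complex_of_real b / z))"
    by (intro tendsto_intros tendsto_chyp_approx z ab)
  ultimately show ?thesis unfolding k_def by (rule LIMSEQ_unique)
qed

section \<open>The Hilbert transform of a difference of Cauchy kernels\<close>

lemma diff_quot_cauchy_kernel:
  assumes "Im z \<noteq> 0" "u \<noteq> 0"
  shows "diff_quot (cauchy_kernel z) x u = - 2 * (cauchy_kernel z (x + u) * cauchy_kernel z (x - u))"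
proof -
  have "complex_of_real (x + u) - z \<noteq> 0" "complex_of_real (x - u) - z \<noteq> 0"
    using assms by (auto intro!: cauchy_denom_nonzero simp del: of_real_add of_real_diff)
  then have n: "complex_of_real x + complex_of_real u - z \<noteq> 0" "complex_of_real x - complex_of_real u - z \<noteq> 0" by simp_all
  then show ?thesis using assms(2)
    unfolding diff_quot_def cauchy_kernel_def of_real_add of_real_diff
    by (simp add: divide_simps)
qed

lemma integral_cauchy_kernel_reflected:
  assumes z: "Im z > 0"
  shows "integrable lborel (\<lambda>u. cauchy_kernel z (x + u) * cauchy_kernel z (x - u))"
    and "(\<integral>u. cauchy_kernel z (x + u) * cauchy_kernel z (x - u) \<partial>lborel) = pi * \<i> * cauchy_kernel z x"
proof -
  define A where "A = complex_of_real x - z"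
  have A: "A \<noteq> 0" unfolding A_def using z by (intro cauchy_denom_nonzero) simp
  have Im: "Im (- A) = Im z" "Im A = - Im z" by (simp_all add: A_def)
  have e: "cauchy_kernel z (x + u) * cauchy_kernel z (x - u) = (1 / (2 * A)) * (cauchy_kernel (- A) u - cauchy_kernel A u)" for u
  proof -
    have n: "complex_of_real u - - A \<noteq> 0" "complex_of_real u - A \<noteq> 0"
      by (rule cauchy_denom_nonzero; use Im z in simp)+
    then have n': "complex_of_real u + A \<noteq> 0" "A - complex_of_real u \<noteq> 0" by auto
    have "cauchy_kernel z (x + u) = 1 / (complex_of_real u + A)" "cauchy_kernel z (x - u) = 1 / (A - complex_of_real u)"
      by (simp_all add: cauchy_kernel_def A_def algebra_simps)
    moreover have "cauchy_kernel (- A) u = 1 / (complex_of_real u + A)" by (simp add: cauchy_kernel_def)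
    moreover have "cauchy_kernel A u = - (1 / (A - complex_of_real u))"
      using n(2) n'(2) by (simp add: cauchy_kernel_def divide_simps)
    moreover have "1 / p * (1 / q) = 1 / (2 * A) * (1 / p - - (1 / q))" if "p \<noteq> 0" "q \<noteq> 0" "p + q = 2 * A" for p q
    proof -
      have "1 / p - - (1 / q) = (p + q) / (p * q)" using that(1,2) by (simp add: field_simps)
      then show ?thesis unfolding that(3) using A by simp
    qed
    ultimately show ?thesis using n' by simp
  qed
  show "integrable lborel (\<lambda>u. cauchy_kernel z (x + u) * cauchy_kernel z (x - u))"
    unfolding e using z by (intro integrable_mult_right integrable_cauchy_kernel_diff) (simp_all add: Im)
  have "(\<integral>u. cauchy_kernel z (x + u) * cauchy_kernel z (x - u) \<partial>lborel) = (1 / (2 * A)) * (\<integral>u. cauchy_kernel (- A) u - cauchy_kernel A u \<partial>lborel)"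
    unfolding e by simp
  also have "(\<integral>u. cauchy_kernel (- A) u - cauchy_kernel A u \<partial>lborel) = 2 * pi * \<i>"
    using z by (subst integral_cauchy_kernel_diff) (simp_all add: Im)
  finally have "(\<integral>u. cauchy_kernel z (x + u) * cauchy_kernel z (x - u) \<partial>lborel) = (1 / (2 * A)) * (2 * pi * \<i>)" .
  note integral = this
  show "(\<integral>u. cauchy_kernel z (x + u) * cauchy_kernel z (x - u) \<partial>lborel) = pi * \<i> * cauchy_kernel z x"
  proof -
    have "cauchy_kernel z x = 1 / A" by (simp add: cauchy_kernel_def A_def)
    moreover have "(1 / (2 * A)) * (2 * pi * \<i>) = pi * \<i> * (1 / A)" by simp
    ultimately show ?thesis using integral by (simp only:)
  qed
qed

definition kernel_major :: "complex \<Rightarrow> real \<Rightarrow> real \<Rightarrow> real" where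
  "kernel_major z x u = (norm (cauchy_kernel z (x + u)))\<^sup>2 + (norm (cauchy_kernel z (x - u)))\<^sup>2"

lemma kernel_major_integral:
  assumes z: "Im z > 0"
  shows "integrable lborel (kernel_major z x)"
    and "(\<integral>u. kernel_major z x u \<partial>lborel) = 2 * (\<integral>u. (norm (cauchy_kernel z u))\<^sup>2 \<partial>lborel)"
proof -
  have i: "integrable lborel (\<lambda>u. (norm (cauchy_kernel z u))\<^sup>2)"
    using z by (intro integrable_norm_cauchy_kernel_square) simp
  have i1: "integrable lborel (\<lambda>u. (norm (cauchy_kernel z (x + u)))\<^sup>2)"
    using lborel_integrable_translate[OF i, of x] by (simp add: add.commute)
  have i2: "integrable lborel (\<lambda>u. (norm (cauchy_kernel z (x - u)))\<^sup>2)"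
    by (rule lborel_integrable_reflect[OF i])
  show "integrable lborel (kernel_major z x)" unfolding kernel_major_def by (intro Bochner_Integration.integrable_add i1 i2)
  have "(\<integral>u. (norm (cauchy_kernel z (x + u)))\<^sup>2 \<partial>lborel) = (\<integral>u. (norm (cauchy_kernel z u))\<^sup>2 \<partial>lborel)"
    using lborel_integral_real_affine[of 1 "\<lambda>u. (norm (cauchy_kernel z u))\<^sup>2" x] by simp
  moreover have "(\<integral>u. (norm (cauchy_kernel z (x - u)))\<^sup>2 \<partial>lborel) = (\<integral>u. (norm (cauchy_kernel z u))\<^sup>2 \<partial>lborel)"
    using lborel_integral_real_affine[of "-1" "\<lambda>u. (norm (cauchy_kernel z u))\<^sup>2" x] by simp
  ultimately show "(\<integral>u. kernel_major z x u \<partial>lborel) = 2 * (\<integral>u. (norm (cauchy_kernel z u))\<^sup>2 \<partial>lborel)"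
    unfolding kernel_major_def Bochner_Integration.integral_add[OF i1 i2] by simp
qed

lemma kernel_major_nonneg: "0 \<le> kernel_major z x u"
  by (simp add: kernel_major_def)

text \<open>With both poles in the upper half-plane, \<open>f\<close> extends holomorphically to the
  lower one and is an eigenfunction with eigenvalue \<open>\<i>\<close>. In the computation, the
  difference quotient of a Cauchy kernel factorizes, its integral gives
  \<open>- 2 * pi * \<i> * f x\<close>, and the orientation of the kernel supplies the factor
  \<open>- 1 / (2 * pi)\<close>.\<close>

lemma has_hilbert_transform_cauchy_kernel:
  assumes z: "Im z > 0" and w: "Im w > 0"
  defines "f \<equiv> \<lambda>t. cauchy_kernel z t - cauchy_kernel w t"
  shows "has_hilbert_transform (curve_measure (\<lambda>t. t) f) (curve_measure (\<lambda>t. t) (\<lambda>t. \<i> * f t))"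
  unfolding has_hilbert_transform_def
proof (intro allI impI)
  fix \<phi> assume \<phi>: "test_function \<phi>"
  obtain K where K: "\<And>t. norm (\<phi> t) \<le> K" using test_function_props(2)[OF \<phi>] by blast
  have m[measurable]: "\<phi> \<in> borel_measurable borel" and ip: "integrable lborel \<phi>" using test_function_props[OF \<phi>] by auto
  have int: "integrable lborel f" unfolding f_def using z w by (intro integrable_cauchy_kernel_diff) auto
  have fm[measurable]: "f \<in> borel_measurable borel" using int by auto
  have cm: "cm_integral (curve_measure (\<lambda>t. t) (\<lambda>t. \<i> * f t)) \<phi> = (\<integral>t. \<phi> t * (\<i> * f t) \<partial>lborel)"
  proof -
    have "cm_integral (curve_measure (\<lambda>t. t) (\<lambda>t. \<i> * f t)) \<phi> = (\<integral>t. \<i> * f t * \<phi> t \<partial>lborel)"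
      by (rule cm_integral_curve[where q="\<lambda>t. t" and K=K]) (use m K int in auto)
    then show ?thesis by (simp add: mult_ac)
  qed
  define M where "M x u = 2 * kernel_major z x u + 2 * kernel_major w x u" for x u
  have intM: "integrable lborel (M x)" for x
    unfolding M_def using kernel_major_integral(1)[OF z] kernel_major_integral(1)[OF w] by simp
  define C where "C = 4 * (\<integral>u. (norm (cauchy_kernel z u))\<^sup>2 \<partial>lborel) + 4 * (\<integral>u. (norm (cauchy_kernel w u))\<^sup>2 \<partial>lborel)"
  have iM: "(\<integral>u. M x u \<partial>lborel) = C" for x
    unfolding M_def C_def using kernel_major_integral[OF z, of x] kernel_major_integral[OF w, of x] by simp
  have dq: "diff_quot f x u = - 2 * (cauchy_kernel z (x + u) * cauchy_kernel z (x - u)) - - 2 * (cauchy_kernel w (x + u) * cauchy_kernel w (x - u))"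
    if "u \<noteq> 0" for x u
  proof -
    have "diff_quot f x u = diff_quot (cauchy_kernel z) x u - diff_quot (cauchy_kernel w) x u"
      by (simp add: diff_quot_def f_def diff_divide_distrib)
    then show ?thesis using z w that by (simp add: diff_quot_cauchy_kernel)
  qed
  have bound: "norm (diff_quot f x u) \<le> M x u" for x u
  proof (cases "u = 0")
    case True
    then show ?thesis by (simp add: diff_quot_def M_def kernel_major_nonneg)
  next
    case False
    have km: "norm (- 2 * (cauchy_kernel v (x + u) * cauchy_kernel v (x - u))) \<le> 2 * kernel_major v x u" for v
    proof -
      have "2 * norm (cauchy_kernel v (x + u)) * norm (cauchy_kernel v (x - u)) \<le> kernel_major v x u"
        unfolding kernel_major_def by (rule sum_squares_bound)
      moreover have "norm (- 2 * (cauchy_kernel v (x + u) * cauchy_kernel v (x - u))) = 2 * norm (cauchy_kernel v (x + u)) * norm (cauchy_kernel v (x - u))"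
        by (simp add: norm_mult)
      ultimately show ?thesis using kernel_major_nonneg[of v x u] by linarith
    qed
    show ?thesis unfolding dq[OF False] M_def
      by (rule order_trans[OF norm_triangle_ineq4]) (intro add_mono km)
  qed
  have M0: "0 \<le> M x u" for x u by (simp add: M_def kernel_major_nonneg)
  have dm: "diff_quot f x \<in> borel_measurable borel" for x unfolding diff_quot_def by measurable
  have val: "(\<integral>u. diff_quot f x u \<partial>lborel) = - 2 * pi * \<i> * f x" for x
  proof -
    have "(\<integral>u. diff_quot f x u \<partial>lborel) = (\<integral>u. - 2 * (cauchy_kernel z (x + u) * cauchy_kernel z (x - u)) - - 2 * (cauchy_kernel w (x + u) * cauchy_kernel w (x - u)) \<partial>lborel)"
    proof (rule integral_cong_AE)
      show "AE u in lborel. diff_quot f x u = - 2 * (cauchy_kernel z (x + u) * cauchy_kernel z (x - u)) - - 2 * (cauchy_kernel w (x + u) * cauchy_kernel w (x - u))"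
        using AE_lborel_singleton[of "0::real"] by eventually_elim (rule dq)
    qed (use dm in auto)
    also have "\<dots> = - 2 * (pi * \<i> * cauchy_kernel z x) - - 2 * (pi * \<i> * cauchy_kernel w x)"
      using integral_cauchy_kernel_reflected[OF z, of x] integral_cauchy_kernel_reflected[OF w, of x]
      by (subst Bochner_Integration.integral_diff) simp_all
    finally show ?thesis by (simp add: f_def algebra_simps)
  qed
  show "((\<lambda>\<epsilon>. \<integral>x. hilbert_truncated (curve_measure (\<lambda>t. t) f) \<epsilon> x * \<phi> x \<partial>lborel)
      \<longlongrightarrow> cm_integral (curve_measure (\<lambda>t. t) (\<lambda>t. \<i> * f t)) \<phi>) (at_right 0)"
  proof (rule tendsto_at_right_sequentially[of 0 1])
    fix S :: "nat \<Rightarrow> real" assume S: "\<And>n. 0 < S n" "S \<longlonglongrightarrow> 0"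
    have tr: "hilbert_truncated (curve_measure (\<lambda>t. t) f) (S n) x = complex_of_real (1 / pi) * (\<integral>t. f t * pv_kernel (S n) (x - t) \<partial>lborel)" for n x
      by (rule hilbert_truncated_curve[OF int _ S(1)]) simp
    have tr': "complex_of_real (1 / pi) * (\<integral>t. f t * pv_kernel (S n) (x - t) \<partial>lborel)
       = - complex_of_real (1 / (2 * pi)) * (\<integral>u. (if \<bar>u\<bar> > S n then diff_quot f x u else 0) \<partial>lborel)" for n x
    proof -
      have "f t * pv_kernel (S n) (x - t) = - (f t * pv_kernel (S n) (t - x))" for t
        using pv_kernel_minus[of "S n" "t - x"] by simp
      then have "(\<integral>t. f t * pv_kernel (S n) (x - t) \<partial>lborel) = - ((\<integral>u. (if \<bar>u\<bar> > S n then diff_quot f x u else 0) \<partial>lborel) / 2)"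
        using pv_symmetrize[OF int S(1)[of n], of x] by simp
      then show ?thesis by simp
    qed
    have "(\<lambda>n. \<integral>x. \<phi> x * hilbert_truncated (curve_measure (\<lambda>t. t) f) (S n) x \<partial>lborel) \<longlonglongrightarrow> (\<integral>x. \<phi> x * (\<i> * f x) \<partial>lborel)"
    proof (rule tendsto_integral_mult_bounded[OF ip, where B="1 / (2 * pi) * C"])
      show "hilbert_truncated (curve_measure (\<lambda>t. t) f) (S n) \<in> borel_measurable lborel" for n
        unfolding tr by measurable
      show "norm (hilbert_truncated (curve_measure (\<lambda>t. t) f) (S n) x) \<le> 1 / (2 * pi) * C" for n x
      proof -
        have "norm (\<integral>u. (if \<bar>u\<bar> > S n then diff_quot f x u else 0) \<partial>lborel) \<le> (\<integral>u. M x u \<partial>lborel)"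
        proof (rule Bochner_Integration.integral_norm_bound_integral)
          show "integrable lborel (\<lambda>u. if \<bar>u\<bar> > S n then diff_quot f x u else 0)"
            by (rule Bochner_Integration.integrable_bound[OF intM[of x]])
              (use dm[of x] bound[of x] M0[of x] in auto)
          show "norm (if \<bar>u\<bar> > S n then diff_quot f x u else 0) \<le> M x u" for u
            using bound[of x u] M0[of x u] by simp
        qed (rule intM)
        then show ?thesis
          unfolding tr tr' norm_mult norm_minus_cancel norm_of_real iM
          by (simp only: abs_of_nonneg divide_nonneg_nonneg zero_le_one mult_nonneg_nonneg zero_le_numeral pi_ge_zero mult_left_mono)
      qed
      have lim: "(\<lambda>n. \<integral>u. (if \<bar>u\<bar> > S n then diff_quot f x u else 0) \<partial>lborel) \<longlonglongrightarrow> (\<integral>u. diff_quot f x u \<partial>lborel)" for x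
      proof (rule integral_dominated_convergence[where w="M x"])
        show "AE u in lborel. norm (if \<bar>u\<bar> > S n then diff_quot f x u else 0) \<le> M x u" for n
          using bound[of x] M0[of x] by (intro AE_I2) simp
        show "AE u in lborel. (\<lambda>n. if \<bar>u\<bar> > S n then diff_quot f x u else 0) \<longlonglongrightarrow> diff_quot f x u"
          using AE_lborel_singleton[of "0::real"]
        proof eventually_elim
          case (elim u)
          then have "\<forall>\<^sub>F n in sequentially. S n < \<bar>u\<bar>" using S(2) by (intro order_tendstoD) auto
          then have "\<forall>\<^sub>F n in sequentially. (if \<bar>u\<bar> > S n then diff_quot f x u else 0) = diff_quot f x u"
            by eventually_elim simp
          then show ?case by (rule tendsto_eventually)
        qed
      qed (use dm intM in auto)
      have "- complex_of_real (1 / (2 * pi)) * (\<integral>u. diff_quot f x u \<partial>lborel) = \<i> * f x" for x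
        unfolding val by simp
      then show "AE x in lborel. (\<lambda>n. hilbert_truncated (curve_measure (\<lambda>t. t) f) (S n) x) \<longlonglongrightarrow> \<i> * f x"
        unfolding tr tr' using tendsto_mult[OF tendsto_const lim, of "- complex_of_real (1 / (2 * pi))"] by (intro AE_I2) simp
    qed measurable
    then show "(\<lambda>n. \<integral>x. hilbert_truncated (curve_measure (\<lambda>t. t) f) (S n) x * \<phi> x \<partial>lborel) \<longlonglongrightarrow> cm_integral (curve_measure (\<lambda>t. t) (\<lambda>t. \<i> * f t)) \<phi>"
      unfolding cm by (simp add: mult.commute)
  qed simp
qed

subsection \<open>The lattice-cross\<close>

lemma fourier_density:
  assumes f: "integrable lborel f" and \<mu>: "\<And>B. B \<in> sets borel \<Longrightarrow> \<mu> B = curve_measure (hyperbola_point m) f B"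
  shows "fourier \<mu> \<xi> = (\<integral>t. f t * hyp_exp (pi * fst \<xi>) (pi * (m\<^sup>2 / (4 * pi\<^sup>2)) * snd \<xi>) t \<partial>lborel)"
proof -
  define h where "h x = exp (\<i> * complex_of_real (pi * (x \<bullet> \<xi>)))" for x
  have hm: "h \<in> borel_measurable borel"
    unfolding h_def by (intro borel_measurable_continuous_onI continuous_intros)
  have "fourier \<mu> \<xi> = cm_integral (curve_measure (hyperbola_point m) f) h"
    unfolding fourier_def h_def[symmetric] by (rule cm_integral_cong) (rule \<mu>)
  also have "\<dots> = (\<integral>t. f t * h (hyperbola_point m t) \<partial>lborel)"
  proof (rule cm_integral_curve[OF f, where q=fst and K=1])
    show "fst \<in> (borel :: (real \<times> real) measure) \<rightarrow>\<^sub>M borel"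
      by (intro borel_measurable_continuous_onI continuous_intros)
    show "fst (hyperbola_point m t) = t" for t by (simp add: hyperbola_point_def)
    show "norm (h x) \<le> 1" for x by (simp add: h_def)
  qed (use hm in auto)
  finally have 1: "fourier \<mu> \<xi> = (\<integral>t. f t * h (hyperbola_point m t) \<partial>lborel)" .
  have "h (hyperbola_point m t) = hyp_exp (pi * fst \<xi>) (pi * (m\<^sup>2 / (4 * pi\<^sup>2)) * snd \<xi>) t" for t
  proof -
    have "pi * (hyperbola_point m t \<bullet> \<xi>) = pi * fst \<xi> * t - pi * (m\<^sup>2 / (4 * pi\<^sup>2)) * snd \<xi> / t"
      by (cases \<xi>) (simp add: hyperbola_point_def algebra_simps)
    then show ?thesis by (simp add: h_def hyp_exp_def)
  qed
  then show ?thesis unfolding 1 by simp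
qed

lemma hyp_exp_minus: "hyp_exp (- a) (- b) t = cnj (hyp_exp a b t)"
  by (simp add: hyp_exp_def exp_cnj algebra_simps)

lemma closure_quadrant_pp: "closure quadrant_pp = {\<xi>. 0 \<le> fst \<xi> \<and> 0 \<le> snd \<xi>}"
proof -
  have eq: "quadrant_pp = {0<..} \<times> {0<..}" by (auto simp: quadrant_pp_def)
  have "closure quadrant_pp = {0..} \<times> {0..}" unfolding eq closure_Times by simp
  then show ?thesis by (simp add: set_eq_iff mem_Times_iff)
qed

lemma closure_quadrant_mm: "closure quadrant_mm = {\<xi>. fst \<xi> \<le> 0 \<and> snd \<xi> \<le> 0}"
proof -
  have eq: "quadrant_mm = {..<0} \<times> {..<0}" by (auto simp: quadrant_mm_def)
  have "closure quadrant_mm = {..0} \<times> {..0}" unfolding eq closure_Times by simp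
  then show ?thesis by (simp add: set_eq_iff mem_Times_iff)
qed

text \<open>The Hardy space parts of \<open>f\<close>: \<open>f + \<i> g\<close> is orthogonal to all \<open>hyp_exp a b\<close> with \<open>a, b \<ge> 0\<close>, and
  \<open>f - \<i> g\<close> to their conjugates, so that \<open>f - \<i> g\<close> is orthogonal to the whole lattice.\<close>

lemma hilbert_pair_uniqueness:
  assumes pos: "\<alpha> > 0" "\<beta> > 0" "c > 0" and crit: "\<alpha> * \<beta> * c \<le> 1" and fg: "hilbert_pair f g"
    and zero1: "\<And>j::nat. (\<integral>t. f t * hyp_exp (pi * (\<alpha> * real j)) 0 t \<partial>lborel) = 0"
    and zero2: "\<And>k::nat. (\<integral>t. f t * hyp_exp 0 (pi * c * (\<beta> * real k)) t \<partial>lborel) = 0"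
    and ab: "a \<ge> 0" "b \<ge> 0"
  shows "(\<integral>t. f t * hyp_exp a b t \<partial>lborel) = 0"
proof -
  have f: "integrable lborel f" and g: "integrable lborel g" using fg by (auto simp: hilbert_pair_def)
  define P where "P t = f t + \<i> * g t" for t
  define N where "N t = f t - \<i> * g t" for t
  have iN: "integrable lborel N" and iP: "integrable lborel P" using f g by (simp_all add: N_def[abs_def] P_def[abs_def])
  have mult: "integrable lborel (\<lambda>t. F t * hyp_exp a b t)" if "integrable lborel F" for F a b
    by (rule integrable_mult_bounded[OF that, where B=1]) auto
  have P: "(\<integral>t. P t * hyp_exp a b t \<partial>lborel) = 0" if "a \<ge> 0" "b \<ge> 0" for a b
    using integral_hardy_hyp_exp[OF hilbert_pair_hardy[OF fg] that] by (simp add: P_def)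
  have Nminus: "(\<integral>t. N t * hyp_exp (- a) (- b) t \<partial>lborel) = 0" if "a \<ge> 0" "b \<ge> 0" for a b
  proof -
    have "(\<integral>t. cnj (N t) * hyp_exp a b t \<partial>lborel) = 0"
      using integral_hardy_hyp_exp[OF hilbert_pair_hardy[OF hilbert_pair_cnj[OF fg]] that] by (simp add: N_def)
    moreover have "cnj (\<integral>t. cnj (N t) * hyp_exp a b t \<partial>lborel) = (\<integral>t. N t * hyp_exp (- a) (- b) t \<partial>lborel)"
      using Bochner_Integration.integral_cnj[of lborel "\<lambda>t. cnj (N t) * hyp_exp a b t"] by (simp add: hyp_exp_minus)
    ultimately show ?thesis by simp
  qed
  have sum: "(\<integral>t. N t * hyp_exp a b t \<partial>lborel) + (\<integral>t. P t * hyp_exp a b t \<partial>lborel) = 2 * (\<integral>t. f t * hyp_exp a b t \<partial>lborel)" for a b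
  proof -
    have "(\<integral>t. N t * hyp_exp a b t \<partial>lborel) + (\<integral>t. P t * hyp_exp a b t \<partial>lborel) = (\<integral>t. N t * hyp_exp a b t + P t * hyp_exp a b t \<partial>lborel)"
      by (rule Bochner_Integration.integral_add[symmetric]) (intro mult iN iP)+
    also have "\<dots> = (\<integral>t. 2 * (f t * hyp_exp a b t) \<partial>lborel)"
      by (intro Bochner_Integration.integral_cong) (auto simp: N_def P_def algebra_simps)
    finally show ?thesis by simp
  qed
  have lattice1: "(\<integral>t. N t * hyp_exp (pi * (\<alpha> * of_int j)) 0 t \<partial>lborel) = 0" for j :: int
  proof (cases "j \<ge> 0")
    case True
    then obtain n where n: "j = int n" using nonneg_int_cases by blast
    show ?thesis using sum[of "pi * (\<alpha> * of_int j)" 0] P[of "pi * (\<alpha> * of_int j)" 0] zero1[of n] pos by (simp add: n)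
  next
    case False
    then have "0 \<le> pi * (\<alpha> * of_int (- j))" using pos by (intro mult_nonneg_nonneg) auto
    from Nminus[OF this, of 0] show ?thesis by simp
  qed
  have lattice2: "(\<integral>t. N t * hyp_exp 0 (pi * c * (\<beta> * of_int j)) t \<partial>lborel) = 0" for j :: int
  proof (cases "j \<ge> 0")
    case True
    then obtain n where n: "j = int n" using nonneg_int_cases by blast
    show ?thesis using sum[of 0 "pi * c * (\<beta> * of_int j)"] P[of 0 "pi * c * (\<beta> * of_int j)"] zero2[of n] pos by (simp add: n)
  next
    case False
    then have "0 \<le> pi * c * (\<beta> * of_int (- j))" using pos by (intro mult_nonneg_nonneg) auto
    from Nminus[of 0, OF _ this] show ?thesis by simp
  qed
  \<comment> \<open>Rescaling the variable by \<open>\<alpha>\<close> gives the characters on the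
    first axis period 2 and moves all parameters of the second axis into the single number
    \<open>\<alpha> * \<beta> * c\<close>.\<close>
  define F where "F t = N (t / \<alpha>)" for t
  have scale: "(\<integral>t. F t * h (t / \<alpha>) \<partial>lborel) = complex_of_real \<alpha> * (\<integral>t. N t * h t \<partial>lborel)" for h
    using lborel_integral_real_affine[of "\<alpha>" "\<lambda>t. F t * h (t / \<alpha>)" 0] pos by (simp add: F_def scaleR_conv_of_real)
  have "AE t in lborel. F t = 0"
  proof (rule L1_lattice_uniqueness[of "\<alpha> * \<beta> * c"])
    show "0 < \<alpha> * \<beta> * c" "\<alpha> * \<beta> * c \<le> 1" using pos crit by auto
    show "integrable lborel F"
      unfolding F_def using lborel_integrable_real_affine[OF iN, of "1 / \<alpha>" 0] pos by simp
    show "(\<integral>t. F t * cis (pi * of_int j * t) \<partial>lborel) = 0" for j :: int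
    proof -
      have "cis (pi * of_int j * t) = hyp_exp (pi * (\<alpha> * of_int j)) 0 (t / \<alpha>)" for t
        using pos by (simp add: hyp_exp_def cis_conv_exp field_simps)
      then show ?thesis using scale[of "hyp_exp (pi * (\<alpha> * of_int j)) 0"] lattice1[of j] by simp
    qed
    show "(\<integral>t. F t * cis (- (pi * of_int j * (\<alpha> * \<beta> * c) / t)) \<partial>lborel) = 0" for j :: int
    proof -
      have "cis (- (pi * of_int j * (\<alpha> * \<beta> * c) / t)) = hyp_exp 0 (pi * c * (\<beta> * of_int j)) (t / \<alpha>)" for t
        by (simp add: hyp_exp_def cis_conv_exp mult_ac)
      then show ?thesis using scale[of "hyp_exp 0 (pi * c * (\<beta> * of_int j))"] lattice2[of j] by simp
    qed
  qed
  then have "AE t in lborel. F t * hyp_exp a b (t / \<alpha>) = 0" by eventually_elim simp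
  then have "(\<integral>t. F t * hyp_exp a b (t / \<alpha>) \<partial>lborel) = 0" by (rule integral_eq_zero_AE)
  then have "(\<integral>t. N t * hyp_exp a b t \<partial>lborel) = 0" using scale[of "hyp_exp a b"] pos by simp
  then show ?thesis using sum[of a b] P[OF ab] by simp
qed

text \<open>For \<open>\<alpha> \<beta> c > 1\<close> the translations by 2 in the variables \<open>\<alpha> t\<close> and \<open>- \<beta> c / t\<close> compose to an elliptic
  Moebius transformation.  The points below are its fixed point in the upper half-plane and the translate
  of the fixed point; all exponentials of the lattice-cross take equal values at the two points.\<close>

lemma supercritical_points:
  fixes \<alpha> \<beta> c :: real
  assumes pos: "\<alpha> > 0" "\<beta> > 0" "c > 0" and crit: "\<alpha> * \<beta> * c > 1"
  obtains z w where "Im z > 0" "Im w > 0"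
    "complex_of_real \<alpha> * z = complex_of_real \<alpha> * w + 2"
    "complex_of_real (c * \<beta>) / z = complex_of_real (c * \<beta>) / w + 2"
    "Re (complex_of_real \<alpha> * z) = 1"
proof
  \<comment> \<open>Chosen so that \<open>\<alpha> * z\<close> and \<open>\<alpha> * w\<close> have
    squared modulus \<open>1 + y\<^sup>2 = \<alpha> * \<beta> * c\<close>. Then
    \<open>c * \<beta> / z\<close> is the conjugate of \<open>\<alpha> * z\<close>, and likewise for
    \<open>w\<close>; conjugation keeps real parts, so the translation by 2 holds in both
    coordinates.\<close>
  define y where "y = sqrt (\<alpha> * \<beta> * c - 1)"
  have y: "y > 0" "y\<^sup>2 = \<alpha> * \<beta> * c - 1" using crit by (auto simp: y_def)
  define z w where "z = Complex 1 y / complex_of_real \<alpha>" and "w = Complex (- 1) y / complex_of_real \<alpha>"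
  have az: "complex_of_real \<alpha> * z = Complex 1 y" and aw: "complex_of_real \<alpha> * w = Complex (- 1) y"
    using pos by (simp_all add: z_def w_def)
  show "Im z > 0" "Im w > 0" using pos y by (simp_all add: z_def w_def)
  show "complex_of_real \<alpha> * z = complex_of_real \<alpha> * w + 2" unfolding az aw by (simp add: complex_eq_iff)
  show "Re (complex_of_real \<alpha> * z) = 1" unfolding az by simp
  have g: "\<alpha> * (c * \<beta>) = 1 + y\<^sup>2" using y by (simp add: mult_ac)
  have n: "Complex 1 y \<noteq> 0" "Complex (- 1) y \<noteq> 0" by (simp_all add: complex_eq_iff)
  have "complex_of_real (c * \<beta>) / z = complex_of_real (\<alpha> * (c * \<beta>)) / Complex 1 y"
    by (simp add: z_def)
  also have "\<dots> = Complex 1 (- y)"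
    unfolding g using n by (simp add: divide_eq_eq) (simp add: complex_eq_iff power2_eq_square)
  finally have 1: "complex_of_real (c * \<beta>) / z = Complex 1 (- y)" .
  have "complex_of_real (c * \<beta>) / w = complex_of_real (\<alpha> * (c * \<beta>)) / Complex (- 1) y"
    by (simp add: w_def)
  also have "\<dots> = Complex (- 1) (- y)"
    unfolding g using n by (simp add: divide_eq_eq) (simp add: complex_eq_iff power2_eq_square)
  finally have 2: "complex_of_real (c * \<beta>) / w = Complex (- 1) (- y)" .
  show "complex_of_real (c * \<beta>) / z = complex_of_real (c * \<beta>) / w + 2" unfolding 1 2 by (simp add: complex_eq_iff)
qed

lemma exp_2pi_int: "exp (\<i> * (complex_of_real (pi * of_int j) * (u + 2))) = exp (\<i> * (complex_of_real (pi * of_int j) * u))"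
  unfolding exp_eq by (intro exI[of _ j]) (simp add: algebra_simps)

lemma supercritical_density:
  fixes \<alpha> \<beta> c :: real
  assumes pos: "\<alpha> > 0" "\<beta> > 0" "c > 0" and crit: "\<alpha> * \<beta> * c > 1"
  obtains f where "integrable lborel f" "(\<integral>t. f t \<partial>lborel) = 0"
    "has_hilbert_transform (curve_measure (\<lambda>t. t) f) (curve_measure (\<lambda>t. t) (\<lambda>t. \<i> * f t))"
    "\<And>j::nat. (\<integral>t. f t * hyp_exp (pi * (\<alpha> * real j)) 0 t \<partial>lborel) = 0"
    "\<And>k::nat. (\<integral>t. f t * hyp_exp 0 (pi * c * (\<beta> * real k)) t \<partial>lborel) = 0"
    "(\<integral>t. f t * hyp_exp (pi * (\<alpha> / 2)) 0 t \<partial>lborel) \<noteq> 0"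
proof -
  obtain z w where z: "Im z > 0" and w: "Im w > 0"
    and e1: "complex_of_real \<alpha> * z = complex_of_real \<alpha> * w + 2"
    and e2: "complex_of_real (c * \<beta>) / z = complex_of_real (c * \<beta>) / w + 2"
    and re: "Re (complex_of_real \<alpha> * z) = 1"
    using supercritical_points[OF pos crit] by metis
  define f where "f t = cauchy_kernel z t - cauchy_kernel w t" for t
  have int: "integrable lborel f" unfolding f_def using z w by (intro integrable_cauchy_kernel_diff) auto
  define V where "V a b z = exp (\<i> * (complex_of_real a * z - complex_of_real b / z))" for a b z
  \<comment> \<open>The auxiliary kernel at \<open>- \<i>\<close> drops out of the difference,
    leaving the two point values.\<close>
  have val: "(\<integral>t. f t * hyp_exp a b t \<partial>lborel) = 2 * pi * \<i> * (V a b z - V a b w)" if ab: "a \<ge> 0" "b \<ge> 0" for a b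
  proof -
    have i: "integrable lborel (\<lambda>t. (cauchy_kernel v t - cauchy_kernel (- \<i>) t) * hyp_exp a b t)" if "Im v > 0" for v
      using that by (intro integrable_mult_bounded[where B=1] integrable_cauchy_kernel_diff) auto
    have "(\<integral>t. f t * hyp_exp a b t \<partial>lborel)
      = (\<integral>t. (cauchy_kernel z t - cauchy_kernel (- \<i>) t) * hyp_exp a b t - (cauchy_kernel w t - cauchy_kernel (- \<i>) t) * hyp_exp a b t \<partial>lborel)"
      by (simp add: f_def algebra_simps)
    also have "\<dots> = 2 * pi * \<i> * V a b z - 2 * pi * \<i> * V a b w"
      using i[OF z] i[OF w] integral_cauchy_hyp_exp[OF z ab] integral_cauchy_hyp_exp[OF w ab] by (simp add: V_def)
    finally show ?thesis by (simp add: right_diff_distrib)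
  qed
  show thesis
  proof (rule that)
    show "integrable lborel f" by (rule int)
    show "(\<integral>t. f t \<partial>lborel) = 0" unfolding f_def using z w by (subst integral_cauchy_kernel_diff) auto
    show "has_hilbert_transform (curve_measure (\<lambda>t. t) f) (curve_measure (\<lambda>t. t) (\<lambda>t. \<i> * f t))"
      unfolding f_def by (rule has_hilbert_transform_cauchy_kernel[OF z w])
    show "(\<integral>t. f t * hyp_exp (pi * (\<alpha> * real j)) 0 t \<partial>lborel) = 0" for j :: nat
    proof -
      have V: "V (pi * (\<alpha> * real j)) 0 v = exp (\<i> * (complex_of_real (pi * of_int (int j)) * (complex_of_real \<alpha> * v)))" for v
        by (simp add: V_def mult_ac)
      have "V (pi * (\<alpha> * real j)) 0 z = V (pi * (\<alpha> * real j)) 0 w"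
        unfolding V e1 by (rule exp_2pi_int)
      then show ?thesis using pos by (subst val) auto
    qed
    show "(\<integral>t. f t * hyp_exp 0 (pi * c * (\<beta> * real k)) t \<partial>lborel) = 0" for k :: nat
    proof -
      have V: "V 0 (pi * c * (\<beta> * real k)) v = exp (\<i> * (complex_of_real (pi * of_int (- int k)) * (complex_of_real (c * \<beta>) / v)))" for v
        by (simp add: V_def mult_ac)
      have "V 0 (pi * c * (\<beta> * real k)) z = V 0 (pi * c * (\<beta> * real k)) w"
        unfolding V e2 by (rule exp_2pi_int)
      then show ?thesis using pos by (subst val) auto
    qed
    show "(\<integral>t. f t * hyp_exp (pi * (\<alpha> / 2)) 0 t \<partial>lborel) \<noteq> 0"
    proof -
      have V: "V (pi * (\<alpha> / 2)) 0 v = exp (\<i> * (complex_of_real (pi / 2) * (complex_of_real \<alpha> * v)))" for v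
        by (simp add: V_def mult_ac)
      \<comment> \<open>Half a lattice step: translation by 2 now multiplies the exponential by
        \<open>exp (\<i> * pi) = -1\<close>, so the values at the two points are opposite and
        nonzero.\<close>
      have "V (pi * (\<alpha> / 2)) 0 z = V (pi * (\<alpha> / 2)) 0 w * exp (\<i> * complex_of_real pi)"
        unfolding V e1 exp_add[symmetric] by (simp add: algebra_simps)
      also have "\<dots> = - V (pi * (\<alpha> / 2)) 0 w" by simp
      finally have "V (pi * (\<alpha> / 2)) 0 z - V (pi * (\<alpha> / 2)) 0 w = - 2 * V (pi * (\<alpha> / 2)) 0 w" by simp
      moreover have "V (pi * (\<alpha> / 2)) 0 w \<noteq> 0" by (simp add: V_def)
      ultimately show ?thesis using pos by (subst val) auto
    qed
  qed
qed

text \<open>The principal value kernel is real, so conjugating the test function conjugates both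
  sides. This carries the counterexample from the quadrant of positive frequencies to that of
  negative ones.\<close>

lemma has_hilbert_transform_cnj:
  assumes f: "integrable lborel f" and g: "integrable lborel g"
    and H: "has_hilbert_transform (curve_measure (\<lambda>t. t) f) (curve_measure (\<lambda>t. t) g)"
  shows "has_hilbert_transform (curve_measure (\<lambda>t. t) (\<lambda>t. cnj (f t))) (curve_measure (\<lambda>t. t) (\<lambda>t. cnj (g t)))"
  unfolding has_hilbert_transform_def
proof (intro allI impI)
  fix \<phi> assume \<phi>: "test_function \<phi>"
  have \<phi>': "test_function (\<lambda>t. cnj (\<phi> t))" by (rule test_function_cnj[OF \<phi>])
  obtain K where K: "\<And>t. norm (\<phi> t) \<le> K" using test_function_props(2)[OF \<phi>] by blast
  have [measurable]: "\<phi> \<in> borel_measurable borel" "(\<lambda>t. cnj (\<phi> t)) \<in> borel_measurable borel"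
    using test_function_props(1)[OF \<phi>] test_function_props(1)[OF \<phi>'] by auto
  have swap: "(\<integral>t. cnj (h t) * k t \<partial>lborel) = cnj (\<integral>t. h t * cnj (k t) \<partial>lborel)" for h k :: "real \<Rightarrow> complex"
    using Bochner_Integration.integral_cnj[of lborel "\<lambda>t. h t * cnj (k t)"] by simp
  have cm: "cm_integral (curve_measure (\<lambda>t. t) (\<lambda>t. cnj (g t))) \<phi> = cnj (cm_integral (curve_measure (\<lambda>t. t) g) (\<lambda>t. cnj (\<phi> t)))"
  proof -
    have "cm_integral (curve_measure (\<lambda>t. t) (\<lambda>t. cnj (g t))) \<phi> = (\<integral>t. cnj (g t) * \<phi> t \<partial>lborel)"
      by (rule cm_integral_curve[where q="\<lambda>t. t" and K=K]) (use g K in auto)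
    also have "\<dots> = cnj (\<integral>t. g t * cnj (\<phi> t) \<partial>lborel)" by (rule swap)
    also have "(\<integral>t. g t * cnj (\<phi> t) \<partial>lborel) = cm_integral (curve_measure (\<lambda>t. t) g) (\<lambda>t. cnj (\<phi> t))"
      by (rule cm_integral_curve[symmetric, where q="\<lambda>t. t" and K=K]) (use g K in auto)
    finally show ?thesis .
  qed
  have tr: "hilbert_truncated (curve_measure (\<lambda>t. t) (\<lambda>t. cnj (f t))) \<epsilon> x = cnj (hilbert_truncated (curve_measure (\<lambda>t. t) f) \<epsilon> x)"
    if e: "\<epsilon> > 0" for \<epsilon> x
  proof -
    have pc: "cnj (pv_kernel \<epsilon> u) = pv_kernel \<epsilon> u" for u by (simp add: pv_kernel_def)
    have "hilbert_truncated (curve_measure (\<lambda>t. t) (\<lambda>t. cnj (f t))) \<epsilon> x = complex_of_real (1 / pi) * (\<integral>t. cnj (f t) * pv_kernel \<epsilon> (x - t) \<partial>lborel)"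
      by (rule hilbert_truncated_curve[OF _ _ e]) (use f in auto)
    also have "\<dots> = cnj (complex_of_real (1 / pi) * (\<integral>t. f t * pv_kernel \<epsilon> (x - t) \<partial>lborel))"
      by (simp add: swap pc)
    also have "complex_of_real (1 / pi) * (\<integral>t. f t * pv_kernel \<epsilon> (x - t) \<partial>lborel) = hilbert_truncated (curve_measure (\<lambda>t. t) f) \<epsilon> x"
      by (rule hilbert_truncated_curve[OF f _ e, symmetric]) simp
    finally show ?thesis .
  qed
  have "((\<lambda>\<epsilon>. cnj (\<integral>x. hilbert_truncated (curve_measure (\<lambda>t. t) f) \<epsilon> x * cnj (\<phi> x) \<partial>lborel))
      \<longlongrightarrow> cnj (cm_integral (curve_measure (\<lambda>t. t) g) (\<lambda>t. cnj (\<phi> t)))) (at_right 0)"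
    using H \<phi>' unfolding has_hilbert_transform_def by (intro tendsto_cnj) blast
  moreover have "\<forall>\<^sub>F \<epsilon> in at_right 0. cnj (\<integral>x. hilbert_truncated (curve_measure (\<lambda>t. t) f) \<epsilon> x * cnj (\<phi> x) \<partial>lborel)
     = (\<integral>x. hilbert_truncated (curve_measure (\<lambda>t. t) (\<lambda>t. cnj (f t))) \<epsilon> x * \<phi> x \<partial>lborel)"
    using eventually_at_right_less[of "0::real"] by eventually_elim (simp add: tr swap)
  ultimately show "((\<lambda>\<epsilon>. \<integral>x. hilbert_truncated (curve_measure (\<lambda>t. t) (\<lambda>t. cnj (f t))) \<epsilon> x * \<phi> x \<partial>lborel)
      \<longlongrightarrow> cm_integral (curve_measure (\<lambda>t. t) (\<lambda>t. cnj (g t))) \<phi>) (at_right 0)"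
    unfolding cm by (rule Lim_transform_eventually)
qed

section \<open>From measures in \<open>ACH m\<close> to Hilbert pairs and back\<close>

lemma curve_measure_in_ACH:
  assumes m: "m > 0" and f: "integrable lborel f" "(\<integral>t. f t \<partial>lborel) = 0" and g: "integrable lborel g" "(\<integral>t. g t \<partial>lborel) = 0"
    and H: "has_hilbert_transform (curve_measure (\<lambda>t. t) f) (curve_measure (\<lambda>t. t) g)"
  shows "curve_measure (hyperbola_point m) f \<in> ACH m"
  unfolding ACH_def
  using curve_measure_in_AC0[OF m f] curve_measure_in_AC0[OF m g] H
  by (auto simp: compression_curve_measure intro!: bexI[of _ "curve_measure (hyperbola_point m) g"])

lemma ACH_density:
  assumes m: "m > 0" and \<mu>: "\<mu> \<in> ACH m"
  obtains f g where "hilbert_pair f g" "\<And>B. B \<in> sets borel \<Longrightarrow> \<mu> B = curve_measure (hyperbola_point m) f B"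
proof -
  obtain \<rho> where \<mu>0: "\<mu> \<in> AC0 m" and \<rho>: "\<rho> \<in> AC0 m" and H: "has_hilbert_transform (compression \<mu>) (compression \<rho>)"
    using \<mu> by (auto simp: ACH_def)
  obtain f where f: "integrable lborel f" "(\<integral>t. f t \<partial>lborel) = 0"
    "\<And>B. B \<in> sets borel \<Longrightarrow> \<mu> B = curve_measure (hyperbola_point m) f B"
    "\<And>B. B \<in> sets borel \<Longrightarrow> compression \<mu> B = curve_measure (\<lambda>t. t) f B"
    using AC0_density[OF m \<mu>0] by metis
  obtain g where g: "integrable lborel g" "(\<integral>t. g t \<partial>lborel) = 0"
    "\<And>B. B \<in> sets borel \<Longrightarrow> compression \<rho> B = curve_measure (\<lambda>t. t) g B"
    using AC0_density[OF m \<rho>] by metis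
  have "hilbert_pair f g"
    by (rule has_hilbert_transform_pair[OF f(1,2) g(1,2) f(4) g(3) H])
  then show ?thesis using f(3) by (rule that)
qed

theorem theorem3p9:
  fixes m \<alpha> \<beta> :: real and Q :: "(real \<times> real) set"
  assumes "m > 0" and "\<alpha> > 0" and "\<beta> > 0"
    and "Q \<in> {quadrant_pp, quadrant_mm}"
  shows "local_fourier_uniqueness_set (lattice_cross \<alpha> \<beta> \<inter> closure Q) (closure Q) (ACH m)
     \<longleftrightarrow> \<alpha> * \<beta> * m\<^sup>2 \<le> 4 * pi\<^sup>2"
proof -
  define c where "c = m\<^sup>2 / (4 * pi\<^sup>2)"
  have pos: "\<alpha> > 0" "\<beta> > 0" "c > 0" using assms by (simp_all add: c_def)
  have crit: "\<alpha> * \<beta> * m\<^sup>2 \<le> 4 * pi\<^sup>2 \<longleftrightarrow> \<alpha> * \<beta> * c \<le> 1"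
    by (simp add: c_def divide_le_eq)
  \<comment> \<open>The sign \<open>s\<close> encodes the quadrant, so that one argument serves
    both.\<close>
  obtain s :: real where s: "s = 1 \<or> s = - 1" and Q: "closure Q = {\<xi>. 0 \<le> s * fst \<xi> \<and> 0 \<le> s * snd \<xi>}"
  proof (cases "Q = quadrant_pp")
    case True
    then show ?thesis using that[of 1] by (simp add: closure_quadrant_pp)
  next
    case False
    then have "Q = quadrant_mm" using assms(4) by simp
    then show ?thesis using that[of "- 1"] by (simp add: closure_quadrant_mm)
  qed
  \<comment> \<open>For \<open>s = -1\<close> the density is conjugated: this reverses the
    frequencies up to conjugating the integral, so vanishing at \<open>\<xi>\<close> becomes
    vanishing at \<open>s * \<xi>\<close> in the first quadrant.\<close>
  define conj where "conj f = (if s = 1 then f else (\<lambda>t. cnj (f t)))" for f :: "real \<Rightarrow> complex"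
  have conj_conj: "conj (conj f) = f" for f by (simp add: conj_def)
  have s0: "s \<noteq> 0" "s * s = 1" using s by auto
  have ss: "s * (s * x) = x" for x using s by auto
  have zero_iff: "fourier \<mu> \<xi> = 0 \<longleftrightarrow> (\<integral>t. conj f t * hyp_exp (pi * (s * fst \<xi>)) (pi * c * (s * snd \<xi>)) t \<partial>lborel) = 0"
    if f: "integrable lborel f" and \<mu>: "\<And>B. B \<in> sets borel \<Longrightarrow> \<mu> B = curve_measure (hyperbola_point m) f B" for \<mu> f \<xi>
  proof (cases "s = 1")
    case True
    then show ?thesis using fourier_density[OF f \<mu>, of \<xi>] by (simp add: conj_def c_def)
  next
    case False
    then have s: "s = - 1" using s by simp
    have "(\<integral>t. cnj (f t) * hyp_exp (- (pi * fst \<xi>)) (- (pi * c * snd \<xi>)) t \<partial>lborel)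
       = cnj (\<integral>t. f t * hyp_exp (pi * fst \<xi>) (pi * c * snd \<xi>) t \<partial>lborel)"
      using Bochner_Integration.integral_cnj[of lborel "\<lambda>t. f t * hyp_exp (pi * fst \<xi>) (pi * c * snd \<xi>) t"]
      by (simp add: hyp_exp_minus)
    then show ?thesis using fourier_density[OF f \<mu>, of \<xi>] s by (simp add: conj_def c_def)
  qed
  have lat1: "(s * (\<alpha> * real j), 0) \<in> lattice_cross \<alpha> \<beta> \<inter> closure Q" for j :: nat
  proof -
    have "(s * (\<alpha> * real j), 0) \<in> range (\<lambda>j::int. (\<alpha> * of_int j, 0::real))"
      using s by (elim disjE) (force intro: range_eqI[of _ _ "int j"], force intro: range_eqI[of _ _ "- int j"])
    then show ?thesis using pos s0 by (simp add: lattice_cross_def Q mult.assoc[symmetric])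
  qed
  have lat2: "(0, s * (\<beta> * real k)) \<in> lattice_cross \<alpha> \<beta> \<inter> closure Q" for k :: nat
  proof -
    have "(0, s * (\<beta> * real k)) \<in> range (\<lambda>k::int. (0::real, \<beta> * of_int k))"
      using s by (elim disjE) (force intro: range_eqI[of _ _ "int k"], force intro: range_eqI[of _ _ "- int k"])
    then show ?thesis using pos s0 by (simp add: lattice_cross_def Q mult.assoc[symmetric])
  qed
  have lat: "\<exists>n::nat. \<xi> = (s * (\<alpha> * real n), 0) \<or> \<xi> = (0, s * (\<beta> * real n))" if xi: "\<xi> \<in> lattice_cross \<alpha> \<beta> \<inter> closure Q" for \<xi>
  proof -
    have *: "\<exists>n::nat. a * of_int j = s * (a * real n)" if "a > 0" "0 \<le> s * (a * of_int j)" for a :: real and j :: int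
    proof -
      have "0 \<le> s * of_int j" using that by (simp add: mult.left_commute[of s a] zero_le_mult_iff)
      show ?thesis
      proof (cases "s = 1")
        case True
        then have "0 \<le> j" using \<open>0 \<le> s * of_int j\<close> by simp
        then obtain n where "j = int n" using nonneg_int_cases by blast
        then show ?thesis using True by (intro exI[of _ n]) simp
      next
        case False
        then have m: "s = - 1" using s by simp
        then have "0 \<le> - j" using \<open>0 \<le> s * of_int j\<close> by simp
        then obtain n where "- j = int n" using nonneg_int_cases by blast
        then have "j = - int n" by simp
        then show ?thesis using m by (intro exI[of _ n]) simp
      qed
    qed
    have sQ: "0 \<le> s * fst \<xi>" "0 \<le> s * snd \<xi>" using xi by (auto simp: Q)
    consider j :: int where "\<xi> = (\<alpha> * of_int j, 0)" | k :: int where "\<xi> = (0, \<beta> * of_int k)"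
      using xi unfolding lattice_cross_def by blast
    then show ?thesis
    proof cases
      case (1 j)
      then have "0 \<le> s * (\<alpha> * of_int j)" using sQ(1) by simp
      from *[OF pos(1) this] obtain n :: nat where "\<alpha> * of_int j = s * (\<alpha> * real n)" by blast
      then show ?thesis using 1 by (intro exI[of _ n] disjI1) (simp only:)
    next
      case (2 k)
      then have "0 \<le> s * (\<beta> * of_int k)" using sQ(2) by simp
      from *[OF pos(2) this] obtain n :: nat where "\<beta> * of_int k = s * (\<beta> * real n)" by blast
      then show ?thesis using 2 by (intro exI[of _ n] disjI2) (simp only:)
    qed
  qed
  show ?thesis unfolding crit
  proof
    assume uniq: "local_fourier_uniqueness_set (lattice_cross \<alpha> \<beta> \<inter> closure Q) (closure Q) (ACH m)"
    show "\<alpha> * \<beta> * c \<le> 1"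
    proof (rule ccontr)
      assume "\<not> \<alpha> * \<beta> * c \<le> 1"
      then have gt: "\<alpha> * \<beta> * c > 1" by simp
      show False
      proof (rule supercritical_density[OF pos gt])
      fix f assume f: "integrable lborel f" "(\<integral>t. f t \<partial>lborel) = 0"
        and H: "has_hilbert_transform (curve_measure (\<lambda>t. t) f) (curve_measure (\<lambda>t. t) (\<lambda>t. \<i> * f t))"
        and z1: "\<And>j::nat. (\<integral>t. f t * hyp_exp (pi * (\<alpha> * real j)) 0 t \<partial>lborel) = 0"
        and z2: "\<And>k::nat. (\<integral>t. f t * hyp_exp 0 (pi * c * (\<beta> * real k)) t \<partial>lborel) = 0"
        and nz: "(\<integral>t. f t * hyp_exp (pi * (\<alpha> / 2)) 0 t \<partial>lborel) \<noteq> 0"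
      define \<mu> where "\<mu> = curve_measure (hyperbola_point m) (conj f)"
      have cf: "integrable lborel (conj f)" "(\<integral>t. conj f t \<partial>lborel) = 0"
        using f by (auto simp: conj_def)
      have "\<mu> \<in> ACH m"
        unfolding \<mu>_def
      proof (rule curve_measure_in_ACH[OF assms(1) cf])
        show "integrable lborel (conj (\<lambda>t. \<i> * f t))" "(\<integral>t. conj (\<lambda>t. \<i> * f t) t \<partial>lborel) = 0"
          using f by (auto simp: conj_def)
        have "has_hilbert_transform (curve_measure (\<lambda>t. t) (\<lambda>t. cnj (f t))) (curve_measure (\<lambda>t. t) (\<lambda>t. cnj (\<i> * f t)))"
          by (rule has_hilbert_transform_cnj[OF f(1) _ H]) (use f in simp)
        then show "has_hilbert_transform (curve_measure (\<lambda>t. t) (conj f)) (curve_measure (\<lambda>t. t) (conj (\<lambda>t. \<i> * f t)))"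
          using H by (simp add: conj_def)
      qed
      have zi: "fourier \<mu> \<xi> = 0 \<longleftrightarrow> (\<integral>t. f t * hyp_exp (pi * (s * fst \<xi>)) (pi * c * (s * snd \<xi>)) t \<partial>lborel) = 0" for \<xi>
        using zero_iff[OF cf(1), of \<mu> \<xi>] by (simp add: \<mu>_def conj_conj)
      have "\<forall>\<xi>\<in>lattice_cross \<alpha> \<beta> \<inter> closure Q. fourier \<mu> \<xi> = 0"
      proof
        fix \<xi> assume "\<xi> \<in> lattice_cross \<alpha> \<beta> \<inter> closure Q"
        then obtain n :: nat where "\<xi> = (s * (\<alpha> * real n), 0) \<or> \<xi> = (0, s * (\<beta> * real n))" using lat by blast
        then show "fourier \<mu> \<xi> = 0"
          using z1[of n] z2[of n] by (auto simp: zi ss)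
      qed
      \<comment> \<open>The witness lies half a lattice step from the origin on the first axis:
        inside the closed quadrant, with nonzero transform.\<close>
      moreover have "(s * (\<alpha> / 2), 0) \<in> closure Q" using pos by (simp add: Q ss del: times_divide_eq_right)
      ultimately have "fourier \<mu> (s * (\<alpha> / 2), 0) = 0"
        using uniq \<open>\<mu> \<in> ACH m\<close> unfolding local_fourier_uniqueness_set_def by blast
      then show False using nz by (simp add: zi ss del: times_divide_eq_right)
      qed
    qed
  next
    assume le: "\<alpha> * \<beta> * c \<le> 1"
    show "local_fourier_uniqueness_set (lattice_cross \<alpha> \<beta> \<inter> closure Q) (closure Q) (ACH m)"
      unfolding local_fourier_uniqueness_set_def
    proof (intro conjI ballI impI)
      fix \<mu> \<xi> assume \<mu>: "\<mu> \<in> ACH m" and zero: "\<forall>\<xi>\<in>lattice_cross \<alpha> \<beta> \<inter> closure Q. fourier \<mu> \<xi> = 0" and \<xi>: "\<xi> \<in> closure Q"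
      show "fourier \<mu> \<xi> = 0"
      proof (rule ACH_density[OF assms(1) \<mu>])
      fix f g assume fg: "hilbert_pair f g" and rep: "\<And>B. B \<in> sets borel \<Longrightarrow> \<mu> B = curve_measure (hyperbola_point m) f B"
      have f: "integrable lborel f" using fg by (simp add: hilbert_pair_def)
      have cfg: "hilbert_pair (conj f) (conj g)" using fg hilbert_pair_cnj[OF fg] by (simp add: conj_def)
      have "(\<integral>t. conj f t * hyp_exp (pi * (s * fst \<xi>)) (pi * c * (s * snd \<xi>)) t \<partial>lborel) = 0"
      proof (rule hilbert_pair_uniqueness[OF pos le cfg])
        show "(\<integral>t. conj f t * hyp_exp (pi * (\<alpha> * real j)) 0 t \<partial>lborel) = 0" for j :: nat
          using zero lat1[of j] zero_iff[OF f rep, of "(s * (\<alpha> * real j), 0)"] by (simp add: ss)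
        show "(\<integral>t. conj f t * hyp_exp 0 (pi * c * (\<beta> * real k)) t \<partial>lborel) = 0" for k :: nat
          using zero lat2[of k] zero_iff[OF f rep, of "(0, s * (\<beta> * real k))"] by (simp add: ss)
        show "0 \<le> pi * (s * fst \<xi>)" "0 \<le> pi * c * (s * snd \<xi>)" using \<xi> pos unfolding Q by auto
      qed
      then show "fourier \<mu> \<xi> = 0" using zero_iff[OF f rep] by simp
      qed
    qed auto
  qed
qed

end
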